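(* Let $M$ be a connected Stein manifold of complex dimension $n$. Suppose that the groups $\mathrm{Aut}(M)$ and $\mathrm{Aut}(\mathbb{C}^n)$, each equipped with the compact-open topology, are isomorphic as topological groups. Then $M$ is biholomorphically equivalent to $\mathbb{C}^n$.
   Context: For a connected complex manifold $X$, $\mathrm{Aut}(X)$ denotes the group of all holomorphic automorphisms of $X$ (biholomorphic maps $X\to X$) under composition; it is a topological group with the compact-open topology. An isomorphism of topological groups is a group isomorphism that is also a homeomorphism. *)

theory Defs
  imports "HOL-Analysis.Analysis" "HOL-Algebra.Bij"
begin

section \<open>Holomorphic maps between open subsets of complex coordinate spaces\<close>

text \<open>Complex differentiability at every point of the (open) set \<open>S\<close>: the real Frechet
  derivative exists and is complex-linear.\<close>

definition holomorphic_fun_on :: "(complex^'n \<Rightarrow> complex) \<Rightarrow> (complex^'n) set \<Rightarrow> bool"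
  where "holomorphic_fun_on f S \<longleftrightarrow>
    (\<forall>z\<in>S. \<exists>D. (f has_derivative D) (at z) \<and> (\<forall>c v. D (c *s v) = c * D v))"

definition holomorphic_vec_on :: "(complex^'n \<Rightarrow> complex^'m) \<Rightarrow> (complex^'n) set \<Rightarrow> bool"
  where "holomorphic_vec_on F S \<longleftrightarrow> (\<forall>i. holomorphic_fun_on (\<lambda>z. F z $ i) S)"


section \<open>Complex manifolds and holomorphic maps\<close>

text \<open>A complex manifold of dimension \<open>CARD('n)\<close> is a topological space with a set of charts
  \<open>(U, \<phi>)\<close>; only the values of \<open>\<phi>\<close> on \<open>U\<close> matter.  The atlas need not be maximal: every notion
  below depends only on the maximal atlas it generates.\<close>

type_synonym ('a, 'n) atlas = "('a set \<times> ('a \<Rightarrow> complex^'n)) set"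

definition second_countable_space :: "'a topology \<Rightarrow> bool"
  where "second_countable_space X \<longleftrightarrow>
    (\<exists>\<B>. countable \<B> \<and> (\<forall>V\<in>\<B>. openin X V) \<and>
         (\<forall>U x. openin X U \<and> x \<in> U \<longrightarrow> (\<exists>V\<in>\<B>. x \<in> V \<and> V \<subseteq> U)))"

definition holomorphic_atlas :: "'a topology \<Rightarrow> ('a, 'n::finite) atlas \<Rightarrow> bool"
  where "holomorphic_atlas X \<A> \<longleftrightarrow>
    (\<forall>(U, \<phi>)\<in>\<A>. openin X U \<and> open (\<phi> ` U) \<and>
       homeomorphic_map (subtopology X U) (top_of_set (\<phi> ` U)) \<phi>) \<and>
    (\<Union>(U, \<phi>)\<in>\<A>. U) = topspace X \<and>
    (\<forall>(U, \<phi>)\<in>\<A>. \<forall>(V, \<psi>)\<in>\<A>.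
       holomorphic_vec_on (\<psi> \<circ> inv_into U \<phi>) (\<phi> ` (U \<inter> V)))"

definition complex_manifold :: "'a topology \<Rightarrow> ('a, 'n::finite) atlas \<Rightarrow> bool"
  where "complex_manifold X \<A> \<longleftrightarrow>
    Hausdorff_space X \<and> second_countable_space X \<and> holomorphic_atlas X \<A>"

definition holomorphic_functions :: "'a topology \<Rightarrow> ('a, 'n::finite) atlas \<Rightarrow> ('a \<Rightarrow> complex) set"
  where "holomorphic_functions X \<A> =
    {f. \<forall>(U, \<phi>)\<in>\<A>. holomorphic_fun_on (f \<circ> inv_into U \<phi>) (\<phi> ` U)}"

definition holomorphic_map ::
  "'a topology \<Rightarrow> ('a, 'n::finite) atlas \<Rightarrow> 'b topology \<Rightarrow> ('b, 'm::finite) atlas \<Rightarrow> ('a \<Rightarrow> 'b) \<Rightarrow> bool"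
  where "holomorphic_map X \<A> Y \<B> f \<longleftrightarrow> continuous_map X Y f \<and>
    (\<forall>(U, \<phi>)\<in>\<A>. \<forall>(V, \<psi>)\<in>\<B>.
       holomorphic_vec_on (\<psi> \<circ> f \<circ> inv_into U \<phi>) (\<phi> ` (U \<inter> f -` V)))"

definition biholomorphic_map ::
  "'a topology \<Rightarrow> ('a, 'n::finite) atlas \<Rightarrow> 'b topology \<Rightarrow> ('b, 'm::finite) atlas \<Rightarrow> ('a \<Rightarrow> 'b) \<Rightarrow> bool"
  where "biholomorphic_map X \<A> Y \<B> f \<longleftrightarrow>
    bij_betw f (topspace X) (topspace Y) \<and>
    holomorphic_map X \<A> Y \<B> f \<and> holomorphic_map Y \<B> X \<A> (inv_into (topspace X) f)"

definition biholomorphically_equivalent ::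
  "'a topology \<Rightarrow> ('a, 'n::finite) atlas \<Rightarrow> 'b topology \<Rightarrow> ('b, 'm::finite) atlas \<Rightarrow> bool"
  where "biholomorphically_equivalent X \<A> Y \<B> \<longleftrightarrow> (\<exists>f. biholomorphic_map X \<A> Y \<B> f)"

definition std_atlas :: "(complex^'n, 'n::finite) atlas"
  where "std_atlas = {(UNIV, id)}"


section \<open>Stein manifolds\<close>

text \<open>Classical definition: holomorphic convexity, separation of points, and local coordinates given
  by global holomorphic functions; countability at infinity is part of
  \<^const>\<open>complex_manifold\<close>.\<close>

definition holomorphic_hull :: "'a topology \<Rightarrow> ('a, 'n::finite) atlas \<Rightarrow> 'a set \<Rightarrow> 'a set"
  where "holomorphic_hull X \<A> K =
    {x \<in> topspace X. \<forall>f\<in>holomorphic_functions X \<A>. cmod (f x) \<le> (SUP y\<in>K. cmod (f y))}"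

text \<open>\<open>K \<noteq> {}\<close> because the real supremum of the empty set is unspecified; the hull of the empty set
  is empty in any case.  In the last clause, that functions form a coordinate system near \<open>x\<close> means
  that they can be added to the atlas as a chart.\<close>

definition stein_manifold :: "'a topology \<Rightarrow> ('a, 'n::finite) atlas \<Rightarrow> bool"
  where "stein_manifold X \<A> \<longleftrightarrow>
    complex_manifold X \<A> \<and>
    (\<forall>K. compactin X K \<and> K \<noteq> {} \<longrightarrow> compactin X (holomorphic_hull X \<A> K)) \<and>
    (\<forall>x\<in>topspace X. \<forall>y\<in>topspace X. x \<noteq> y \<longrightarrow> (\<exists>f\<in>holomorphic_functions X \<A>. f x \<noteq> f y)) \<and>
    (\<forall>x\<in>topspace X. \<exists>(f :: 'n \<Rightarrow> 'a \<Rightarrow> complex) V.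
       (\<forall>i. f i \<in> holomorphic_functions X \<A>) \<and> x \<in> V \<and>
       holomorphic_atlas X (insert (V, \<lambda>y. \<chi> i. f i y) \<A>))"


section \<open>The topological group of automorphisms\<close>

text \<open>Maps are taken to be extensional, so that a map on \<open>topspace X\<close> is represented by exactly one
  HOL function.\<close>

definition compact_open_topology :: "'a topology \<Rightarrow> 'b topology \<Rightarrow> ('a \<Rightarrow> 'b) topology"
  where "compact_open_topology X Y = topology_generated_by
    {{f \<in> extensional (topspace X). continuous_map X Y f \<and> f ` K \<subseteq> U} | K U.
       compactin X K \<and> openin Y U}"

definition Aut :: "'a topology \<Rightarrow> ('a, 'n::finite) atlas \<Rightarrow> ('a \<Rightarrow> 'a) set"
  where "Aut X \<A> = {f \<in> extensional (topspace X). biholomorphic_map X \<A> X \<A> f}"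

definition Aut_group :: "'a topology \<Rightarrow> ('a, 'n::finite) atlas \<Rightarrow> ('a \<Rightarrow> 'a) monoid"
  where "Aut_group X \<A> = BijGroup (topspace X) \<lparr>carrier := Aut X \<A>\<rparr>"

definition Aut_topology :: "'a topology \<Rightarrow> ('a, 'n::finite) atlas \<Rightarrow> ('a \<Rightarrow> 'a) topology"
  where "Aut_topology X \<A> = subtopology (compact_open_topology X X) (Aut X \<A>)"

definition isomorphic_topological_groups ::
  "('a, 'c) monoid_scheme \<Rightarrow> 'a topology \<Rightarrow> ('b, 'd) monoid_scheme \<Rightarrow> 'b topology \<Rightarrow> bool"
  where "isomorphic_topological_groups G S H T \<longleftrightarrow> (\<exists>h \<in> iso G H. homeomorphic_map S T h)"

end

theory Submission
  imports Defs "HOL-Complex_Analysis.Conformal_Mappings" "HOL-Real_Asymp.Real_Asymp"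
begin

text \<open>The diagonal maps of \<open>\<complex>\<^sup>n\<close> act on \<open>M\<close> through the isomorphism. Averaging over the compact torus
  \<open>T\<^sup>n\<close> of diagonal rotations decomposes holomorphic functions on \<open>M\<close> into weight functions, and these
  still separate points and provide local coordinates. A generic torus orbit is totally real of
  maximal dimension, so weight spaces have dimension at most one. Positive dilations commute with the
  torus, hence act on weight functions by characters, and the torus action extends to the complexified
  torus.

  The next goal is a fixed point of the torus. Let \<open>x\<close> be a point at which as few independent weights
  as possible occur. If the cone spanned by the weights occurring at \<open>x\<close> were not a linear space, then
  holomorphic convexity would give a limit point of \<open>x\<close> under a one-parameter flow at which fewer
  weights occur. So with each weight at \<open>x\<close> a multiple of its negative occurs as well, and some weight
  \<open>l\<close> has a nowhere vanishing weight function \<open>f\<close>. If \<open>l \<noteq> 0\<close>, flowing each point \<open>y\<close> for the time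
  \<open>log f(y)\<close> in a suitable direction gives an automorphism of \<open>M\<close> that normalizes the torus in a way
  that is impossible in \<open>Aut(\<complex>\<^sup>n)\<close>, because entire functions have only nonnegative weights. Hence all
  weights at \<open>x\<close> are zero and \<open>x\<close> is fixed.

  Near the fixed point every weight function is a monomial in \<open>n\<close> weight functions that form a chart.
  So these \<open>n\<close> functions separate all points of \<open>M\<close>, and the dilations spread the chart to a
  biholomorphic map from \<open>M\<close> onto \<open>\<complex>\<^sup>n\<close>.\<close>

section \<open>Holomorphic functions on open subsets of complex coordinate space\<close>

text \<open>The isomorphism is one of topological groups only: the transported diagonal maps act
  jointly continuously and each of them is holomorphic, but nothing makes the action holomorphic in
  the group parameter, and dilations might a priori act by unexpected characters. Hence the start
  from the compact torus, where periodicity forces integral weights, and the later reparametrization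
  of the real directions.

  A second obstacle is that a torus action on a Stein manifold may have no fixed point;
  multiplication on \<open>(\<complex> - {0})\<^sup>n\<close> is the model. No topological
  information on \<open>M\<close> is given to exclude this, so the group itself has to do it: a
  nowhere vanishing function of weight \<open>l \<noteq> 0\<close> gives automorphisms of
  \<open>M\<close> that act like monomial maps with exponent matrix \<open>1 + v l\<^sup>T\<close>,
  and \<open>v\<close> can be chosen to produce a negative entry, while exponents on
  \<open>\<complex>\<^sup>n\<close> are nonnegative. This comparison is the only place at which
  automorphisms other than the diagonal maps are carried across.\<close>

definition hol_at :: "(complex^'n \<Rightarrow> complex) \<Rightarrow> complex^'n \<Rightarrow> bool"
  where "hol_at f z \<longleftrightarrow> (\<exists>D. (f has_derivative D) (at z) \<and> (\<forall>c v. D (c *s v) = c * D v))"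

definition hol_vec_at :: "(complex^'n \<Rightarrow> complex^'m) \<Rightarrow> complex^'n \<Rightarrow> bool"
  where "hol_vec_at F z \<longleftrightarrow> (\<forall>i. hol_at (\<lambda>z. F z $ i) z)"

abbreviation dd :: "(complex^'n \<Rightarrow> complex) \<Rightarrow> complex^'n \<Rightarrow> complex^'n \<Rightarrow> complex"
  where "dd f z \<equiv> frechet_derivative f (at z)"

lemma holomorphic_fun_on_iff: "holomorphic_fun_on f S \<longleftrightarrow> (\<forall>z\<in>S. hol_at f z)"
  by (simp add: holomorphic_fun_on_def hol_at_def)

lemma holomorphic_vec_on_iff: "holomorphic_vec_on F S \<longleftrightarrow> (\<forall>z\<in>S. hol_vec_at F z)"
  by (auto simp add: holomorphic_vec_on_def holomorphic_fun_on_iff hol_vec_at_def)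

lemma norm_vector_smult: "norm (c *s v) = cmod c * norm (v :: complex^'n)"
proof -
  have "(\<Sum>i\<in>UNIV. (cmod c * cmod (v $ i))\<^sup>2) = (cmod c)\<^sup>2 * (\<Sum>i\<in>UNIV. (cmod (v $ i))\<^sup>2)"
    by (simp add: power_mult_distrib sum_distrib_left)
  then show ?thesis
    by (simp add: norm_vec_def L2_set_def norm_mult real_sqrt_mult)
qed

lemma bounded_bilinear_vector_smult: "bounded_bilinear ((*s) :: complex \<Rightarrow> complex^'n \<Rightarrow> complex^'n)"
proof
  show "\<exists>K. \<forall>(a::complex) (b::complex^'n). norm (a *s b) \<le> norm a * norm b * K"
    by (rule exI[of _ 1]) (simp add: norm_vector_smult)
qed (simp_all add: vec_eq_iff algebra_simps)

lemmas continuous_on_vector_smult [continuous_intros] =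
  bounded_bilinear.continuous_on[OF bounded_bilinear_vector_smult]

lemma vec_as_sum_axis: "(\<Sum>i\<in>UNIV. axis i (x $ i)) = (x :: 'a::real_normed_vector^'n)"
  by (simp add: vec_eq_iff axis_def sum.delta')

lemma bounded_linear_axis: "bounded_linear (axis i :: complex \<Rightarrow> complex^'n)"
  unfolding linear_conv_bounded_linear [symmetric]
  by (rule linearI) (simp_all add: vec_eq_iff axis_def)

lemma hol_atD:
  assumes "hol_at f z"
  shows "(f has_derivative dd f z) (at z)" "dd f z (c *s v) = c * dd f z v"
proof -
  obtain D where D: "(f has_derivative D) (at z)" "\<And>c v. D (c *s v) = c * D v"
    using assms unfolding hol_at_def by blast
  then have "D = dd f z"
    by (intro frechet_derivative_at)
  with D show "(f has_derivative dd f z) (at z)" "dd f z (c *s v) = c * dd f z v"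
    by simp_all
qed

lemma dd_linear:
  assumes "hol_at f z"
  shows "linear (dd f z)"
  using hol_atD(1)[OF assms] has_derivative_linear by blast

lemma hol_atI:
  assumes "(f has_derivative D) (at z)" "\<And>c v. D (c *s v) = c * D v"
  shows "hol_at f z"
  using assms unfolding hol_at_def by blast

lemma hol_at_const [simp]: "hol_at (\<lambda>_. c) z"
  by (rule hol_atI[OF has_derivative_const]) simp

lemma hol_at_coord [simp]: "hol_at (\<lambda>z. z $ i) z"
  by (rule hol_atI[OF bounded_linear_imp_has_derivative[OF bounded_linear_vec_nth]]) simp

lemma hol_at_add: "hol_at f z \<Longrightarrow> hol_at g z \<Longrightarrow> hol_at (\<lambda>z. f z + g z) z"
  by (rule hol_atI[OF has_derivative_add[OF hol_atD(1) hol_atD(1)]])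
     (simp_all add: hol_atD(2) algebra_simps)

lemma hol_at_mult: "hol_at f z \<Longrightarrow> hol_at g z \<Longrightarrow> hol_at (\<lambda>z. f z * g z) z"
  by (rule hol_atI[OF has_derivative_mult[OF hol_atD(1) hol_atD(1)]])
     (simp_all add: hol_atD(2) algebra_simps)

lemma hol_at_diff: "hol_at f z \<Longrightarrow> hol_at g z \<Longrightarrow> hol_at (\<lambda>z. f z - g z) z"
  using hol_at_add[of f z "\<lambda>z. (-1) * g z"] hol_at_mult[of "\<lambda>_. -1" z g] by simp

lemma hol_at_compose_field:
  assumes "hol_at f z" "g field_differentiable (at (f z))"
  shows "hol_at (\<lambda>z. g (f z)) z"
proof -
  obtain g' where "(g has_field_derivative g') (at (f z))"
    using assms(2) unfolding field_differentiable_def by blast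
  then have "(g has_derivative (*) g') (at (f z))"
    by (simp add: has_field_derivative_def)
  from has_derivative_compose[OF hol_atD(1)[OF assms(1)] this]
  show ?thesis
    by (rule hol_atI) (simp add: hol_atD(2)[OF assms(1)])
qed

lemma hol_vec_atE:
  assumes "hol_vec_at F z"
  obtains D where "(F has_derivative D) (at z)" "\<And>c v. D (c *s v) = c *s D v"
proof
  have 1: "hol_at (\<lambda>z. F z $ i) z" for i
    using assms by (simp add: hol_vec_at_def)
  have "((\<lambda>z. \<Sum>i\<in>UNIV. axis i (F z $ i)) has_derivative
      (\<lambda>v. \<Sum>i\<in>UNIV. axis i (dd (\<lambda>z. F z $ i) z v))) (at z)"
    by (intro has_derivative_sum bounded_linear.has_derivative[OF bounded_linear_axis] hol_atD(1) 1)
  then show "(F has_derivative (\<lambda>v. \<Sum>i\<in>UNIV. axis i (dd (\<lambda>z. F z $ i) z v))) (at z)"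
    by (simp add: vec_as_sum_axis)
  show "(\<Sum>i\<in>UNIV. axis i (dd (\<lambda>z. F z $ i) z (c *s v))) =
      c *s (\<Sum>i\<in>UNIV. axis i (dd (\<lambda>z. F z $ i) z v))" for c v
    by (simp add: hol_atD(2)[OF 1] vec_eq_iff axis_def sum.delta' if_distrib cong: if_cong)
qed

lemma hol_vec_atI:
  assumes "(F has_derivative D) (at z)" "\<And>c v. D (c *s v) = c *s D v"
  shows "hol_vec_at F z"
  unfolding hol_vec_at_def
  by (intro allI hol_atI[OF bounded_linear.has_derivative[OF bounded_linear_vec_nth assms(1)]])
     (simp add: assms(2))

lemma hol_at_compose:
  assumes "hol_vec_at F z" "hol_at f (F z)"
  shows "hol_at (\<lambda>z. f (F z)) z"
proof -
  obtain D where D: "(F has_derivative D) (at z)" "\<And>c v. D (c *s v) = c *s D v"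
    using hol_vec_atE[OF assms(1)] by blast
  from has_derivative_compose[OF D(1) hol_atD(1)[OF assms(2)]]
  show ?thesis
    by (rule hol_atI) (simp add: D(2) hol_atD(2)[OF assms(2)])
qed

lemma hol_vec_at_compose:
  assumes "hol_vec_at F z" "hol_vec_at G (F z)"
  shows "hol_vec_at (\<lambda>z. G (F z)) z"
  using assms(2) hol_at_compose[OF assms(1)] unfolding hol_vec_at_def by blast

lemma hol_at_transform:
  assumes "hol_at f z" "open S" "z \<in> S" "\<And>w. w \<in> S \<Longrightarrow> f w = g w"
  shows "hol_at g z"
proof -
  have "(g has_derivative dd f z) (at z)"
    using has_derivative_transform_within_open[OF hol_atD(1)[OF assms(1)] assms(2,3)] assms(4) by blast
  then show ?thesis
    by (rule hol_atI) (simp add: hol_atD(2)[OF assms(1)])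
qed

lemma hol_vec_at_transform:
  assumes "hol_vec_at F z" "open S" "z \<in> S" "\<And>w. w \<in> S \<Longrightarrow> F w = G w"
  shows "hol_vec_at G z"
  using assms hol_at_transform[of "\<lambda>z. F z $ _" z S] unfolding hol_vec_at_def by force

lemma hol_at_continuous: "hol_at f z \<Longrightarrow> isCont f z"
  using hol_atD(1) has_derivative_continuous by blast

section \<open>Restriction to complex lines and identity theorems\<close>

lemma hol_at_line:
  fixes f :: "complex^'n \<Rightarrow> complex"
  assumes "hol_at f (a + \<zeta> *s v)"
  shows "((\<lambda>\<zeta>. f (a + \<zeta> *s v)) has_field_derivative dd f (a + \<zeta> *s v) v) (at \<zeta>)"
proof -
  have "((\<lambda>\<zeta>. \<zeta> *s v) has_derivative (\<lambda>h. h *s v)) (at \<zeta>)"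
    by (rule bounded_linear_imp_has_derivative
        [OF bounded_bilinear.bounded_linear_left[OF bounded_bilinear_vector_smult]])
  then have "((\<lambda>\<zeta>. a + \<zeta> *s v) has_derivative (\<lambda>h. h *s v)) (at \<zeta>)"
    using has_derivative_add[OF has_derivative_const] by fastforce
  from has_derivative_compose[OF this hol_atD(1)[OF assms]]
  have "((\<lambda>\<zeta>. f (a + \<zeta> *s v)) has_derivative (\<lambda>h. dd f (a + \<zeta> *s v) (h *s v))) (at \<zeta>)" .
  moreover have "(\<lambda>h. dd f (a + \<zeta> *s v) (h *s v)) = (*) (dd f (a + \<zeta> *s v) v)"
    by (auto simp: hol_atD(2)[OF assms])
  ultimately show ?thesis
    by (simp add: has_field_derivative_def)
qed

lemma hol_line_holomorphic:
  fixes f :: "complex^'n \<Rightarrow> complex"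
  assumes "\<And>\<zeta>. \<zeta> \<in> S \<Longrightarrow> hol_at f (a + \<zeta> *s v)"
  shows "(\<lambda>\<zeta>. f (a + \<zeta> *s v)) holomorphic_on S"
  using hol_at_line[OF assms] unfolding holomorphic_on_def field_differentiable_def
  by (meson has_field_derivative_at_within)

text \<open>Analytic continuation in one variable needs a connected open domain; a complex line
  meets a convex open set in such a one.\<close>

lemma line_preimage_convex_open:
  fixes a v :: "complex^'n"
  assumes "convex B" "open B"
  shows "convex {\<zeta>. a + \<zeta> *s v \<in> B}" "open {\<zeta>. a + \<zeta> *s v \<in> B}"
proof -
  show "convex {\<zeta>. a + \<zeta> *s v \<in> B}"
  proof (rule convexI)
    fix x y :: complex and u w :: real
    assume *: "x \<in> {\<zeta>. a + \<zeta> *s v \<in> B}" "y \<in> {\<zeta>. a + \<zeta> *s v \<in> B}" "0 \<le> u" "0 \<le> w" "u + w = 1"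
    then have "u *\<^sub>R (a + x *s v) + w *\<^sub>R (a + y *s v) \<in> B"
      using convexD[OF assms(1)] by simp
    moreover have "u *\<^sub>R (a + x *s v) + w *\<^sub>R (a + y *s v) = a + (u *\<^sub>R x + w *\<^sub>R y) *s v"
    proof -
      have w: "w = 1 - u" using \<open>u + w = 1\<close> by simp
      show ?thesis by (simp add: vec_eq_iff w algebra_simps)
    qed
    ultimately show "u *\<^sub>R x + w *\<^sub>R y \<in> {\<zeta>. a + \<zeta> *s v \<in> B}" by simp
  qed
  have "continuous_on UNIV (\<lambda>\<zeta>. a + \<zeta> *s v)"
    by (intro continuous_intros)
  then show "open {\<zeta>. a + \<zeta> *s v \<in> B}"
    using open_vimage[OF assms(2)] by (auto simp: vimage_def)
qed

text \<open>On the complex line through \<open>z\<close> and a point of \<open>W\<close> the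
  function vanishes near the parameter 0, and the identity theorem of one variable carries this to
  the parameter 1.\<close>

lemma hol_identity_convex:
  fixes f :: "complex^'n \<Rightarrow> complex"
  assumes "convex B" "open B" "\<And>z. z \<in> B \<Longrightarrow> hol_at f z"
    and "open W" "W \<subseteq> B" "W \<noteq> {}" "\<And>z. z \<in> W \<Longrightarrow> f z = 0" "z \<in> B"
  shows "f z = 0"
proof -
  obtain w where w: "w \<in> W" using assms(6) by blast
  define S where "S = {\<zeta>. w + \<zeta> *s (z - w) \<in> B}"
  define S' where "S' = {\<zeta>. w + \<zeta> *s (z - w) \<in> W}"
  have "continuous_on UNIV (\<lambda>\<zeta>. w + \<zeta> *s (z - w))"
    by (intro continuous_intros)
  then have S': "open S'" "0 \<in> S'" "S' \<subseteq> S"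
    using open_vimage[OF assms(4)] w assms(5) by (auto simp: S'_def S_def vimage_def)
  have S: "open S" "convex S"
    unfolding S_def by (rule line_preimage_convex_open[OF assms(1,2)])+
  have hol: "(\<lambda>\<zeta>. f (w + \<zeta> *s (z - w))) holomorphic_on S"
    by (rule hol_line_holomorphic) (use assms(3) S_def in auto)
  have "f (w + 1 *s (z - w)) = 0"
    by (rule analytic_continuation_open[of S' S "\<lambda>\<zeta>. f (w + \<zeta> *s (z - w))" "\<lambda>_. 0"])
       (use S S'(1,3) hol assms(7,8) convex_connected[OF S(2)] ex_in_conv[THEN iffD1, OF exI, OF S'(2)] in \<open>auto simp: S_def S'_def simp del: vector_sub_rdistrib vector_ssub_ldistrib\<close>)
  then show ?thesis by simp
qed

text \<open>A totally real subspace of maximal dimension is a uniqueness set. A point \<open>\<i>b + a\<close> with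
  \<open>a, b\<close> real lies at parameter \<open>-\<i>\<close> on the line \<open>\<zeta> \<mapsto> \<i>(b + \<zeta>a)\<close>, whose real parameters
  belong to the subspace.\<close>

lemma hol_identity_imaginary:
  fixes f :: "complex^'n \<Rightarrow> complex"
  assumes hol: "\<And>z. z \<in> ball 0 r \<Longrightarrow> hol_at f z"
    and zero: "\<And>\<theta>::real^'n. (\<chi> j. \<i> * of_real (\<theta> $ j)) \<in> ball 0 r \<Longrightarrow> f (\<chi> j. \<i> * of_real (\<theta> $ j)) = 0"
    and z: "z \<in> ball 0 r"
  shows "f z = 0"
proof -
  define b where "b = (\<chi> j. \<i> * of_real (Im (z $ j)))"
  define a where "a = (\<chi> j. \<i> * complex_of_real (Re (z $ j)))"
  define S where "S = {\<zeta>. b + \<zeta> *s a \<in> ball 0 r}"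
  have S: "open S" "convex S"
    unfolding S_def by (rule line_preimage_convex_open[OF convex_ball open_ball])+
  have z_eq: "b + (-\<i>) *s a = z"
    by (simp add: vec_eq_iff a_def b_def complex_eq_iff)
  \<comment> \<open>Puts the base point of the line into the ball, so that small real parameters
    stay in \<open>S\<close> and accumulate at 0.\<close>
  have "norm b \<le> norm z"
    unfolding norm_vec_def b_def
    by (rule L2_set_mono) (auto simp: norm_mult abs_Im_le_cmod)
  then have "0 \<in> S" using z by (simp add: S_def)
  have "-\<i> \<in> S" unfolding S_def mem_Collect_eq z_eq by (rule z)
  have "0 islimpt (S \<inter> \<real>)"
  proof -
    obtain e where e: "e > 0" "ball 0 e \<subseteq> S"
      using \<open>open S\<close> \<open>0 \<in> S\<close> open_contains_ball by blast
    show ?thesis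
      unfolding islimpt_approachable
    proof (intro allI impI)
      fix d :: real assume "d > 0"
      then have "of_real (min d e / 2) \<in> S \<inter> \<real>" "of_real (min d e / 2) \<noteq> (0::complex)"
          "dist (of_real (min d e / 2)) (0::complex) < d"
        using e by (auto intro!: subsetD[OF e(2)] simp del: of_real_divide simp: norm_of_real)
      then show "\<exists>x'\<in>S \<inter> \<real>. x' \<noteq> 0 \<and> dist x' 0 < d" by blast
    qed
  qed
  moreover have "f (b + \<zeta> *s a) = 0" if \<zeta>: "\<zeta> \<in> S \<inter> \<real>" for \<zeta>
  proof -
    obtain t where t: "\<zeta> = of_real t" using \<zeta> by (auto simp: Reals_def elim!: rangeE)
    have "b + \<zeta> *s a = (\<chi> j. \<i> * of_real ((\<chi> j. Im (z $ j) + t * Re (z $ j)) $ j))"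
      by (simp add: vec_eq_iff a_def b_def t algebra_simps)
    moreover have "b + \<zeta> *s a \<in> ball 0 r" using \<zeta> by (simp add: S_def)
    ultimately show ?thesis using zero by metis
  qed
  moreover have "(\<lambda>\<zeta>. f (b + \<zeta> *s a)) holomorphic_on S"
    by (rule hol_line_holomorphic) (use hol S_def in auto)
  ultimately have "f (b + (-\<i>) *s a) = 0"
    using analytic_continuation[of "\<lambda>\<zeta>. f (b + \<zeta> *s a)" S "S \<inter> \<real>" 0 "-\<i>"]
      S \<open>0 \<in> S\<close> \<open>-\<i> \<in> S\<close> convex_connected by blast
  then show ?thesis by (simp only: z_eq)
qed

text \<open>Cauchy's inequality on a small disc in direction \<open>v\<close> bounds the difference
  of two derivatives by the difference of the functions on that disc, which is uniformly small
  because the disc is compact. Of the dependence on the parameter only continuity is asked.\<close>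

lemma continuous_on_dd:
  fixes F :: "'p::topological_space \<Rightarrow> complex^'n \<Rightarrow> complex"
  assumes "open S" and cont: "continuous_on (T \<times> S) (\<lambda>(t,z). F t z)"
    and hol: "\<And>t z. t \<in> T \<Longrightarrow> z \<in> S \<Longrightarrow> hol_at (F t) z"
  shows "continuous_on (T \<times> S) (\<lambda>(t,z). dd (F t) z v)"
  unfolding continuous_on_topological
proof (clarify, goal_cases)
  case (1 t0 z0 B)
  obtain e where e: "e > 0" "ball (dd (F t0) z0 v) e \<subseteq> B"
    using 1 open_contains_ball by metis
  obtain \<delta> where \<delta>: "\<delta> > 0" "ball z0 \<delta> \<subseteq> S"
    using 1 \<open>open S\<close> open_contains_ball by metis
  \<comment> \<open>The summand 1 avoids a zero denominator when \<open>v = 0\<close>; the factor 2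
    leaves half of \<open>\<delta>\<close> for moving \<open>z\<close>.\<close>
  define r where "r = \<delta> / (2 * (norm v + 1))"
  have r: "r > 0" "r * norm v \<le> \<delta> / 2"
    using \<delta> by (auto simp: r_def field_simps pos_divide_le_eq add_pos_nonneg)
  have inS: "z + \<zeta> *s v \<in> S" if "z \<in> ball z0 (\<delta>/2)" "\<zeta> \<in> cball 0 r" for z \<zeta>
  proof -
    have "norm (\<zeta> *s v) \<le> r * norm v"
      using that by (simp add: norm_vector_smult mult_right_mono)
    then have "dist z0 (z + \<zeta> *s v) < \<delta>"
      using that r(2) dist_triangle[of z0 "z + \<zeta> *s v" z] by (simp add: dist_norm)
    then show ?thesis using \<delta>(2) by auto
  qed
  define U where "U = T \<times> ball z0 (\<delta>/2)"
  have "continuous_on (U \<times> cball 0 r) (\<lambda>(p,\<zeta>). (fst p, snd p + \<zeta> *s v))"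
    unfolding split_beta by (intro continuous_intros)
  moreover have "(\<lambda>(p,\<zeta>). (fst p, snd p + \<zeta> *s v)) ` (U \<times> cball 0 r) \<subseteq> T \<times> S"
    using inS by (auto simp: U_def)
  ultimately have "continuous_on (U \<times> cball 0 r) (\<lambda>x. (\<lambda>(t,z). F t z) ((\<lambda>(p,\<zeta>). (fst p, snd p + \<zeta> *s v)) x))"
    by (rule continuous_on_compose2[OF cont])
  then have "continuous_on (U \<times> cball 0 r) (\<lambda>(p,\<zeta>). F (fst p) (snd p + \<zeta> *s v))"
    by (simp add: split_beta)
  moreover have "(t0,z0) \<in> U" using 1 \<delta> by (auto simp: U_def)
  moreover have "r * e / 2 > 0" using r e by simp
  ultimately obtain X0 where X0: "(t0,z0) \<in> X0" "open X0"
    "\<forall>x\<in>X0 \<inter> U. \<forall>\<zeta>\<in>cball 0 r. dist (F (fst x) (snd x + \<zeta> *s v)) (F t0 (z0 + \<zeta> *s v)) \<le> r * e / 2"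
    using continuous_on_prod_compactE[of U "cball 0 r" "\<lambda>(p,\<zeta>). F (fst p) (snd p + \<zeta> *s v)" "(t0,z0)" "r*e/2"]
    by auto
  have main: "dd (F t) z v \<in> B" if tz: "(t,z) \<in> X0" "t \<in> T" "z \<in> ball z0 (\<delta>/2)" for t z
  proof -
    define u where "u = (\<lambda>\<zeta>. F t (z + \<zeta> *s v) - F t0 (z0 + \<zeta> *s v))"
    have h1: "((\<lambda>\<zeta>. F t (z + \<zeta> *s v)) has_field_derivative dd (F t) (z + \<zeta> *s v) v) (at \<zeta>)"
      if "\<zeta> \<in> cball 0 r" for \<zeta>
      using tz that by (intro hol_at_line hol inS)
    have h2: "((\<lambda>\<zeta>. F t0 (z0 + \<zeta> *s v)) has_field_derivative dd (F t0) (z0 + \<zeta> *s v) v) (at \<zeta>)"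
      if "\<zeta> \<in> cball 0 r" for \<zeta>
      using \<open>t0 \<in> T\<close> \<open>0 < \<delta>\<close> that by (intro hol_at_line hol inS) auto
    have u': "(u has_field_derivative (dd (F t) (z + \<zeta> *s v) v - dd (F t0) (z0 + \<zeta> *s v) v)) (at \<zeta>)"
      if "\<zeta> \<in> cball 0 r" for \<zeta>
      unfolding u_def by (intro DERIV_diff h1 h2 that)
    have "norm ((deriv ^^ 1) u 0) \<le> fact 1 * (r * e / 2) / r ^ 1"
    proof (rule Cauchy_inequality)
      show "u holomorphic_on ball 0 r"
        using u' has_field_derivative_at_within ball_subset_cball
        unfolding holomorphic_on_def field_differentiable_def by blast
      show "continuous_on (cball 0 r) u"
        by (intro continuous_at_imp_continuous_on ballI DERIV_isCont[OF u'])
      show "norm (u x) \<le> r * e / 2" if "norm (0 - x) = r" for x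
      proof -
        have "(t,z) \<in> X0 \<inter> U" using tz by (auto simp: U_def)
        from bspec[OF bspec[OF X0(3) this], of x] that show ?thesis
          by (simp add: u_def dist_norm)
      qed
    qed (use r in auto)
    then have "norm (deriv u 0) \<le> e / 2"
      using r by simp
    moreover have "deriv u 0 = dd (F t) z v - dd (F t0) z0 v"
      using DERIV_imp_deriv[OF u'[of 0]] r by simp
    ultimately show ?thesis
      using e by (intro subsetD[OF e(2)]) (simp add: dist_norm norm_minus_commute)
  qed
  have "open (X0 \<inter> UNIV \<times> ball z0 (\<delta>/2))"
    using X0(2) by (intro open_Int open_Times) auto
  then show ?case
    by (rule exI[where x = "X0 \<inter> UNIV \<times> ball z0 (\<delta>/2)", OF conjI]) (use X0 \<delta> main in auto)
qed

text \<open>Differentiation under the integral needs the differential as a point of the normed space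
  of operators, where it can be continuous and integrated.\<close>

definition ddb :: "(complex^'n \<Rightarrow> complex) \<Rightarrow> complex^'n \<Rightarrow> ((complex^'n) \<Rightarrow>\<^sub>L complex)"
  where "ddb f z = Blinfun (dd f z)"

lemma ddb_apply: "hol_at f z \<Longrightarrow> blinfun_apply (ddb f z) = dd f z"
  unfolding ddb_def
  using bounded_linear_Blinfun_apply has_derivative_bounded_linear[OF hol_atD(1)] by blast

lemma continuous_on_ddb:
  fixes F :: "'p::t2_space \<Rightarrow> complex^'n \<Rightarrow> complex"
  assumes "open S" "continuous_on (T \<times> S) (\<lambda>(t,z). F t z)"
    and hol: "\<And>t z. t \<in> T \<Longrightarrow> z \<in> S \<Longrightarrow> hol_at (F t) z"
  shows "continuous_on (T \<times> S) (\<lambda>(t,z). ddb (F t) z)"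
proof (rule continuous_on_blinfun_componentwise)
  fix i :: "complex^'n"
  have "continuous_on (T \<times> S) (\<lambda>(t,z). dd (F t) z i)"
    by (rule continuous_on_dd[OF assms])
  then show "continuous_on (T \<times> S) (\<lambda>x. blinfun_apply (case x of (t,z) \<Rightarrow> ddb (F t) z) i)"
    by (rule continuous_on_eq) (auto simp: ddb_apply hol)
qed

section \<open>Fourier coefficients of periodic functions\<close>

definition fcoef :: "(real \<Rightarrow> complex) \<Rightarrow> int \<Rightarrow> complex"
  where "fcoef h m = integral {-pi..pi} (\<lambda>\<theta>. h \<theta> * cis (- (of_int m * \<theta>))) / of_real (2 * pi)"

lemma fcoef_integrable:
  assumes "continuous_on UNIV h"
  shows "(\<lambda>\<theta>. h \<theta> * cis (- (of_int m * \<theta>))) integrable_on {-pi..pi}"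
  by (intro integrable_continuous_real continuous_intros continuous_on_subset[OF assms]) auto

lemma fcoef_one: "fcoef (\<lambda>_. 1) m = (if m = 0 then 1 else 0)"
proof (cases "m = 0")
  case True
  then show ?thesis by (simp add: fcoef_def scaleR_conv_of_real)
next
  case False
  define F where "F = (\<lambda>\<theta>. \<i> / of_int m * cis (- (of_int m * \<theta>)))"
  have "(F has_vector_derivative cis (- (of_int m * \<theta>))) (at \<theta> within {-pi..pi})" for \<theta>
  proof -
    have "((\<lambda>z. \<i> / of_int m * exp (- \<i> * of_int m * z)) has_field_derivative
        exp (- \<i> * of_int m * of_real \<theta>)) (at (of_real \<theta>))"
      using False by (auto intro!: derivative_eq_intros simp: field_simps)
    from has_vector_derivative_real_field[OF this]
    show ?thesis by (simp add: F_def cis_conv_exp mult_ac)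
  qed
  then have "((\<lambda>\<theta>. cis (- (of_int m * \<theta>))) has_integral (F pi - F (-pi))) {-pi..pi}"
    by (intro fundamental_theorem_of_calculus) auto
  moreover have "F pi - F (-pi) = 0"
  proof -
    have "cis (of_int m * pi) = cis (- (of_int m * pi)) * cis (2 * pi * of_int m)"
      by (simp add: cis_mult algebra_simps)
    also have "cis (2 * pi * of_int m) = 1"
      by (rule cis_multiple_2pi) simp
    finally show ?thesis by (simp add: F_def)
  qed
  ultimately show ?thesis using False by (simp add: fcoef_def integral_unique)
qed

lemma one_plus_cos_nonneg: "0 \<le> 1 + cos (\<theta> :: real)"
proof -
  have "0 \<le> 1 + x" if "-1 \<le> x" for x :: real
    using that by simp
  from this[OF cos_ge_minus_one] show ?thesis .
qed

definition peak :: "nat \<Rightarrow> real \<Rightarrow> real"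
  where "peak N \<theta> = ((1 + cos \<theta>) / 2) ^ N"

text \<open>\<open>(1 + cos \<theta>) / 2\<close> is the square of \<open>cos (\<theta>/2)\<close>,
  so the peak is \<open>((cis (\<theta>/2) + cis (-(\<theta>/2))) / 2) ^ (2*N)\<close> and the
  binomial theorem gives its Fourier coefficients.\<close>

lemma peak_fourier:
  "of_real (peak N \<theta>) =
    (\<Sum>j\<le>2*N. of_real (real (2*N choose j) / 4 ^ N) * cis (- (of_int (int N - int j) * \<theta>)))"
proof -
  have "cis (\<theta>/2) + cis (-(\<theta>/2)) = of_real (2 * cos (\<theta>/2))"
    by (simp add: complex_eq_iff)
  moreover have "(2 * cos (\<theta>/2))\<^sup>2 = 2 * (1 + cos \<theta>)"
    using cos_double_cos[of "\<theta>/2"] by (simp add: power_mult_distrib)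
  ultimately have *: "(cis (\<theta>/2) + cis (-(\<theta>/2)))\<^sup>2 = of_real (2 * (1 + cos \<theta>))"
    by (metis of_real_power)
  have "of_real (peak N \<theta>) = ((cis (\<theta>/2) + cis (-(\<theta>/2)))\<^sup>2 / 4) ^ N"
  proof -
    have "complex_of_real ((1 + cos \<theta>) / 2) = of_real (2 * (1 + cos \<theta>)) / 4"
      by (simp add: complex_eq_iff)
    then show ?thesis unfolding * peak_def by (simp only: of_real_power)
  qed
  also have "\<dots> = (cis (\<theta>/2) + cis (-(\<theta>/2))) ^ (2*N) / 4 ^ N"
    by (simp add: power_divide power_mult)
  also have "\<dots> = (\<Sum>j\<le>2*N. of_nat (2*N choose j) * cis (\<theta>/2) ^ j * cis (-(\<theta>/2)) ^ (2*N - j)) / 4 ^ N"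
    by (simp add: binomial_ring)
  also have "\<dots> = (\<Sum>j\<le>2*N. of_real (real (2*N choose j) / 4 ^ N) * cis (- (of_int (int N - int j) * \<theta>)))"
    unfolding sum_divide_distrib
  proof (rule sum.cong)
    fix j assume j: "j \<in> {..2*N}"
    have "cis (\<theta>/2) ^ j * cis (-(\<theta>/2)) ^ (2*N - j) = cis (real j * (\<theta>/2) + real (2*N-j) * (-(\<theta>/2)))"
      unfolding Complex.DeMoivre cis_mult ..
    also have "real j * (\<theta>/2) + real (2*N-j) * (-(\<theta>/2)) = - (of_int (int N - int j) * \<theta>)"
      using j by (simp add: of_nat_diff algebra_simps add_divide_distrib)
    finally show "of_nat (2*N choose j) * cis (\<theta>/2) ^ j * cis (-(\<theta>/2)) ^ (2*N - j) / 4 ^ N =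
        of_real (real (2*N choose j) / 4 ^ N) * cis (- (of_int (int N - int j) * \<theta>))"
      by (simp add: mult.assoc)
  qed simp
  finally show ?thesis .
qed

lemma integral_peak:
  assumes "continuous_on UNIV h"
  shows "integral {-pi..pi} (\<lambda>\<theta>. h \<theta> * of_real (peak N \<theta>)) =
    of_real (2 * pi) * (\<Sum>j\<le>2*N. of_real (real (2*N choose j) / 4 ^ N) * fcoef h (int N - int j))"
proof -
  have "(\<lambda>\<theta>. h \<theta> * of_real (peak N \<theta>)) = (\<lambda>\<theta>. \<Sum>j\<le>2*N. of_real (real (2*N choose j) / 4 ^ N) *
      (h \<theta> * cis (- (of_int (int N - int j) * \<theta>))))"
    unfolding peak_fourier sum_distrib_left by (intro ext sum.cong) (simp_all add: mult_ac)
  then have "integral {-pi..pi} (\<lambda>\<theta>. h \<theta> * of_real (peak N \<theta>)) =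
      (\<Sum>j\<le>2*N. integral {-pi..pi} (\<lambda>\<theta>. of_real (real (2*N choose j) / 4 ^ N) *
        (h \<theta> * cis (- (of_int (int N - int j) * \<theta>)))))"
    by (simp only:) (intro integral_sum finite_atMost integrable_on_mult_right fcoef_integrable assms)
  also have "\<dots> = (\<Sum>j\<le>2*N. of_real (real (2*N choose j) / 4 ^ N) * (of_real (2*pi) * fcoef h (int N - int j)))"
    by (intro sum.cong refl) (simp only: integral_mult_right fcoef_def, simp)
  finally show ?thesis by (simp add: sum_distrib_left mult_ac)
qed

lemma integral_peak_one:
  "integral {-pi..pi} (peak N) = 2 * pi * (real (2*N choose N) / 4 ^ N)"
proof -
  have "continuous_on {-pi..pi} (peak N)"
    unfolding peak_def by (intro continuous_intros) auto
  then have "integral {-pi..pi} (of_real \<circ> peak N) = complex_of_real (integral {-pi..pi} (peak N))"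
    by (intro integral_linear integrable_continuous_real bounded_linear_of_real)
  then have "complex_of_real (integral {-pi..pi} (peak N)) = integral {-pi..pi} (\<lambda>\<theta>. of_real (peak N \<theta>))"
    by (simp add: o_def)
  also have "\<dots> = of_real (2 * pi) *
      (\<Sum>j\<le>2*N. of_real (real (2*N choose j) / 4 ^ N) * fcoef (\<lambda>_. 1) (int N - int j))"
    using integral_peak[of "\<lambda>_. 1" N] by simp
  also have "(\<Sum>j\<le>2*N. of_real (real (2*N choose j) / 4 ^ N) * fcoef (\<lambda>_. 1) (int N - int j)) =
      (\<Sum>j\<le>2*N. if j = N then complex_of_real (real (2*N choose N) / 4 ^ N) else 0)"
    by (intro sum.cong) (auto simp: fcoef_one)
  also have "\<dots> = of_real (real (2*N choose N) / 4 ^ N)"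
    by (simp add: sum.delta)
  finally show ?thesis
    by (metis of_real_eq_iff of_real_mult)
qed

text \<open>The trigonometric polynomials \<open>peak N\<close> concentrate at \<open>0\<close> and have nonnegative
  coefficients, of which the central one is the largest.\<close>

lemma norm_le_sum_fcoef:
  assumes cont: "continuous_on UNIV h"
    and B: "\<And>F. finite F \<Longrightarrow> (\<Sum>m\<in>F. cmod (fcoef h m)) \<le> B"
  shows "cmod (h 0) \<le> B"
proof (rule field_le_epsilon)
  fix e :: real assume "e > 0"
  define \<gamma> where "\<gamma> = (\<lambda>N. real (2*N choose N) / 4 ^ N)"
  obtain \<delta> where \<delta>: "\<delta> > 0" "\<delta> < pi" "\<And>\<theta>. \<bar>\<theta>\<bar> < \<delta> \<Longrightarrow> cmod (h \<theta> - h 0) < e/2"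
  proof -
    have "isCont h 0" using cont continuous_on_eq_continuous_at[of UNIV h] by simp
    then obtain d where "d > 0" "\<And>\<theta>. \<bar>\<theta>\<bar> < d \<Longrightarrow> cmod (h \<theta> - h 0) < e/2"
      using \<open>e > 0\<close> unfolding continuous_at_eps_delta dist_norm
      by (metis diff_zero half_gt_zero real_norm_def)
    then show ?thesis using that[of "min d 1"] pi_gt3 by auto
  qed
  obtain M where M: "M > 0" "\<And>\<theta>. \<theta> \<in> {-pi..pi} \<Longrightarrow> cmod (h \<theta>) \<le> M"
  proof -
    have "compact (h ` {-pi..pi})"
      by (intro compact_continuous_image continuous_on_subset[OF cont]) auto
    then show ?thesis
      using that compact_imp_bounded bounded_pos by (metis imageI)
  qed
  \<comment> \<open>At distance \<open>\<delta>\<close> or more from 0 the peak is at most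
    \<open>q ^ N\<close>.\<close>
  define q where "q = (1 + cos \<delta>) / 2"
  have q: "0 \<le> q" "q < 1"
  proof -
    have "cos \<delta> < cos 0" using \<delta> by (intro cos_monotone_0_pi) auto
    then show "0 \<le> q" "q < 1" using one_plus_cos_nonneg[of \<delta>] by (auto simp: q_def)
  qed
  have peak0: "peak N \<theta> \<ge> 0" for N \<theta>
    unfolding peak_def using one_plus_cos_nonneg[of \<theta>] by simp
  have point: "cmod ((h \<theta> - h 0) * of_real (peak N \<theta>)) \<le> e/2 * peak N \<theta> + 2 * M * q ^ N"
    if "\<theta> \<in> {-pi..pi}" for \<theta> N
  proof (cases "\<bar>\<theta>\<bar> < \<delta>")
    case True
    then have "cmod (h \<theta> - h 0) * peak N \<theta> \<le> e/2 * peak N \<theta>"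
      using \<delta>(3)[OF True] peak0 by (intro mult_right_mono) auto
    moreover have "0 \<le> 2 * M * q ^ N" using M q by simp
    ultimately show ?thesis using peak0[of N \<theta>] by (simp add: norm_mult)
  next
    case False
    have "cos \<bar>\<theta>\<bar> \<le> cos \<delta>"
      using False that \<delta> by (intro cos_monotone_0_pi_le) auto
    then have "peak N \<theta> \<le> q ^ N"
      unfolding peak_def q_def using one_plus_cos_nonneg[of \<theta>] by (intro power_mono) auto
    moreover have "cmod (h \<theta> - h 0) \<le> 2 * M"
      using M(2)[OF that] M(2)[of 0] norm_triangle_ineq4[of "h \<theta>" "h 0"] pi_gt_zero by auto
    ultimately have "cmod (h \<theta> - h 0) * peak N \<theta> \<le> 2 * M * q ^ N"
      using peak0 M q by (intro mult_mono) auto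
    then show ?thesis using peak0[of N \<theta>] \<open>e > 0\<close> by (simp add: norm_mult add_increasing)
  qed
  have intp: "peak N integrable_on {-pi..pi}" for N
    unfolding peak_def by (intro integrable_continuous_real continuous_intros) auto
  have bound: "cmod (h 0) * \<gamma> N \<le> B * \<gamma> N + e/2 * \<gamma> N + 2 * M * q ^ N" for N
  proof -
    have c1: "continuous_on UNIV (\<lambda>\<theta>. h \<theta> - h 0)"
      by (intro continuous_intros cont)
    have i1: "(\<lambda>\<theta>. g \<theta> * complex_of_real (peak N \<theta>)) integrable_on {-pi..pi}" if "continuous_on UNIV g" for g
      unfolding peak_def
      by (intro integrable_continuous_real continuous_intros continuous_on_subset[OF that]) auto
    have "cmod (integral {-pi..pi} (\<lambda>\<theta>. (h \<theta> - h 0) * of_real (peak N \<theta>))) \<le>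
        integral {-pi..pi} (\<lambda>\<theta>. e/2 * peak N \<theta> + 2 * M * q ^ N)"
      by (intro Henstock_Kurzweil_Integration.integral_norm_bound_integral i1 c1 point
          integrable_add integrable_on_mult_right intp) auto
    also have "\<dots> = e/2 * (2 * pi * \<gamma> N) + 2 * pi * (2 * M * q ^ N)"
      by (subst integral_add) (auto intro!: integrable_on_mult_right intp simp: integral_peak_one \<gamma>_def)
    finally have 1: "cmod (integral {-pi..pi} (\<lambda>\<theta>. (h \<theta> - h 0) * of_real (peak N \<theta>))) \<le>
        2 * pi * (e/2 * \<gamma> N + 2 * M * q ^ N)" by (simp add: algebra_simps)
    have "integral {-pi..pi} (\<lambda>\<theta>. (h \<theta> - h 0) * of_real (peak N \<theta>)) =
        integral {-pi..pi} (\<lambda>\<theta>. h \<theta> * of_real (peak N \<theta>)) - integral {-pi..pi} (\<lambda>\<theta>. h 0 * of_real (peak N \<theta>))"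
      using Henstock_Kurzweil_Integration.integral_diff[OF i1[OF cont] i1[of "\<lambda>_. h 0"]]
      by (simp add: algebra_simps)
    moreover have "integral {-pi..pi} (\<lambda>\<theta>. h 0 * of_real (peak N \<theta>)) = h 0 * of_real (2 * pi * \<gamma> N)"
    proof -
      have "integral {-pi..pi} (of_real \<circ> peak N) = complex_of_real (integral {-pi..pi} (peak N))"
        by (intro integral_linear intp bounded_linear_of_real)
      then show ?thesis
        by (simp add: o_def integral_peak_one \<gamma>_def integral_mult_right)
    qed
    ultimately have 2: "cmod (h 0 * of_real (2 * pi * \<gamma> N)) \<le>
        cmod (integral {-pi..pi} (\<lambda>\<theta>. h \<theta> * of_real (peak N \<theta>))) + 2 * pi * (e/2 * \<gamma> N + 2 * M * q ^ N)"
      using 1 by (smt (verit) norm_minus_commute norm_triangle_sub)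
    \<comment> \<open>Each coefficient of the peak is at most the central one
      \<open>\<gamma> N\<close>, which is also the mean of the peak; this common factor cancels at
      the end.\<close>
    have "cmod (\<Sum>j\<le>2*N. of_real (real (2*N choose j) / 4 ^ N) * fcoef h (int N - int j)) \<le>
        (\<Sum>j\<le>2*N. \<gamma> N * cmod (fcoef h (int N - int j)))"
    proof (rule sum_norm_le)
      fix j assume "j \<in> {..2*N}"
      have "real (2*N choose j) \<le> real (2*N choose N)"
        using binomial_maximum[of "2*N" j] by simp
      then have "real (2*N choose j) / 4 ^ N \<le> \<gamma> N"
        unfolding \<gamma>_def by (intro divide_right_mono) auto
      then show "cmod (of_real (real (2*N choose j) / 4 ^ N) * fcoef h (int N - int j)) \<le>
          \<gamma> N * cmod (fcoef h (int N - int j))"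
        unfolding norm_mult norm_of_real by (intro mult_right_mono) auto
    qed
    also have "\<dots> = \<gamma> N * (\<Sum>m\<in>(\<lambda>j. int N - int j) ` {..2*N}. cmod (fcoef h m))"
      by (subst sum.reindex) (auto simp: inj_on_def sum_distrib_left)
    also have "\<dots> \<le> \<gamma> N * B"
      by (intro mult_left_mono B) (auto simp: \<gamma>_def)
    finally have *: "cmod (integral {-pi..pi} (\<lambda>\<theta>. h \<theta> * of_real (peak N \<theta>))) \<le> 2 * pi * (\<gamma> N * B)"
      unfolding integral_peak[OF cont] norm_mult norm_of_real by simp
    have "2 * pi * (cmod (h 0) * \<gamma> N) \<le> 2 * pi * (B * \<gamma> N + e/2 * \<gamma> N + 2 * M * q ^ N)"
    proof -
      have "cmod (h 0 * of_real (2 * pi * \<gamma> N)) = 2 * pi * (cmod (h 0) * \<gamma> N)"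
        unfolding norm_mult norm_of_real by (simp add: \<gamma>_def)
      with 2 * show ?thesis by (simp add: mult.commute[of "\<gamma> N" B] distrib_left)
    qed
    then show ?thesis by simp
  qed
  \<comment> \<open>The mean of the peak is at least \<open>1 / (2 * N)\<close>, while its tails
    decay geometrically; so the tails are negligible against the mean as soon as
    \<open>N * q ^ N\<close> is small.\<close>
  have "(\<lambda>N. 4 * M * (of_nat N * q ^ N)) \<longlonglongrightarrow> 4 * M * 0"
    by (intro tendsto_intros powser_times_n_limit_0) (use q in auto)
  then have "\<forall>\<^sub>F N in sequentially. 4 * M * (of_nat N * q ^ N) < e/2"
    using \<open>e > 0\<close> by (intro order_tendstoD(2)[where y=0]) auto
  from eventually_happens'[OF sequentially_bot eventually_conj[OF eventually_gt_at_top[of 0] this]]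
  obtain N where N: "N > 0" "4 * M * (real N * q ^ N) < e/2"
    by blast
  have \<gamma>: "\<gamma> N \<ge> 1 / (2 * real N)"
    using central_binomial_lower_bound[OF N(1)] N(1) by (simp add: \<gamma>_def field_simps)
  then have "\<gamma> N > 0" using N(1) by (smt (verit) divide_pos_pos of_nat_0_less_iff)
  have "2 * M * q ^ N = 4 * M * (real N * q ^ N) * (1 / (2 * real N))"
    using N by simp
  also have "\<dots> \<le> e/2 * \<gamma> N"
    using N \<gamma> M q \<open>e > 0\<close> by (intro mult_mono) auto
  finally have "cmod (h 0) * \<gamma> N \<le> (B + e) * \<gamma> N"
    using bound[of N] by (simp add: algebra_simps)
  then show "cmod (h 0) \<le> B + e" using \<open>\<gamma> N > 0\<close> by simp
qed

lemma fcoef_eq_0_imp: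
  assumes "continuous_on UNIV h" "\<And>m. fcoef h m = 0"
  shows "h 0 = 0"
  using norm_le_sum_fcoef[of h 0] assms by simp

text \<open>For an antiderivative \<open>g\<close> the function \<open>g (x + 2 * pi) - g x\<close>
  has derivative zero by periodicity; both integrals are values of it.\<close>

lemma integral_period_shift:
  fixes u :: "real \<Rightarrow> complex"
  assumes cont: "continuous_on UNIV u" and per: "\<And>\<theta>. u (\<theta> + 2 * pi) = u \<theta>"
  shows "integral {-pi..pi} (\<lambda>\<theta>. u (\<theta> + a)) = integral {-pi..pi} u"
proof -
  define R where "R = \<bar>a\<bar> + 2 * pi"
  have "continuous_on {-R..R} u" by (rule continuous_on_subset[OF cont]) simp
  then obtain g where g: "\<And>x. x \<in> {-R..R} \<Longrightarrow> (g has_vector_derivative u x) (at x within {-R..R})"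
    using antiderivative_continuous by metis
  have int: "integral {x..y} u = g y - g x" if "-R \<le> x" "x \<le> y" "y \<le> R" for x y
    by (intro integral_unique fundamental_theorem_of_calculus that)
       (use that in \<open>auto intro: has_vector_derivative_within_subset[OF g]\<close>)
  let ?I = "{-R..R-2*pi}"
  have shift: "((\<lambda>x. g (x + b)) has_vector_derivative u (x + b)) (at x within {c..d})"
    if "x \<in> {c..d}" "- R \<le> c + b" "d + b \<le> R" for x b c d
  proof -
    have "((\<lambda>x. x + b) has_real_derivative 1) (at x within {c..d})"
      by (auto intro!: derivative_eq_intros)
    moreover have "(g has_vector_derivative u (x + b)) (at (x + b) within (\<lambda>x. x + b) ` {c..d})"
      using that by (intro has_vector_derivative_within_subset[OF g]) auto
    ultimately have "((g \<circ> (\<lambda>x. x + b)) has_vector_derivative 1 *\<^sub>R u (x + b)) (at x within {c..d})"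
      by (intro vector_diff_chain_within) (auto simp: has_real_derivative_iff_has_vector_derivative)
    then show ?thesis by (simp add: o_def)
  qed
  have "((\<lambda>x. g (x + 2*pi) - g x) has_vector_derivative (u (x + 2*pi) - u x)) (at x within ?I)"
    if "x \<in> ?I" for x
    using shift[OF that, of "2*pi"] shift[OF that, of 0] pi_gt_zero
    by (intro has_vector_derivative_diff) auto
  then have "((\<lambda>x. g (x + 2*pi) - g x) has_vector_derivative 0) (at x within ?I)" if "x \<in> ?I" for x
    using that per by simp
  from has_vector_derivative_zero_constant[OF convex_real_interval(5) this]
  obtain c where c: "\<And>x. x \<in> ?I \<Longrightarrow> g (x + 2*pi) - g x = c"
    by blast
  have "integral {-pi..pi} (\<lambda>\<theta>. u (\<theta> + a)) = g (pi + a) - g (-pi + a)"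
    using pi_gt_zero
    by (intro integral_unique fundamental_theorem_of_calculus shift) (auto simp: R_def)
  also have "\<dots> = c"
  proof -
    have "-pi + a \<in> ?I"
      unfolding R_def atLeastAtMost_iff using pi_gt_zero by linarith
    moreover have "-pi + a + 2 * pi = pi + a" by simp
    ultimately show ?thesis using c[of "-pi + a"] by simp
  qed
  also have "\<dots> = integral {-pi..pi} u"
  proof -
    have "-pi \<in> ?I" "pi \<le> R" "-R \<le> -pi" "-pi \<le> pi"
      unfolding R_def atLeastAtMost_iff using pi_gt_zero by linarith+
    then show ?thesis using int[of "-pi" pi] c[of "-pi"] by simp
  qed
  finally show ?thesis .
qed

section \<open>The inverse function theorem for holomorphic maps\<close>

lemma has_derivative_vecI:
  fixes F :: "'b::real_normed_vector \<Rightarrow> complex^'m"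
  assumes "\<And>i. ((\<lambda>z. F z $ i) has_derivative (\<lambda>v. D v $ i)) (at z)"
  shows "(F has_derivative D) (at z)"
proof -
  have "((\<lambda>z. \<Sum>i\<in>UNIV. axis i (F z $ i)) has_derivative (\<lambda>v. \<Sum>i\<in>UNIV. axis i (D v $ i))) (at z)"
    by (intro has_derivative_sum bounded_linear.has_derivative[OF bounded_linear_axis] assms)
  then show ?thesis by (simp add: vec_as_sum_axis)
qed

lemma hol_vec_atD:
  assumes "hol_vec_at F z"
  shows "(F has_derivative (\<lambda>v. \<chi> i. dd (\<lambda>z. F z $ i) z v)) (at z)"
    and "(\<chi> i. dd (\<lambda>z. F z $ i) z (c *s v)) = c *s (\<chi> i. dd (\<lambda>z. F z $ i) z v)"
proof -
  have h: "hol_at (\<lambda>z. F z $ i) z" for i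
    using assms by (simp add: hol_vec_at_def)
  show "(F has_derivative (\<lambda>v. \<chi> i. dd (\<lambda>z. F z $ i) z v)) (at z)"
    by (rule has_derivative_vecI) (simp add: hol_atD(1)[OF h])
  show "(\<chi> i. dd (\<lambda>z. F z $ i) z (c *s v)) = c *s (\<chi> i. dd (\<lambda>z. F z $ i) z v)"
    by (simp add: vec_eq_iff hol_atD(2)[OF h])
qed

text \<open>The inverse function theorem over the reals applies because
  \<open>continuous_on_dd\<close> makes the differential continuous. The differential of the inverse
  is the inverse of a complex linear bijection, hence complex linear.\<close>

lemma hol_inverse_function:
  fixes G :: "complex^'n \<Rightarrow> complex^'n"
  assumes "open S" and hol: "\<And>z. z \<in> S \<Longrightarrow> hol_vec_at G z" and "z0 \<in> S"
    and inj: "\<And>v. (\<And>i. dd (\<lambda>z. G z $ i) z0 v = 0) \<Longrightarrow> v = 0"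
  obtains U V h where "open U" "U \<subseteq> S" "z0 \<in> U" "open V" "homeomorphism U V G h"
    "\<And>y. y \<in> V \<Longrightarrow> hol_vec_at h y"
proof -
  define D where "D = (\<lambda>z v. (\<chi> i. dd (\<lambda>z. G z $ i) z v))"
  have D: "(G has_derivative D z) (at z)" "D z (c *s v) = c *s D z v" if "z \<in> S" for z c v
    unfolding D_def using hol_vec_atD[OF hol[OF that]] by auto
  have app: "blinfun_apply (Blinfun (D z)) = D z" if "z \<in> S" for z
    using bounded_linear_Blinfun_apply has_derivative_bounded_linear D(1)[OF that] by blast
  have hol_i: "hol_at (\<lambda>z. G z $ i) z" if "z \<in> S" for i z
    using hol[OF that] by (simp add: hol_vec_at_def)
  have cont: "continuous_on S (\<lambda>z. Blinfun (D z))"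
  proof (rule continuous_on_blinfun_componentwise)
    fix v :: "complex^'n"
    have "continuous_on S (\<lambda>z. dd (\<lambda>z. G z $ i) z v)" for i
    proof -
      \<comment> \<open>The parameter space of \<open>continuous_on_dd\<close> is a single point
        here.\<close>
      have "continuous_on ({True} \<times> S) (\<lambda>(t::bool,z). G z $ i)"
        unfolding split_beta
        by (intro continuous_on_compose2[of S "\<lambda>z. G z $ i" _ snd] continuous_intros
            continuous_at_imp_continuous_on ballI hol_at_continuous hol_i) auto
      then have "continuous_on ({True} \<times> S) (\<lambda>(t::bool,z). dd (\<lambda>z. G z $ i) z v)"
        by (rule continuous_on_dd[OF \<open>open S\<close>]) (simp add: hol_i)
      then have "continuous_on S ((\<lambda>(t::bool,z). dd (\<lambda>z. G z $ i) z v) \<circ> (\<lambda>z. (True, z)))"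
        by (intro continuous_on_compose continuous_intros) (auto elim: continuous_on_subset)
      then show ?thesis by (simp add: o_def)
    qed
    then have "continuous_on S (\<lambda>z. D z v)"
      unfolding D_def by (intro continuous_on_vec_lambda)
    then show "continuous_on S (\<lambda>z. blinfun_apply (Blinfun (D z)) v)"
      by (rule continuous_on_eq) (simp add: app)
  qed
  have lin: "linear (D z0)" using D(1)[OF \<open>z0 \<in> S\<close>] has_derivative_linear by blast
  have "inj (D z0)"
    unfolding linear_injective_0[OF lin]
  proof (intro allI impI)
    fix v assume "D z0 v = 0"
    then have "(D z0 v) $ i = 0" for i by simp
    then show "v = 0" by (intro inj) (simp add: D_def)
  qed
  then obtain L where L: "linear L" "L \<circ> D z0 = id"
    using linear_injective_left_inverse[OF lin] by blast
  have LD: "Blinfun L o\<^sub>L Blinfun (D z0) = id_blinfun"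
    using L app[OF \<open>z0 \<in> S\<close>]
    by (intro blinfun_eqI)
       (simp add: bounded_linear_Blinfun_apply linear_conv_bounded_linear[symmetric] fun_eq_iff)
  have der: "(G has_derivative blinfun_apply (Blinfun (D z))) (at z)" if "z \<in> S" for z
    using D(1)[OF that] app[OF that] by simp
  show ?thesis
  proof (rule inverse_function_theorem[OF \<open>open S\<close> der cont \<open>z0 \<in> S\<close> LD])
    fix U V h h'
    assume U: "open U" "U \<subseteq> S" "z0 \<in> U" "open V" "G z0 \<in> V" "homeomorphism U V G h"
      and h: "\<And>y. y \<in> V \<Longrightarrow> (h has_derivative h' y) (at y)"
        "\<And>y. y \<in> V \<Longrightarrow> h' y = inv_into UNIV (blinfun_apply (Blinfun (D (h y))))"
        "\<And>y. y \<in> V \<Longrightarrow> bij (blinfun_apply (Blinfun (D (h y))))"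
    have "hol_vec_at h y" if "y \<in> V" for y
    proof (rule hol_vec_atI[OF h(1)[OF that]])
      fix c w
      have hy: "h y \<in> S" using U(2,6) that unfolding homeomorphism_def by blast
      then have bij: "bij (D (h y))" and h': "h' y = inv_into UNIV (D (h y))"
        using h(2,3)[OF that] app by auto
      have "D (h y) (h' y w) = w" for w
        unfolding h' using bij by (simp add: bij_is_surj surj_f_inv_f)
      then have "D (h y) (h' y (c *s w)) = D (h y) (c *s h' y w)"
        by (simp add: D(2)[OF hy])
      then show "h' y (c *s w) = c *s h' y w"
        using bij by (simp add: bij_is_inj inj_eq)
    qed
    with U that show ?thesis by blast
  qed
qed

section \<open>Charts, holomorphic functions and holomorphic maps\<close>

text \<open>Admissible charts outside the given atlas: coordinates made of global functions can be
  used without passing to a maximal atlas.\<close>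

definition compat_chart :: "'a topology \<Rightarrow> ('a, 'n::finite) atlas \<Rightarrow> 'a set \<Rightarrow> ('a \<Rightarrow> complex^'n) \<Rightarrow> bool"
  where "compat_chart M \<A> U \<phi> \<longleftrightarrow> holomorphic_atlas M (insert (U,\<phi>) \<A>)"

lemma compat_chart_member: "holomorphic_atlas M \<A> \<Longrightarrow> (U,\<phi>) \<in> \<A> \<Longrightarrow> compat_chart M \<A> U \<phi>"
  by (simp add: compat_chart_def insert_absorb)

lemma atlas_chart_at:
  assumes "holomorphic_atlas M \<A>" "x \<in> topspace M"
  obtains U \<phi> where "(U,\<phi>) \<in> \<A>" "x \<in> U"
proof -
  have "x \<in> (\<Union>(U,\<phi>)\<in>\<A>. U)"
    using assms by (simp add: holomorphic_atlas_def)
  then show ?thesis using that by blast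
qed

lemma compat_chartD:
  assumes "compat_chart M \<A> U \<phi>"
  shows "openin M U" "open (\<phi> ` U)" "inj_on \<phi> U" "U \<subseteq> topspace M"
    and "homeomorphic_map (subtopology M U) (top_of_set (\<phi> ` U)) \<phi>"
    and "(V,\<psi>) \<in> \<A> \<Longrightarrow> z \<in> \<phi> ` (U \<inter> V) \<Longrightarrow> hol_vec_at (\<psi> \<circ> inv_into U \<phi>) z"
    and "(V,\<psi>) \<in> \<A> \<Longrightarrow> z \<in> \<psi> ` (U \<inter> V) \<Longrightarrow> hol_vec_at (\<phi> \<circ> inv_into V \<psi>) z"
proof -
  have at: "holomorphic_atlas M (insert (U,\<phi>) \<A>)"
    using assms by (simp add: compat_chart_def)
  show U: "openin M U" "open (\<phi> ` U)"
    and hom: "homeomorphic_map (subtopology M U) (top_of_set (\<phi> ` U)) \<phi>"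
    using at unfolding holomorphic_atlas_def by auto
  show sub: "U \<subseteq> topspace M" using U(1) openin_subset by blast
  show "inj_on \<phi> U"
    using hom sub by (simp add: homeomorphic_map_def inf.absorb2)
  show "(V,\<psi>) \<in> \<A> \<Longrightarrow> z \<in> \<phi> ` (U \<inter> V) \<Longrightarrow> hol_vec_at (\<psi> \<circ> inv_into U \<phi>) z"
    and "(V,\<psi>) \<in> \<A> \<Longrightarrow> z \<in> \<psi> ` (U \<inter> V) \<Longrightarrow> hol_vec_at (\<phi> \<circ> inv_into V \<psi>) z"
    using at unfolding holomorphic_atlas_def holomorphic_vec_on_iff by (fastforce simp: Int_commute)+
qed

lemma compat_chart_open_image:
  assumes "compat_chart M \<A> U \<phi>" "openin M W" "W \<subseteq> U"
  shows "open (\<phi> ` W)"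
proof -
  have "openin (subtopology M U) W"
    using assms(2,3) by (simp add: openin_subset_topspace_eq openin_open_subtopology
        compat_chartD(1)[OF assms(1)])
  then have "openin (top_of_set (\<phi> ` U)) (\<phi> ` W)"
    using homeomorphic_imp_open_map[OF compat_chartD(5)[OF assms(1)]] by (auto simp: open_map_def)
  then show ?thesis using compat_chartD(2)[OF assms(1)] openin_open_trans by blast
qed

lemma compat_chart_open_preimage:
  assumes "compat_chart M \<A> U \<phi>" "open W"
  shows "openin M {x\<in>U. \<phi> x \<in> W}"
proof -
  have "openin (top_of_set (\<phi> ` U)) (\<phi> ` U \<inter> W)"
    using assms(2) by (rule openin_open_Int)
  then have "openin (subtopology M U) {x \<in> topspace (subtopology M U). \<phi> x \<in> \<phi> ` U \<inter> W}"
    using openin_continuous_map_preimage homeomorphic_imp_continuous_map[OF compat_chartD(5)[OF assms(1)]]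
    by blast
  also have "{x \<in> topspace (subtopology M U). \<phi> x \<in> \<phi> ` U \<inter> W} = {x\<in>U. \<phi> x \<in> W}"
    using compat_chartD(4)[OF assms(1)] by auto
  finally show ?thesis
    using compat_chartD(1)[OF assms(1)] openin_trans_full by blast
qed

lemma compat_chart_inv:
  assumes "compat_chart M \<A> U \<phi>"
  shows "z \<in> \<phi> ` U \<Longrightarrow> inv_into U \<phi> z \<in> U" "z \<in> \<phi> ` U \<Longrightarrow> \<phi> (inv_into U \<phi> z) = z"
    and "x \<in> U \<Longrightarrow> inv_into U \<phi> (\<phi> x) = x"
  using compat_chartD(3)[OF assms] by (simp_all add: inv_into_into f_inv_into_f)

lemma compat_chart_inv_preimage:
  assumes "compat_chart M \<A> U \<phi>" "openin M W"
  shows "open {z \<in> \<phi> ` U. inv_into U \<phi> z \<in> W}"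
proof -
  have "{z \<in> \<phi> ` U. inv_into U \<phi> z \<in> W} = \<phi> ` (U \<inter> W)"
    using compat_chart_inv[OF assms(1)] by force
  then show ?thesis
    using compat_chart_open_image[OF assms(1), of "U \<inter> W"] assms(2) compat_chartD(1)[OF assms(1)]
    by auto
qed

lemma compat_chart_continuous_inv:
  assumes "compat_chart M \<A> U \<phi>"
  shows "continuous_map (top_of_set (\<phi> ` U)) M (inv_into U \<phi>)"
  unfolding continuous_map_def
proof (intro conjI allI impI)
  show "inv_into U \<phi> \<in> topspace (top_of_set (\<phi> ` U)) \<rightarrow> topspace M"
    using compat_chart_inv(1)[OF assms] compat_chartD(4)[OF assms] by auto
  fix W assume "openin M W"
  from compat_chart_inv_preimage[OF assms this]
  show "openin (top_of_set (\<phi> ` U)) {z \<in> topspace (top_of_set (\<phi> ` U)). inv_into U \<phi> z \<in> W}"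
    by (simp add: openin_open_eq compat_chartD(2)[OF assms] subset_iff)
qed

section \<open>Holomorphic functions and maps on complex manifolds\<close>

lemma holomorphic_functionsD:
  "f \<in> holomorphic_functions M \<A> \<Longrightarrow> (U,\<phi>) \<in> \<A> \<Longrightarrow> z \<in> \<phi> ` U \<Longrightarrow> hol_at (f \<circ> inv_into U \<phi>) z"
  by (auto simp: holomorphic_functions_def holomorphic_fun_on_iff)

lemma holomorphic_functionsI:
  "(\<And>U \<phi> z. (U,\<phi>) \<in> \<A> \<Longrightarrow> z \<in> \<phi> ` U \<Longrightarrow> hol_at (f \<circ> inv_into U \<phi>) z) \<Longrightarrow> f \<in> holomorphic_functions M \<A>"
  by (auto simp: holomorphic_functions_def holomorphic_fun_on_iff)

lemma holomorphic_functions_compat_chart: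
  assumes "holomorphic_atlas M \<A>" "f \<in> holomorphic_functions M \<A>" "compat_chart M \<A> V g" "z \<in> g ` V"
  shows "hol_at (f \<circ> inv_into V g) z"
proof -
  have x: "inv_into V g z \<in> V" using compat_chart_inv(1) assms by blast
  then have "inv_into V g z \<in> topspace M" using compat_chartD(4)[OF assms(3)] by blast
  then obtain U \<phi> where U: "(U,\<phi>) \<in> \<A>" "inv_into V g z \<in> U"
    using atlas_chart_at[OF assms(1)] by metis
  have cU: "compat_chart M \<A> U \<phi>" by (rule compat_chart_member[OF assms(1) U(1)])
  have z: "z \<in> g ` (V \<inter> U)" using x U(2) compat_chart_inv(2)[OF assms(3,4)] by force
  have "hol_vec_at (\<phi> \<circ> inv_into V g) z"
    by (rule compat_chartD(6)[OF assms(3) U(1) z])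
  moreover have "hol_at (f \<circ> inv_into U \<phi>) ((\<phi> \<circ> inv_into V g) z)"
    using holomorphic_functionsD[OF assms(2) U(1)] U(2) by simp
  ultimately have "hol_at (\<lambda>w. (f \<circ> inv_into U \<phi>) ((\<phi> \<circ> inv_into V g) w)) z"
    by (rule hol_at_compose)
  then show ?thesis
  proof (rule hol_at_transform)
    show "open {w \<in> g ` V. inv_into V g w \<in> U}"
      by (rule compat_chart_inv_preimage[OF assms(3) compat_chartD(1)[OF cU]])
  qed (use assms(4) U(2) compat_chart_inv[OF cU] in auto)
qed

lemma holomorphic_functions_continuous:
  assumes "holomorphic_atlas M \<A>" "f \<in> holomorphic_functions M \<A>"
  shows "continuous_map M euclidean f"
  unfolding continuous_map_def
proof (intro conjI allI impI)
  fix W :: "complex set" assume "openin euclidean W"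
  then have W: "open W" by simp
  show "openin M {x \<in> topspace M. f x \<in> W}"
  proof (subst openin_subopen, intro ballI)
    fix x assume x: "x \<in> {x \<in> topspace M. f x \<in> W}"
    then obtain U \<phi> where U: "(U,\<phi>) \<in> \<A>" "x \<in> U"
      using atlas_chart_at[OF assms(1)] by blast
    have cU: "compat_chart M \<A> U \<phi>" by (rule compat_chart_member[OF assms(1) U(1)])
    have "continuous_on (\<phi> ` U) (f \<circ> inv_into U \<phi>)"
      by (intro continuous_at_imp_continuous_on ballI hol_at_continuous holomorphic_functionsD[OF assms(2) U(1)])
    then have "open (\<phi> ` U \<inter> (f \<circ> inv_into U \<phi>) -` W)"
      using compat_chartD(2)[OF cU] W by (rule continuous_open_preimage)
    note * = compat_chart_open_preimage[OF cU this]
    show "\<exists>T. openin M T \<and> x \<in> T \<and> T \<subseteq> {x \<in> topspace M. f x \<in> W}"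
      by (rule exI, rule conjI[OF *]) (use x U compat_chart_inv[OF cU] compat_chartD(3,4)[OF cU] in \<open>auto dest: inj_onD\<close>)
  qed
qed auto

lemma holomorphic_functions_const [simp]: "(\<lambda>_. c) \<in> holomorphic_functions M \<A>"
  by (rule holomorphic_functionsI) (simp add: o_def)

lemma holomorphic_functions_mult:
  "f \<in> holomorphic_functions M \<A> \<Longrightarrow> g \<in> holomorphic_functions M \<A> \<Longrightarrow>
    (\<lambda>x. f x * g x) \<in> holomorphic_functions M \<A>"
  by (rule holomorphic_functionsI)
     (use hol_at_mult[OF holomorphic_functionsD holomorphic_functionsD, of f M \<A>] in \<open>simp add: o_def\<close>)

lemma holomorphic_functions_diff:
  "f \<in> holomorphic_functions M \<A> \<Longrightarrow> g \<in> holomorphic_functions M \<A> \<Longrightarrow>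
    (\<lambda>x. f x - g x) \<in> holomorphic_functions M \<A>"
  by (rule holomorphic_functionsI)
     (use hol_at_diff[OF holomorphic_functionsD holomorphic_functionsD, of f M \<A>] in \<open>simp add: o_def\<close>)

lemma holomorphic_functions_prod:
  "finite I \<Longrightarrow> (\<And>i. i \<in> I \<Longrightarrow> f i \<in> holomorphic_functions M \<A>) \<Longrightarrow>
    (\<lambda>x. \<Prod>i\<in>I. f i x) \<in> holomorphic_functions M \<A>"
  by (induction I rule: finite_induct) (auto intro: holomorphic_functions_mult)

lemma holomorphic_functions_power:
  "f \<in> holomorphic_functions M \<A> \<Longrightarrow> (\<lambda>x. f x ^ N) \<in> holomorphic_functions M \<A>"
  by (induction N) (auto intro: holomorphic_functions_mult)

lemma holomorphic_functions_inverse: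
  assumes "holomorphic_atlas M \<A>" "f \<in> holomorphic_functions M \<A>" "\<And>x. x \<in> topspace M \<Longrightarrow> f x \<noteq> 0"
  shows "(\<lambda>x. inverse (f x)) \<in> holomorphic_functions M \<A>"
proof (rule holomorphic_functionsI)
  fix U \<phi> z assume U: "(U,\<phi>) \<in> \<A>" "z \<in> \<phi> ` U"
  have cU: "compat_chart M \<A> U \<phi>" by (rule compat_chart_member[OF assms(1) U(1)])
  have "(f \<circ> inv_into U \<phi>) z \<noteq> 0"
    using assms(3) compat_chart_inv(1)[OF cU U(2)] compat_chartD(4)[OF cU] by auto
  then have "hol_at (\<lambda>z. inverse ((f \<circ> inv_into U \<phi>) z)) z"
    by (intro hol_at_compose_field[where g=inverse] holomorphic_functionsD[OF assms(2) U])
       (auto simp: field_differentiable_def intro!: derivative_eq_intros)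
  then show "hol_at ((\<lambda>x. inverse (f x)) \<circ> inv_into U \<phi>) z" by (simp add: o_def)
qed

text \<open>The largest open set on which \<open>f\<close> vanishes is also closed: a chart ball
  around a boundary point meets it, and the identity theorem for balls spreads the zeros over that
  ball.\<close>

lemma holomorphic_functions_identity:
  assumes "holomorphic_atlas M \<A>" "connected_space M" "f \<in> holomorphic_functions M \<A>"
    and "openin M W" "W \<noteq> {}" "\<And>y. y \<in> W \<Longrightarrow> f y = 0" "x \<in> topspace M"
  shows "f x = 0"
proof -
  define Z where "Z = \<Union>{W. openin M W \<and> (\<forall>y\<in>W. f y = 0)}"
  have "openin M Z" unfolding Z_def by (rule openin_Union) auto
  moreover have "closedin M Z"
    unfolding closedin_def
  proof
    show "Z \<subseteq> topspace M" using \<open>openin M Z\<close> openin_subset by blast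
    show "openin M (topspace M - Z)"
    proof (subst openin_subopen, intro ballI)
      fix x assume x: "x \<in> topspace M - Z"
      then obtain U \<phi> where U: "(U,\<phi>) \<in> \<A>" "x \<in> U"
        using atlas_chart_at[OF assms(1)] by blast
      have cU: "compat_chart M \<A> U \<phi>" by (rule compat_chart_member[OF assms(1) U(1)])
      obtain r where r: "r > 0" "ball (\<phi> x) r \<subseteq> \<phi> ` U"
        using U(2) compat_chartD(2)[OF cU] open_contains_ball by blast
      define B where "B = {y\<in>U. \<phi> y \<in> ball (\<phi> x) r}"
      have B: "openin M B" "x \<in> B" "B \<subseteq> U"
        unfolding B_def using compat_chart_open_preimage[OF cU open_ball] r U by auto
      have "B \<inter> Z = {}"
      proof (rule ccontr)
        assume "B \<inter> Z \<noteq> {}"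
        then obtain y W where W: "y \<in> B" "y \<in> W" "openin M W" "\<And>y. y \<in> W \<Longrightarrow> f y = 0"
          unfolding Z_def by blast
        have "open (\<phi> ` (B \<inter> W))"
          using compat_chart_open_image[OF cU, of "B \<inter> W"] B W by auto
        then have "(f \<circ> inv_into U \<phi>) w = 0" if "w \<in> ball (\<phi> x) r" for w
        proof (rule hol_identity_convex[OF convex_ball open_ball _ _ _ _ _ that, rotated])
          show "\<phi> ` (B \<inter> W) \<subseteq> ball (\<phi> x) r" by (auto simp: B_def)
          show "\<phi> ` (B \<inter> W) \<noteq> {}" using W by auto
          show "(f \<circ> inv_into U \<phi>) z = 0" if "z \<in> \<phi> ` (B \<inter> W)" for z
            using that W(4) B(3) compat_chart_inv(3)[OF cU] by auto
          show "hol_at (f \<circ> inv_into U \<phi>) z" if "z \<in> ball (\<phi> x) r" for z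
            using r(2) that holomorphic_functionsD[OF assms(3) U(1)] by blast
        qed
        then have "f y = 0" if "y \<in> B" for y
          using that compat_chart_inv(3)[OF cU] unfolding B_def by fastforce
        then show False using B x unfolding Z_def by blast
      qed
      then show "\<exists>T. openin M T \<and> x \<in> T \<and> T \<subseteq> topspace M - Z"
        using B compat_chartD(4)[OF cU] by blast
    qed
  qed
  ultimately have "Z = {} \<or> Z = topspace M"
    using assms(2) connected_space_clopen_in by blast
  moreover have "W \<subseteq> Z" unfolding Z_def using assms(4,6) by blast
  ultimately have "x \<in> Z" using assms(5,7) by auto
  then show ?thesis unfolding Z_def by blast
qed

text \<open>Around each image point a single chart with holomorphic pullbacks is enough, since any
  other chart differs from it by a holomorphic transition. On a Stein manifold such a chart can be
  built from global functions.\<close>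

lemma holomorphic_mapI:
  assumes N: "holomorphic_atlas N \<B>" and M: "holomorphic_atlas M \<A>" and cont: "continuous_map N M F"
    and loc: "\<And>y. y \<in> topspace N \<Longrightarrow> \<exists>W g. F y \<in> W \<and> compat_chart M \<A> W g \<and>
      (\<forall>i. (\<lambda>y. g (F y) $ i) \<in> holomorphic_functions N \<B>)"
  shows "holomorphic_map N \<B> M \<A> F"
proof -
  have main: "hol_vec_at (\<psi> \<circ> F \<circ> inv_into U \<phi>) (\<phi> y)"
    if 1: "(U,\<phi>) \<in> \<B>" "(V,\<psi>) \<in> \<A>" "y \<in> U" "F y \<in> V" for U \<phi> V \<psi> y
  proof -
  have cU: "compat_chart N \<B> U \<phi>" by (rule compat_chart_member[OF N 1(1)])
  have cV: "compat_chart M \<A> V \<psi>" by (rule compat_chart_member[OF M 1(2)])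
  have y: "y \<in> topspace N" using 1 compat_chartD(4)[OF cU] by blast
  obtain W g where W: "F y \<in> W" "compat_chart M \<A> W g"
      "\<And>i. (\<lambda>y. g (F y) $ i) \<in> holomorphic_functions N \<B>"
    using loc[OF y] by blast
  have "hol_vec_at (\<lambda>z. g (F (inv_into U \<phi> z))) (\<phi> y)"
    using holomorphic_functionsD[OF W(3) 1(1)] 1 by (simp add: hol_vec_at_def o_def)
  moreover have "hol_vec_at (\<psi> \<circ> inv_into W g) (g (F (inv_into U \<phi> (\<phi> y))))"
    using compat_chartD(6)[OF W(2) 1(2)] W(1) 1 compat_chart_inv(3)[OF cU] by auto
  ultimately have "hol_vec_at (\<lambda>z. (\<psi> \<circ> inv_into W g) (g (F (inv_into U \<phi> z)))) (\<phi> y)"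
    by (rule hol_vec_at_compose)
  then show ?thesis
  proof (rule hol_vec_at_transform)
    have "openin N {y \<in> topspace N. F y \<in> W}"
      by (rule openin_continuous_map_preimage[OF cont compat_chartD(1)[OF W(2)]])
    then show "open {z \<in> \<phi> ` U. inv_into U \<phi> z \<in> {y \<in> topspace N. F y \<in> W}}"
      by (rule compat_chart_inv_preimage[OF cU])
  qed (use 1 y W(1) compat_chart_inv(3)[OF cU] compat_chart_inv(3)[OF W(2)] in auto)
  qed
  show ?thesis
    unfolding holomorphic_map_def holomorphic_vec_on_iff using cont main by blast
qed

lemma holomorphic_map_pullback:
  assumes N: "holomorphic_atlas N \<B>" and M: "holomorphic_atlas M \<A>"
    and F: "holomorphic_map N \<B> M \<A> F" and f: "f \<in> holomorphic_functions M \<A>"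
  shows "(\<lambda>y. f (F y)) \<in> holomorphic_functions N \<B>"
proof (rule holomorphic_functionsI)
  fix U \<phi> z assume U: "(U,\<phi>) \<in> \<B>" "z \<in> \<phi> ` U"
  have cont: "continuous_map N M F" using F by (simp add: holomorphic_map_def)
  have cU: "compat_chart N \<B> U \<phi>" by (rule compat_chart_member[OF N U(1)])
  define y where "y = inv_into U \<phi> z"
  have y: "y \<in> U" "\<phi> y = z" using compat_chart_inv[OF cU] U(2) by (auto simp: y_def)
  have Fy: "F y \<in> topspace M"
    using y compat_chartD(4)[OF cU] continuous_map_image_subset_topspace[OF cont] by blast
  then obtain V \<psi> where V: "(V,\<psi>) \<in> \<A>" "F y \<in> V"
    using atlas_chart_at[OF M] by blast
  have cV: "compat_chart M \<A> V \<psi>" by (rule compat_chart_member[OF M V(1)])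
  have "z \<in> \<phi> ` (U \<inter> F -` V)" using y V by blast
  then have "hol_vec_at (\<psi> \<circ> F \<circ> inv_into U \<phi>) z"
    using F U(1) V(1) unfolding holomorphic_map_def holomorphic_vec_on_iff by blast
  moreover have "hol_at (f \<circ> inv_into V \<psi>) ((\<psi> \<circ> F \<circ> inv_into U \<phi>) z)"
    using holomorphic_functionsD[OF f V(1)] V(2) by (simp add: y_def)
  ultimately have "hol_at (\<lambda>w. (f \<circ> inv_into V \<psi>) ((\<psi> \<circ> F \<circ> inv_into U \<phi>) w)) z"
    by (rule hol_at_compose)
  then show "hol_at ((\<lambda>y. f (F y)) \<circ> inv_into U \<phi>) z"
  proof (rule hol_at_transform)
    have "openin N {y \<in> topspace N. F y \<in> V}"
      by (rule openin_continuous_map_preimage[OF cont compat_chartD(1)[OF cV]])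
    then show "open {z \<in> \<phi> ` U. inv_into U \<phi> z \<in> {y \<in> topspace N. F y \<in> V}}"
      by (rule compat_chart_inv_preimage[OF cU])
  qed (use U(2) y V(2) compat_chart_inv(3)[OF cV] compat_chartD(4)[OF cU] in \<open>auto simp: y_def\<close>)
qed

lemma continuous_map_vec_lambda:
  fixes g :: "'n::finite \<Rightarrow> 'a \<Rightarrow> complex"
  assumes "\<And>i. continuous_map M euclidean (g i)"
  shows "continuous_map M euclidean (\<lambda>y. \<chi> i. g i y)"
  using assms unfolding continuous_map_atin by (auto intro!: tendsto_vec_lambda)

text \<open>Independent differentials make the functions local coordinates by the inverse function
  theorem; transitions to the atlas pass through the holomorphic local inverse \<open>h\<close> and
  the chart \<open>\<phi>\<close>.\<close>

lemma compat_chart_from_functions: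
  fixes \<A> :: "('a, 'n::finite) atlas"
  assumes M: "holomorphic_atlas M \<A>" and U: "(U,\<phi>) \<in> \<A>" "x \<in> U"
    and g: "\<And>i. g i \<in> holomorphic_functions M \<A>"
    and inj: "\<And>v. (\<And>i. dd (g i \<circ> inv_into U \<phi>) (\<phi> x) v = 0) \<Longrightarrow> v = 0"
  shows "\<exists>V. x \<in> V \<and> compat_chart M \<A> V (\<lambda>y. \<chi> i. g i y)"
proof -
  define \<gamma> where "\<gamma> = (\<lambda>y. \<chi> i::'n. g i y)"
  define G where "G = (\<lambda>z. \<gamma> (inv_into U \<phi> z))"
  have cU: "compat_chart M \<A> U \<phi>" by (rule compat_chart_member[OF M U(1)])
  have G: "hol_vec_at G z" if "z \<in> \<phi> ` U" for z
    using holomorphic_functionsD[OF g U(1) that] by (simp add: hol_vec_at_def G_def \<gamma>_def o_def)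
  obtain U' V' h where U': "open U'" "U' \<subseteq> \<phi> ` U" "\<phi> x \<in> U'" "open V'" "homeomorphism U' V' G h"
    "\<And>y. y \<in> V' \<Longrightarrow> hol_vec_at h y"
    by (rule hol_inverse_function[OF compat_chartD(2)[OF cU] G, of "\<phi> x"])
       (use U inj in \<open>auto simp: G_def \<gamma>_def o_def\<close>)
  define V where "V = {y\<in>U. \<phi> y \<in> U'}"
  have V: "openin M V" "x \<in> V" "V \<subseteq> U"
    unfolding V_def using compat_chart_open_preimage[OF cU U'(1)] U U' by auto
  have \<phi>V: "\<phi> ` V = U'" using U'(2) by (auto simp: V_def)
  have \<gamma>\<phi>: "\<gamma> y = G (\<phi> y)" if "y \<in> U" for y
    using compat_chart_inv(3)[OF cU that] by (simp add: G_def)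
  have \<gamma>V: "\<gamma> ` V = V'"
  proof -
    have "\<gamma> ` V = G ` \<phi> ` V" using \<gamma>\<phi> V(3) by (auto simp: image_image intro!: image_cong)
    then show ?thesis using U'(5) by (simp add: \<phi>V homeomorphism_def)
  qed
  have hG: "h (G z) = z" if "z \<in> U'" for z
    using U'(5) that by (simp add: homeomorphism_def)
  have inj\<gamma>: "inj_on \<gamma> V"
    using hG \<gamma>\<phi> V(3) compat_chart_inv(3)[OF cU] by (intro inj_onI) (metis (no_types, lifting) V_def mem_Collect_eq)
  have inv\<gamma>: "inv_into V \<gamma> w = inv_into U \<phi> (h w)" if "w \<in> V'" for w
  proof -
    have "inv_into U \<phi> (h w) \<in> V" "\<gamma> (inv_into U \<phi> (h w)) = w"
    proof -
      have hw: "h w \<in> U'" "G (h w) = w" using U'(5) that by (auto simp: homeomorphism_def)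
      then show "inv_into U \<phi> (h w) \<in> V" "\<gamma> (inv_into U \<phi> (h w)) = w"
        using compat_chart_inv[OF cU] U'(2) by (auto simp: V_def G_def)
    qed
    then show ?thesis using inj\<gamma> by (metis inv_into_f_f)
  qed
  have cont: "continuous_map (subtopology M V) (top_of_set V') \<gamma>"
  proof -
    have "continuous_map M euclidean \<gamma>"
      unfolding \<gamma>_def by (intro continuous_map_vec_lambda holomorphic_functions_continuous[OF M g])
    then show ?thesis
      using \<gamma>V by (auto simp: continuous_map_in_subtopology continuous_map_from_subtopology image_subset_iff)
  qed
  have hom: "homeomorphic_map (subtopology M V) (top_of_set V') \<gamma>"
    unfolding homeomorphic_map_maps homeomorphic_maps_def
  proof (intro exI[of _ "inv_into V \<gamma>"] conjI cont ballI)
    have "continuous_on V' h" using U'(5) by (simp add: homeomorphism_def)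
    then have "continuous_map (top_of_set V') (top_of_set (\<phi> ` U)) h"
      using U'(2,5) by (auto simp: homeomorphism_def)
    from continuous_map_compose[OF this compat_chart_continuous_inv[OF cU]]
    have "continuous_map (top_of_set V') M (inv_into V \<gamma>)"
      by (rule continuous_map_eq) (simp add: inv\<gamma>)
    then show "continuous_map (top_of_set V') (subtopology M V) (inv_into V \<gamma>)"
      using \<gamma>V by (auto simp: continuous_map_in_subtopology inv_into_into)
  qed (use \<gamma>V inj\<gamma> V(1) openin_subset in \<open>auto simp: f_inv_into_f\<close>)
  have "compat_chart M \<A> V \<gamma>"
    unfolding compat_chart_def holomorphic_atlas_def
  proof (intro conjI)
    show "\<forall>(U, \<phi>)\<in>insert (V, \<gamma>) \<A>. openin M U \<and> open (\<phi> ` U) \<and>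
        homeomorphic_map (subtopology M U) (top_of_set (\<phi> ` U)) \<phi>"
      using M hom V(1) U'(4) unfolding holomorphic_atlas_def by (auto simp: \<gamma>V)
    show "(\<Union>(U, \<phi>)\<in>insert (V, \<gamma>) \<A>. U) = topspace M"
      using M openin_subset[OF V(1)] unfolding holomorphic_atlas_def by auto
    have 1: "hol_vec_at (\<gamma> \<circ> inv_into W \<psi>) z" if "(W,\<psi>) \<in> \<A>" "z \<in> \<psi> ` W" for W \<psi> z
      using holomorphic_functionsD[OF g that] by (simp add: hol_vec_at_def \<gamma>_def o_def)
    have 2: "hol_vec_at (\<psi> \<circ> inv_into V \<gamma>) z" if WA: "(W,\<psi>) \<in> \<A>" and zW: "z \<in> \<gamma> ` (V \<inter> W)" for W \<psi> z
    proof -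
      have z: "z \<in> V'" using zW \<gamma>V by blast
      have hz: "inv_into U \<phi> (h z) \<in> W"
      proof -
        obtain y where "y \<in> V" "y \<in> W" "z = \<gamma> y" using zW by blast
        then show ?thesis using inv\<gamma>[OF z] inj\<gamma> by (metis inv_into_f_f)
      qed
      have "h z \<in> \<phi> ` (U \<inter> W)"
      proof -
        have "h z \<in> \<phi> ` U" using U'(2,5) z by (auto simp: homeomorphism_def)
        then show ?thesis using compat_chart_inv[OF cU] hz by (metis IntI image_eqI)
      qed
      then have "hol_vec_at (\<psi> \<circ> inv_into U \<phi>) (h z)"
        by (rule compat_chartD(6)[OF cU WA])
      from hol_vec_at_compose[OF U'(6)[OF z] this]
      show ?thesis
        by (rule hol_vec_at_transform[OF _ U'(4) z]) (simp add: inv\<gamma>)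
    qed
    have 3: "hol_vec_at (\<gamma> \<circ> inv_into V \<gamma>) z" if "z \<in> \<gamma> ` V" for z
    proof (rule hol_vec_at_transform[of "\<lambda>z. z"])
      show "hol_vec_at (\<lambda>z. z) z" by (simp add: hol_vec_at_def)
      show "open (\<gamma> ` V)" using U'(4) by (simp add: \<gamma>V)
    qed (use that in \<open>auto simp: f_inv_into_f\<close>)
    have 4: "hol_vec_at (\<psi>' \<circ> inv_into W \<psi>) z" if "(W,\<psi>) \<in> \<A>" "(W',\<psi>') \<in> \<A>" "z \<in> \<psi> ` (W \<inter> W')" for W \<psi> W' \<psi>' z
      using compat_chartD(6)[OF compat_chart_member[OF M that(1)] that(2,3)] .
    show "\<forall>(U, \<phi>)\<in>insert (V, \<gamma>) \<A>. \<forall>(W, \<psi>)\<in>insert (V, \<gamma>) \<A>.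
        holomorphic_vec_on (\<psi> \<circ> inv_into U \<phi>) (\<phi> ` (U \<inter> W))"
      unfolding holomorphic_vec_on_iff using 1 2 3 4 by (auto simp: Int_commute; blast)
  qed
  then show ?thesis using V(2) unfolding \<gamma>_def by blast
qed

section \<open>Torus actions and weight decompositions\<close>

text \<open>Group parameters are logarithms of diagonal entries: \<open>rot j \<theta>\<close>
  stands for turning the \<open>j\<close>-th coordinate by the angle \<open>\<theta>\<close>, and
  \<open>imag_vec\<close> runs through the compact torus.\<close>

definition rot :: "'n \<Rightarrow> real \<Rightarrow> complex^'n"
  where "rot j \<theta> = axis j (\<i> * of_real \<theta>)"

definition imag_vec :: "real^'n \<Rightarrow> complex^'n"
  where "imag_vec \<theta> = (\<chi> j. \<i> * of_real (\<theta> $ j))"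

lemma rot_add: "rot j (a + b) = rot j a + rot j b"
  by (simp add: rot_def vec_eq_iff axis_def algebra_simps)

lemma rot_0 [simp]: "rot j 0 = 0"
  by (simp add: rot_def vec_eq_iff axis_def)

lemma continuous_on_rot [continuous_intros]:
  "continuous_on S f \<Longrightarrow> continuous_on S (\<lambda>x. rot j (f x))"
  unfolding rot_def
  by (rule bounded_linear.continuous_on[OF bounded_linear_axis]) (intro continuous_intros)

lemma imag_vec_eq_sum_rot: "imag_vec \<theta> = (\<Sum>j\<in>UNIV. rot j (\<theta> $ j))"
  by (simp add: imag_vec_def rot_def vec_eq_iff axis_def sum.delta')

lemma dd_cong_open:
  assumes "hol_at f z" "open S" "z \<in> S" "\<And>w. w \<in> S \<Longrightarrow> f w = g w"
  shows "dd f z = dd g z"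
proof -
  have "(g has_derivative dd f z) (at z)"
    by (rule has_derivative_transform_within_open[OF hol_atD(1)[OF assms(1)] assms(2,3)]) (use assms(4) in auto)
  then show ?thesis by (rule frechet_derivative_at)
qed

locale torus_action =
  fixes M :: "'a topology" and \<A> :: "('a, 'n::finite) atlas" and H :: "complex^'n \<Rightarrow> 'a \<Rightarrow> 'a"
  assumes stein: "stein_manifold M \<A>" and conn: "connected_space M"
    and H_cont: "continuous_map (prod_topology euclidean M) M (\<lambda>(w,x). H w x)"
    and H_hol: "f \<in> holomorphic_functions M \<A> \<Longrightarrow> (\<lambda>x. f (H w x)) \<in> holomorphic_functions M \<A>"
    and H_add: "x \<in> topspace M \<Longrightarrow> H (w + w') x = H w (H w' x)"
    and H_id_iff: "(\<forall>x\<in>topspace M. H w x = x) \<longleftrightarrow> (\<forall>i. \<exists>m::int. w $ i = \<i> * of_real (2 * pi * of_int m))"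
begin

abbreviation "X \<equiv> topspace M"
abbreviation "\<O> \<equiv> holomorphic_functions M \<A>"

lemma atlas: "holomorphic_atlas M \<A>"
  using stein by (simp add: stein_manifold_def complex_manifold_def)

lemma haus: "Hausdorff_space M"
  using stein by (simp add: stein_manifold_def complex_manifold_def)

lemma separate: "x \<in> X \<Longrightarrow> y \<in> X \<Longrightarrow> (\<And>f. f \<in> \<O> \<Longrightarrow> f x = f y) \<Longrightarrow> x = y"
  using stein unfolding stein_manifold_def by blast

lemma H_in [simp]: "x \<in> X \<Longrightarrow> H w x \<in> X"
  using H_cont by (auto simp: continuous_map_def Pi_iff)

lemma H_0 [simp]: "x \<in> X \<Longrightarrow> H 0 x = x"
proof -
  have "\<exists>m::int. (0 :: complex^'n) $ i = \<i> * of_real (2 * pi * of_int m)" for i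
    by (rule exI[of _ 0]) simp
  then show "x \<in> X \<Longrightarrow> H 0 x = x" using H_id_iff by blast
qed

lemma H_rot_2pi: "x \<in> X \<Longrightarrow> H (rot j (2 * pi)) x = x"
proof -
  have "\<exists>m::int. rot j (2 * pi) $ i = \<i> * of_real (2 * pi * of_int m)" for i
    by (rule exI[of _ "if i = j then 1 else 0"]) (simp add: rot_def axis_def)
  then show "x \<in> X \<Longrightarrow> H (rot j (2 * pi)) x = x" using H_id_iff by blast
qed

lemma H_commute: "x \<in> X \<Longrightarrow> H w (H w' x) = H w' (H w x)"
  by (simp add: H_add[symmetric] add.commute)

lemma chart_at:
  assumes "x \<in> X" obtains U \<phi> where "(U,\<phi>) \<in> \<A>" "x \<in> U" "compat_chart M \<A> U \<phi>"
  using atlas_chart_at[OF atlas assms] compat_chart_member[OF atlas] by metis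

lemma H_cont_slice: "continuous_map M M (H w)"
proof -
  have "continuous_map M (prod_topology euclidean M) (\<lambda>x. (w, x))"
    by (intro continuous_map_pairedI) auto
  from continuous_map_compose[OF this H_cont] show ?thesis by (simp add: o_def)
qed

lemma H_cont_orbit:
  assumes "continuous_on S w" "x \<in> X"
  shows "continuous_map (top_of_set S) M (\<lambda>s. H (w s) x)"
proof -
  have "continuous_map (top_of_set S) (prod_topology euclidean M) (\<lambda>s. (w s, x))"
    by (intro continuous_map_pairedI) (use assms in auto)
  from continuous_map_compose[OF this H_cont] show ?thesis by (simp add: o_def)
qed

lemma continuous_on_orbit:
  assumes "f \<in> \<O>" "x \<in> X" "continuous_on S w"
  shows "continuous_on S (\<lambda>s. f (H (w s) x))"
  using continuous_map_compose[OF H_cont_orbit[OF assms(3,2)] holomorphic_functions_continuous[OF atlas assms(1)]]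
  by (simp add: o_def)

lemma continuous_on_orbit_chart:
  assumes "f \<in> \<O>" "compat_chart M \<A> U \<phi>" "continuous_on T w"
  shows "continuous_on (T \<times> \<phi> ` U) (\<lambda>(t,z). f (H (w t) (inv_into U \<phi> z)))"
proof -
  have "continuous_map (prod_topology (top_of_set T) (top_of_set (\<phi> ` U))) (prod_topology euclidean M)
      (\<lambda>(t,z). (w t, inv_into U \<phi> z))"
    unfolding continuous_map_prod_top using assms(3) compat_chart_continuous_inv[OF assms(2)] by simp
  from continuous_map_compose[OF continuous_map_compose[OF this H_cont] holomorphic_functions_continuous[OF atlas assms(1)]]
  have "continuous_map (top_of_set (T \<times> \<phi> ` U)) euclidean
      (f \<circ> ((\<lambda>(w, x). H w x) \<circ> (\<lambda>(t, z). (w t, inv_into U \<phi> z))))"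
    by (simp only: subtopology_Times[symmetric] prod_topology_euclidean)
  moreover have "f \<circ> ((\<lambda>(w, x). H w x) \<circ> (\<lambda>(t, z). (w t, inv_into U \<phi> z))) =
      (\<lambda>(t,z). f (H (w t) (inv_into U \<phi> z)))" by auto
  ultimately show ?thesis by simp
qed

section \<open>Averaging over circles and weight components\<close>

definition avg :: "'n \<Rightarrow> int \<Rightarrow> ('a \<Rightarrow> complex) \<Rightarrow> 'a \<Rightarrow> complex"
  where "avg j m f x = fcoef (\<lambda>\<theta>. f (H (rot j \<theta>) x)) m"

text \<open>Differentiation under the integral sign. The joint continuity of the differential in
  angle and point comes from \<open>continuous_on_dd\<close>, hence from continuity of the action
  and holomorphy in the point.\<close>

lemma avg_has_derivative:
  assumes f: "f \<in> \<O>" and U: "(U,\<phi>) \<in> \<A>" and z: "z \<in> \<phi> ` U"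
  shows "hol_at (avg j m f \<circ> inv_into U \<phi>) z"
    and "dd (avg j m f \<circ> inv_into U \<phi>) z v = fcoef (\<lambda>\<theta>. dd ((\<lambda>x. f (H (rot j \<theta>) x)) \<circ> inv_into U \<phi>) z v) m"
    and "continuous_on UNIV (\<lambda>\<theta>. dd ((\<lambda>x. f (H (rot j \<theta>) x)) \<circ> inv_into U \<phi>) z v)"
proof -
  have cU: "compat_chart M \<A> U \<phi>" by (rule compat_chart_member[OF atlas U])
  define F where "F = (\<lambda>\<theta>. (\<lambda>x. f (H (rot j \<theta>) x)) \<circ> inv_into U \<phi>)"
  have hol: "hol_at (F \<theta>) z" if "z \<in> \<phi> ` U" for \<theta> z
    unfolding F_def by (rule holomorphic_functionsD[OF H_hol[OF f] U that])
  have contF: "continuous_on (T \<times> \<phi> ` U) (\<lambda>(t,z). F t z)" for T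
    unfolding F_def o_def by (rule continuous_on_orbit_chart[OF f cU]) (intro continuous_intros)
  obtain r where r: "r > 0" "ball z r \<subseteq> \<phi> ` U"
    using z compat_chartD(2)[OF cU] open_contains_ball by blast
  define E where "E = (\<lambda>\<theta>. cis (- (of_int m * \<theta>)))"
  define G where "G = (\<lambda>\<theta> w. F \<theta> w * E \<theta>)"
  have holG: "hol_at (G \<theta>) w" if "w \<in> \<phi> ` U" for \<theta> w
    unfolding G_def using hol_at_mult[OF hol[OF that] hol_at_const] .
  have contE: "continuous_on T E" for T
    unfolding E_def by (intro continuous_intros)
  have contG: "continuous_on (T \<times> \<phi> ` U) (\<lambda>(t,z). G t z)" for T
  proof -
    have "continuous_on (T \<times> \<phi> ` U) (\<lambda>p. E (fst p))"
      by (intro continuous_on_compose2[OF contE[of UNIV]] continuous_intros) auto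
    from continuous_on_mult[OF contF this] show ?thesis
      by (simp add: G_def split_beta)
  qed
  have ddG: "dd (G \<theta>) z v = dd (F \<theta>) z v * E \<theta>" if "z \<in> \<phi> ` U" for \<theta> z v
  proof -
    have "(G \<theta> has_derivative (\<lambda>v. dd (F \<theta>) z v * E \<theta>)) (at z)"
      unfolding G_def by (intro has_derivative_mult_left hol_atD(1) hol that)
    then have "(\<lambda>v. dd (F \<theta>) z v * E \<theta>) = dd (G \<theta>) z" by (rule frechet_derivative_at)
    then show ?thesis by (simp add: fun_eq_iff)
  qed
  have "((\<lambda>w. integral (cbox (-pi) pi) (\<lambda>\<theta>. G \<theta> w)) has_derivative
      blinfun_apply (integral (cbox (-pi) pi) (\<lambda>\<theta>. ddb (G \<theta>) z))) (at z within ball z r)"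
  proof (rule leibniz_rule)
    show "((\<lambda>w. G \<theta> w) has_derivative blinfun_apply (ddb (G \<theta>) w)) (at w within ball z r)"
      if "w \<in> ball z r" for w \<theta>
    proof -
      have "w \<in> \<phi> ` U" using that r(2) by blast
      then show ?thesis
        using has_derivative_at_withinI[OF hol_atD(1)[OF holG]] by (simp add: ddb_apply[OF holG])
    qed
    show "(\<lambda>\<theta>. G \<theta> w) integrable_on cbox (- pi) pi" if "w \<in> ball z r" for w
    proof -
      have "continuous_on {-pi..pi} (\<lambda>\<theta>. (\<lambda>(t,z). G t z) (\<theta>, w))"
        by (rule continuous_on_compose2[OF contG[of UNIV]])
           (use r(2) that in \<open>auto intro!: continuous_intros\<close>)
      then show ?thesis by (simp add: integrable_continuous_real)
    qed
    have "continuous_on (UNIV \<times> \<phi> ` U) (\<lambda>(\<theta>,w). ddb (G \<theta>) w)"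
      by (rule continuous_on_ddb[OF compat_chartD(2)[OF cU] contG]) (rule holG)
    then have "continuous_on (ball z r \<times> cbox (-pi) pi) (\<lambda>p. (\<lambda>(\<theta>,w). ddb (G \<theta>) w) (prod.swap p))"
      by (rule continuous_on_compose2) (use r(2) in \<open>auto intro!: continuous_on_swap\<close>)
    then show "continuous_on (ball z r \<times> cbox (-pi) pi) (\<lambda>(w,\<theta>). ddb (G \<theta>) w)"
      by (simp add: split_beta)
  qed (use r(1) in auto)
  then have der: "((\<lambda>w. integral {-pi..pi} (\<lambda>\<theta>. G \<theta> w)) has_derivative
      blinfun_apply (integral {-pi..pi} (\<lambda>\<theta>. ddb (G \<theta>) z))) (at z)"
    using r(1) by (simp add: at_within_open[OF _ open_ball])
  have cont_ddb: "continuous_on {-pi..pi} (\<lambda>\<theta>. ddb (G \<theta>) z)"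
  proof -
    have "continuous_on {-pi..pi} (\<lambda>\<theta>. (\<lambda>(\<theta>,w). ddb (G \<theta>) w) (\<theta>, z))"
      by (rule continuous_on_compose2[OF continuous_on_ddb[OF compat_chartD(2)[OF cU] contG[of UNIV]]])
         (use z holG in \<open>auto intro!: continuous_intros\<close>)
    then show ?thesis by simp
  qed
  have app: "blinfun_apply (integral {-pi..pi} (\<lambda>\<theta>. ddb (G \<theta>) z)) v =
      integral {-pi..pi} (\<lambda>\<theta>. dd (F \<theta>) z v * E \<theta>)" for v
    using blinfun_apply_integral[OF integrable_continuous_real[OF cont_ddb]]
    by (simp add: ddb_apply[OF holG[OF z]] ddG[OF z])
  have avg_eq: "avg j m f \<circ> inv_into U \<phi> = (\<lambda>w. integral {-pi..pi} (\<lambda>\<theta>. G \<theta> w) / of_real (2 * pi))"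
    by (simp add: fun_eq_iff avg_def fcoef_def G_def F_def E_def)
  have der': "((avg j m f \<circ> inv_into U \<phi>) has_derivative
      (\<lambda>v. integral {-pi..pi} (\<lambda>\<theta>. dd (F \<theta>) z v * E \<theta>) / of_real (2 * pi))) (at z)"
    unfolding avg_eq divide_inverse app[symmetric] by (rule has_derivative_mult_left[OF der])
  have "integral {-pi..pi} (\<lambda>\<theta>. dd (F \<theta>) z (c *s v) * E \<theta>) / of_real (2 * pi) =
      c * (integral {-pi..pi} (\<lambda>\<theta>. dd (F \<theta>) z v * E \<theta>) / of_real (2 * pi))" for c v
    by (simp add: hol_atD(2)[OF hol[OF z]] mult.assoc integral_mult_right)
  with der' show "hol_at (avg j m f \<circ> inv_into U \<phi>) z" by (rule hol_atI)
  have "(\<lambda>v. integral {-pi..pi} (\<lambda>\<theta>. dd (F \<theta>) z v * E \<theta>) / of_real (2 * pi)) = dd (avg j m f \<circ> inv_into U \<phi>) z"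
    by (rule frechet_derivative_at[OF der'])
  then show "dd (avg j m f \<circ> inv_into U \<phi>) z v = fcoef (\<lambda>\<theta>. dd ((\<lambda>x. f (H (rot j \<theta>) x)) \<circ> inv_into U \<phi>) z v) m"
    by (simp add: fun_eq_iff fcoef_def E_def F_def)
  have "continuous_on UNIV (\<lambda>\<theta>. (\<lambda>(\<theta>,w). dd (F \<theta>) w v) (\<theta>, z))"
    by (rule continuous_on_compose2[OF continuous_on_dd[OF compat_chartD(2)[OF cU] contF[of UNIV]]])
       (use z hol in \<open>auto intro!: continuous_intros\<close>)
  then show "continuous_on UNIV (\<lambda>\<theta>. dd ((\<lambda>x. f (H (rot j \<theta>) x)) \<circ> inv_into U \<phi>) z v)"
    by (simp add: F_def)
qed

lemma avg_holomorphic: "f \<in> \<O> \<Longrightarrow> avg j m f \<in> \<O>"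
  by (rule holomorphic_functionsI) (rule avg_has_derivative)

lemma avg_rot:
  assumes "f \<in> \<O>" "x \<in> X"
  shows "avg j m f (H (rot j a) x) = cis (of_int m * a) * avg j m f x"
proof -
  define u where "u = (\<lambda>\<theta>. f (H (rot j \<theta>) x) * cis (- (of_int m * \<theta>)))"
  have "u (\<theta> + 2 * pi) = u \<theta>" for \<theta>
  proof -
    have "H (rot j (\<theta> + 2 * pi)) x = H (rot j \<theta>) x"
      using assms(2) by (simp add: rot_add H_add H_rot_2pi)
    moreover have "cis (- (of_int m * (\<theta> + 2 * pi))) = cis (- (of_int m * \<theta>)) * cis (2 * pi * of_int (-m))"
      unfolding cis_mult by (simp add: algebra_simps)
    moreover have "cis (2 * pi * of_int (-m)) = 1"
      by (rule cis_multiple_2pi) simp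
    ultimately show ?thesis by (simp only: u_def mult_1_right)
  qed
  moreover have "continuous_on UNIV u"
    unfolding u_def
    by (intro continuous_on_mult continuous_on_orbit[OF assms] continuous_on_rot continuous_on_id
        continuous_on_cis continuous_on_minus continuous_on_const)
  ultimately have "integral {-pi..pi} (\<lambda>\<theta>. u (\<theta> + a)) = integral {-pi..pi} u"
    by (intro integral_period_shift)
  moreover have "f (H (rot j \<theta>) (H (rot j a) x)) * cis (- (of_int m * \<theta>)) = cis (of_int m * a) * u (\<theta> + a)" for \<theta>
  proof -
    have "H (rot j \<theta>) (H (rot j a) x) = H (rot j (\<theta> + a)) x"
      using assms(2) by (simp add: rot_add H_add)
    moreover have "cis (- (of_int m * \<theta>)) = cis (of_int m * a) * cis (- (of_int m * (\<theta> + a)))"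
      unfolding cis_mult by (simp add: algebra_simps)
    ultimately show ?thesis by (simp add: u_def)
  qed
  ultimately show ?thesis
    by (simp add: avg_def fcoef_def integral_mult_right u_def[symmetric])
qed

text \<open>Circles are averaged one at a time; \<open>J\<close> records the coordinates already
  treated.\<close>

definition wt_on :: "'n set \<Rightarrow> int^'n \<Rightarrow> ('a \<Rightarrow> complex) \<Rightarrow> bool"
  where "wt_on J k f \<longleftrightarrow> (\<forall>j\<in>J. \<forall>a. \<forall>x\<in>X. f (H (rot j a) x) = cis (of_int (k $ j) * a) * f x)"

lemma avg_wt_on:
  assumes f: "f \<in> \<O>" and wt: "wt_on J k f"
  shows "wt_on (insert j J) k (avg j (k $ j) f)"
  unfolding wt_on_def
proof (intro ballI allI)
  fix i a x assume "i \<in> insert j J" and x: "x \<in> X"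
  then consider "i = j" | "i \<in> J" by blast
  then show "avg j (k $ j) f (H (rot i a) x) = cis (of_int (k $ i) * a) * avg j (k $ j) f x"
  proof cases
    case 1 then show ?thesis using avg_rot[OF f x] by simp
  next
    case 2
    have "f (H (rot j \<theta>) (H (rot i a) x)) = cis (of_int (k $ i) * a) * f (H (rot j \<theta>) x)" for \<theta>
      using wt 2 x H_commute[OF x, of "rot j \<theta>" "rot i a"] by (simp add: wt_on_def)
    then show ?thesis
      by (simp add: avg_def fcoef_def mult.assoc integral_mult_right)
  qed
qed

fun component :: "int^'n \<Rightarrow> 'n list \<Rightarrow> ('a \<Rightarrow> complex) \<Rightarrow> 'a \<Rightarrow> complex" where
  "component k [] f = f"
| "component k (j # js) f = component k js (avg j (k $ j) f)"

lemma component_wt_on: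
  "f \<in> \<O> \<Longrightarrow> wt_on J k f \<Longrightarrow> component k js f \<in> \<O> \<and> wt_on (J \<union> set js) k (component k js f)"
proof (induction js arbitrary: f J)
  case (Cons j js)
  show ?case
    using Cons.IH[OF avg_holomorphic[OF Cons.prems(1)] avg_wt_on[OF Cons.prems]] by simp
qed simp

lemma component_cong: "(\<And>j. j \<in> set js \<Longrightarrow> k $ j = k' $ j) \<Longrightarrow> component k js f = component k' js f"
  by (induction js arbitrary: f) auto

definition Wt :: "int^'n \<Rightarrow> ('a \<Rightarrow> complex) set"
  where "Wt k = {f \<in> \<O>. \<forall>\<theta>. \<forall>x\<in>X. f (H (imag_vec \<theta>) x) = cis (\<Sum>i\<in>UNIV. of_int (k $ i) * \<theta> $ i) * f x}"

lemma WtI: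
  assumes "f \<in> \<O>" "wt_on UNIV k f"
  shows "f \<in> Wt k"
proof -
  have "f (H (\<Sum>j\<in>J. rot j (\<theta> $ j)) x) = cis (\<Sum>j\<in>J. of_int (k $ j) * \<theta> $ j) * f x"
    if "x \<in> X" "finite J" for \<theta> :: "real^'n" and x J
    using that(2)
  proof (induction J rule: finite_induct)
    case empty
    then show ?case using that by simp
  next
    case (insert j J)
    have "f (H (rot j (\<theta> $ j)) (H (\<Sum>j\<in>J. rot j (\<theta> $ j)) x)) =
        cis (of_int (k $ j) * \<theta> $ j) * f (H (\<Sum>j\<in>J. rot j (\<theta> $ j)) x)"
      using assms(2) that by (simp add: wt_on_def)
    then show ?case
      using insert that by (simp add: H_add cis_mult[symmetric])
  qed
  then show ?thesis using assms(1) by (simp add: Wt_def imag_vec_eq_sum_rot)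
qed

text \<open>Common frame for differences of values at two points and for directional derivatives in
  a chart. Both commute with averaging over a circle, which lets them detect a weight component
  whenever they detect the function.\<close>

definition averaging :: "(('a \<Rightarrow> complex) \<Rightarrow> complex) \<Rightarrow> bool"
  where "averaging L \<longleftrightarrow>
    (\<forall>f\<in>\<O>. \<forall>g\<in>\<O>. (\<forall>x\<in>X. f x = g x) \<longrightarrow> L f = L g) \<and>
    (\<forall>f\<in>\<O>. \<forall>j. continuous_on UNIV (\<lambda>\<theta>. L (\<lambda>x. f (H (rot j \<theta>) x))) \<and>
       (\<forall>m. L (avg j m f) = fcoef (\<lambda>\<theta>. L (\<lambda>x. f (H (rot j \<theta>) x))) m))"

lemma averagingD:
  assumes "averaging L"
  shows "f \<in> \<O> \<Longrightarrow> g \<in> \<O> \<Longrightarrow> (\<And>x. x \<in> X \<Longrightarrow> f x = g x) \<Longrightarrow> L f = L g"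
    and "f \<in> \<O> \<Longrightarrow> continuous_on UNIV (\<lambda>\<theta>. L (\<lambda>x. f (H (rot j \<theta>) x)))"
    and "f \<in> \<O> \<Longrightarrow> L (avg j m f) = fcoef (\<lambda>\<theta>. L (\<lambda>x. f (H (rot j \<theta>) x))) m"
proof -
  have 1: "\<forall>f\<in>\<O>. \<forall>g\<in>\<O>. (\<forall>x\<in>X. f x = g x) \<longrightarrow> L f = L g"
    and 2: "\<forall>f\<in>\<O>. \<forall>j. continuous_on UNIV (\<lambda>\<theta>. L (\<lambda>x. f (H (rot j \<theta>) x))) \<and>
       (\<forall>m. L (avg j m f) = fcoef (\<lambda>\<theta>. L (\<lambda>x. f (H (rot j \<theta>) x))) m)"
    using assms unfolding averaging_def by (rule conjunct1, rule conjunct2)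
  show "f \<in> \<O> \<Longrightarrow> g \<in> \<O> \<Longrightarrow> (\<And>x. x \<in> X \<Longrightarrow> f x = g x) \<Longrightarrow> L f = L g"
    by (rule 1[rule_format])
  show "f \<in> \<O> \<Longrightarrow> continuous_on UNIV (\<lambda>\<theta>. L (\<lambda>x. f (H (rot j \<theta>) x)))"
    by (rule 2[rule_format, THEN conjunct1])
  show "f \<in> \<O> \<Longrightarrow> L (avg j m f) = fcoef (\<lambda>\<theta>. L (\<lambda>x. f (H (rot j \<theta>) x))) m"
    by (rule 2[rule_format, THEN conjunct2, rule_format])
qed

text \<open>If the functional killed every average over the \<open>j\<close>-th circle, a continuous
  function of the angle would have only zero Fourier coefficients; but its value at the angle 0 is
  \<open>L f\<close>.\<close>

lemma averaging_component:
  assumes L: "averaging L"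
  shows "f \<in> \<O> \<Longrightarrow> L f \<noteq> 0 \<Longrightarrow> distinct js \<Longrightarrow> \<exists>k. L (component k js f) \<noteq> 0"
proof (induction js arbitrary: f)
  case (Cons j js)
  have "\<exists>m. L (avg j m f) \<noteq> 0"
  proof (rule ccontr)
    assume "\<nexists>m. L (avg j m f) \<noteq> 0"
    then have "fcoef (\<lambda>\<theta>. L (\<lambda>x. f (H (rot j \<theta>) x))) m = 0" for m
      using averagingD(3)[OF L Cons.prems(1), of j m] by simp
    from fcoef_eq_0_imp[OF averagingD(2)[OF L Cons.prems(1)] this]
    have "L (\<lambda>x. f (H (rot j 0) x)) = 0" .
    moreover have "L (\<lambda>x. f (H (rot j 0) x)) = L f"
      by (rule averagingD(1)[OF L H_hol[OF Cons.prems(1)] Cons.prems(1)]) simp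
    ultimately show False using Cons.prems(2) by simp
  qed
  then obtain m where "L (avg j m f) \<noteq> 0" by blast
  with Cons.IH[OF avg_holomorphic[OF Cons.prems(1)]] Cons.prems(3)
  obtain k where k: "L (component k js (avg j m f)) \<noteq> 0" by auto
  define k' where "k' = (\<chi> i. if i = j then m else k $ i)"
  have "component k' (j # js) f = component k js (avg j m f)"
    using Cons.prems(3) by (auto simp: k'_def intro!: component_cong)
  with k show ?case by metis
qed auto

lemma averaging_weight:
  assumes L: "averaging L" and f: "f \<in> \<O>" "L f \<noteq> 0"
  shows "\<exists>k. \<exists>g\<in>Wt k. L g \<noteq> 0"
proof -
  obtain js :: "'n list" where js: "set js = UNIV" "distinct js"
    using finite_distinct_list[of "UNIV :: 'n set"] by auto
  from averaging_component[OF L f js(2)] obtain k where "L (component k js f) \<noteq> 0" ..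
  moreover have "component k js f \<in> Wt k"
    using component_wt_on[OF f(1), of "{}" k js] js(1) by (auto intro: WtI simp: wt_on_def)
  ultimately show ?thesis by blast
qed

lemma averaging_diff:
  assumes "x \<in> X" "y \<in> X"
  shows "averaging (\<lambda>f. f x - f y)"
  unfolding averaging_def
proof (intro conjI ballI allI impI)
  fix f j m assume f: "f \<in> \<O>"
  show "continuous_on UNIV (\<lambda>\<theta>. f (H (rot j \<theta>) x) - f (H (rot j \<theta>) y))"
    by (intro continuous_on_diff continuous_on_orbit[OF f] assms continuous_on_rot continuous_on_id)
  have "(\<lambda>\<theta>. f (H (rot j \<theta>) x) * cis (- (of_int m * \<theta>))) integrable_on {-pi..pi}" if "x \<in> X" for x
    by (intro fcoef_integrable continuous_on_orbit[OF f that] continuous_on_rot continuous_on_id)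
  then show "avg j m f x - avg j m f y = fcoef (\<lambda>\<theta>. f (H (rot j \<theta>) x) - f (H (rot j \<theta>) y)) m"
    using assms
    by (simp add: avg_def fcoef_def diff_divide_distrib[symmetric] left_diff_distrib
        Henstock_Kurzweil_Integration.integral_diff)
qed (use assms in auto)

lemma averaging_dd:
  assumes U: "(U,\<phi>) \<in> \<A>" and z: "z \<in> \<phi> ` U"
  shows "averaging (\<lambda>f. dd (f \<circ> inv_into U \<phi>) z v)"
  unfolding averaging_def
proof (intro conjI ballI allI impI)
  fix f g assume "f \<in> \<O>" "g \<in> \<O>" "\<forall>x\<in>X. f x = g x"
  have cU: "compat_chart M \<A> U \<phi>" by (rule compat_chart_member[OF atlas U])
  have "dd (f \<circ> inv_into U \<phi>) z = dd (g \<circ> inv_into U \<phi>) z"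
    by (rule dd_cong_open[OF holomorphic_functionsD[OF \<open>f \<in> \<O>\<close> U z] compat_chartD(2)[OF cU] z])
       (use \<open>\<forall>x\<in>X. f x = g x\<close> compat_chart_inv(1)[OF cU] compat_chartD(4)[OF cU] in auto)
  then show "dd (f \<circ> inv_into U \<phi>) z v = dd (g \<circ> inv_into U \<phi>) z v" by simp
qed (use avg_has_derivative[OF _ U z] in auto)

lemma weight_separate:
  assumes "x \<in> X" "y \<in> X" "\<And>k f. f \<in> Wt k \<Longrightarrow> f x = f y"
  shows "x = y"
proof (rule ccontr)
  assume "x \<noteq> y"
  then obtain f where f: "f \<in> \<O>" "f x \<noteq> f y" using separate[OF assms(1,2)] by blast
  then obtain k g where "g \<in> Wt k" "g x - g y \<noteq> 0"
    using averaging_weight[OF averaging_diff[OF assms(1,2)] f(1)] by auto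
  then show False using assms(3) by simp
qed

definition weight_chart :: "'a set \<Rightarrow> ('n \<Rightarrow> 'a \<Rightarrow> complex) \<Rightarrow> ('n \<Rightarrow> int^'n) \<Rightarrow> bool"
  where "weight_chart V g \<kappa> \<longleftrightarrow> compat_chart M \<A> V (\<lambda>y. \<chi> i. g i y) \<and> (\<forall>i. g i \<in> Wt (\<kappa> i))"

text \<open>Each function of a global coordinate system at \<open>x\<close> is replaced by one of its weight
  components, keeping the differentials at \<open>x\<close> independent.\<close>

lemma weight_chart_exists:
  assumes x: "x \<in> X"
  shows "\<exists>V g \<kappa>. x \<in> V \<and> weight_chart V g \<kappa>"
proof -
  obtain U \<phi> where U: "(U,\<phi>) \<in> \<A>" "x \<in> U" and cU: "compat_chart M \<A> U \<phi>"
    using chart_at[OF x] by blast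
  define d where "d = (\<lambda>f. dd (f \<circ> inv_into U \<phi>) (\<phi> x))"
  have \<phi>x: "\<phi> x \<in> \<phi> ` U" using U by blast
  have lin: "linear (d f)" and scale: "d f (c *s v) = c * d f v" if "f \<in> \<O>" for f c v
    unfolding d_def using dd_linear hol_atD(2) holomorphic_functionsD[OF that U(1) \<phi>x] by auto
  define indep where "indep = (\<lambda>g :: 'n \<Rightarrow> 'a \<Rightarrow> complex. \<forall>v. (\<forall>i. d (g i) v = 0) \<longrightarrow> v = 0)"
  obtain f V where f: "\<And>i. f i \<in> \<O>" "x \<in> V" "compat_chart M \<A> V (\<lambda>y. \<chi> i. f i y)"
    using stein x unfolding stein_manifold_def compat_chart_def by blast
  \<comment> \<open>Composing the coordinates with the transition back to \<open>\<phi>\<close>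
    gives the identity, so the differential \<open>E\<close> of the coordinates has the left inverse
    \<open>D\<close>.\<close>
  have "indep f"
    unfolding indep_def
  proof (intro allI impI)
    fix v assume v: "\<forall>i. d (f i) v = 0"
    define F where "F = (\<lambda>y. \<chi> i. f i y)"
    have xUV: "\<phi> x \<in> \<phi> ` (V \<inter> U)" "F x \<in> F ` (V \<inter> U)" using U f(2) by auto
    have h1: "hol_vec_at (F \<circ> inv_into U \<phi>) (\<phi> x)"
      unfolding F_def by (rule compat_chartD(7)[OF f(3) U(1) xUV(1)])
    have h2: "hol_vec_at (\<phi> \<circ> inv_into V F) (F x)"
      unfolding F_def by (rule compat_chartD(6)[OF f(3) U(1)]) (use U f(2) in auto)
    have Fx: "(F \<circ> inv_into U \<phi>) (\<phi> x) = F x" by (simp add: compat_chart_inv(3)[OF cU U(2)])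
    define D where "D = (\<lambda>v. \<chi> i. dd (\<lambda>z. (\<phi> \<circ> inv_into V F) z $ i) (F x) v)"
    have D: "((\<phi> \<circ> inv_into V F) has_derivative D) (at (F x))"
      unfolding D_def by (rule hol_vec_atD(1)[OF h2])
    define E where "E = (\<lambda>v. \<chi> i. dd (\<lambda>z. (F \<circ> inv_into U \<phi>) z $ i) (\<phi> x) v)"
    have E: "((F \<circ> inv_into U \<phi>) has_derivative E) (at (\<phi> x))"
      unfolding E_def by (rule hol_vec_atD(1)[OF h1])
    have comp: "((\<lambda>z. (\<phi> \<circ> inv_into V F) ((F \<circ> inv_into U \<phi>) z)) has_derivative (\<lambda>v. D (E v))) (at (\<phi> x))"
      by (rule has_derivative_compose[OF E]) (simp only: Fx D)
    have op: "open (\<phi> ` (V \<inter> U))"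
      by (rule compat_chart_open_image[OF cU]) (use compat_chartD(1)[OF f(3)] compat_chartD(1)[OF cU] in auto)
    have "((\<lambda>z. z) has_derivative (\<lambda>v. D (E v))) (at (\<phi> x))"
    proof (rule has_derivative_transform_within_open[OF comp op xUV(1)])
      fix z assume "z \<in> \<phi> ` (V \<inter> U)"
      then show "(\<phi> \<circ> inv_into V F) ((F \<circ> inv_into U \<phi>) z) = z"
        using compat_chart_inv(3)[OF cU] compat_chart_inv(3)[OF f(3)] by (auto simp: F_def)
    qed
    then have "(\<lambda>v. D (E v)) = (\<lambda>v. v)"
      by (rule has_derivative_unique[OF _ has_derivative_ident])
    moreover have "E v = 0"
      using v by (simp add: E_def d_def vec_eq_iff F_def o_def)
    moreover have "D 0 = 0" by (rule linear_0[OF has_derivative_linear[OF D]])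
    ultimately show "v = 0" by (metis (no_types))
  qed
  have "\<exists>g. (\<forall>i. g i \<in> \<O>) \<and> (\<forall>i\<in>I. \<exists>k. g i \<in> Wt k) \<and> indep g" if "finite I" for I :: "'n set"
    using that
  proof (induction I rule: finite_induct)
    case empty
    then show ?case using f(1) \<open>indep f\<close> by blast
  next
    case (insert i I)
    then obtain g where g: "\<And>i. g i \<in> \<O>" "\<And>i. i \<in> I \<Longrightarrow> \<exists>k. g i \<in> Wt k" "indep g" by blast
    define E where "E = (\<lambda>v. \<chi> i. d (g i) v)"
    have "linear E"
      by (rule linearI) (simp_all add: E_def vec_eq_iff linear_add[OF lin[OF g(1)]] linear_scale[OF lin[OF g(1)]])
    moreover have "inj E"
      unfolding linear_injective_0[OF \<open>linear E\<close>] using g(3) by (simp add: indep_def E_def vec_eq_iff)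
    ultimately have "surj E" by (rule linear_injective_imp_surjective) simp
    \<comment> \<open>The dual vector of \<open>g i\<close>, invisible to the other functions. A
      weight function \<open>h\<close> with nonzero derivative along \<open>v\<close> may replace
      \<open>g i\<close>, because whatever the other differentials kill is a multiple of
      \<open>v\<close>.\<close>
    then obtain v where v: "E v = axis i 1"
      by (metis (no_types) surjD)
    have vi: "d (g i) v = 1" and vj: "\<And>j. j \<noteq> i \<Longrightarrow> d (g j) v = 0"
      using arg_cong[OF v, of "\<lambda>e. e $ _"] by (simp_all add: E_def axis_def)
    have "averaging (\<lambda>f. d f v)" unfolding d_def by (rule averaging_dd[OF U(1) \<phi>x])
    then obtain k h where h: "h \<in> Wt k" "d h v \<noteq> 0"
      using averaging_weight[of "\<lambda>f. d f v" "g i"] g(1) vi by auto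
    have hO: "h \<in> \<O>" using h(1) by (simp add: Wt_def)
    have "indep (g(i := h))"
      unfolding indep_def
    proof (intro allI impI)
      fix w assume w: "\<forall>j. d ((g(i := h)) j) w = 0"
      define \<alpha> where "\<alpha> = d (g i) w"
      have "d (g j) (w - \<alpha> *s v) = 0" for j
        using w[rule_format, of j] vi vj[of j]
        by (cases "j = i") (simp_all add: linear_diff[OF lin[OF g(1)]] scale[OF g(1)] \<alpha>_def)
      then have "w - \<alpha> *s v = 0" using g(3) unfolding indep_def by blast
      then have w_eq: "w = \<alpha> *s v" by simp
      have "d h w = 0" using w[rule_format, of i] by simp
      then have "\<alpha> = 0" using h(2) by (simp add: w_eq scale[OF hO])
      then show "w = 0" by (simp add: w_eq)
    qed
    moreover have "\<forall>j. (g(i := h)) j \<in> \<O>" using g(1) hO by simp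
    moreover have "\<forall>j\<in>insert i I. \<exists>k. (g(i := h)) j \<in> Wt k" using g(2) h(1) by auto
    ultimately show ?case by blast
  qed
  from this[of UNIV] obtain g where g: "\<And>i. g i \<in> \<O>" "\<And>i. \<exists>k. g i \<in> Wt k" "indep g" by auto
  obtain \<kappa> where \<kappa>: "\<And>i. g i \<in> Wt (\<kappa> i)" using g(2) by metis
  have "\<exists>V. x \<in> V \<and> compat_chart M \<A> V (\<lambda>y. \<chi> i. g i y)"
    by (rule compat_chart_from_functions[OF atlas U g(1)]) (use g(3) in \<open>auto simp: indep_def d_def\<close>)
  then show ?thesis using \<kappa> unfolding weight_chart_def by blast
qed

end

section \<open>Characters\<close>

lemma norm_axis: "norm (axis i c :: complex^'n) = cmod c"
proof -
  have "(\<Sum>j\<in>UNIV. (cmod ((axis i c :: complex^'n) $ j))\<^sup>2) = (\<Sum>j\<in>UNIV. if j = i then (cmod c)\<^sup>2 else 0)"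
    by (intro sum.cong) (auto simp: axis_def)
  then show ?thesis by (simp add: norm_vec_def L2_set_def)
qed

lemma hol_at_exp: "hol_at f z \<Longrightarrow> hol_at (\<lambda>z. exp (f z)) z"
  by (rule hol_at_compose_field[where g=exp]) (auto simp: field_differentiable_def intro: DERIV_exp)

text \<open>Scaled to modulus at most 1, a nonzero \<open>c\<close> would be a point other than 0
  where \<open>exp\<close> is 1, but the periods of \<open>exp\<close> have spacing
  \<open>2 * pi\<close>.\<close>

lemma exp_eq_1_near_0_imp:
  assumes "e > 0" "\<And>t::real. \<bar>t\<bar> < e \<Longrightarrow> exp (t *\<^sub>R c) = 1"
  shows "c = (0::complex)"
proof -
  define t where "t = min (e/2) (1 / (cmod c + 1))"
  have t: "0 < t" "\<bar>t\<bar> < e" using assms(1) by (auto simp: t_def min_def add_nonneg_pos)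
  have "t \<le> 1 / (cmod c + 1)" by (simp add: t_def)
  then have "t * cmod c \<le> 1 / (cmod c + 1) * cmod c" by (intro mult_right_mono) auto
  also have "\<dots> \<le> 1"
  proof -
    have "0 < cmod c + 1" by (simp add: add_nonneg_pos)
    then show ?thesis by (simp add: field_simps)
  qed
  finally have "t * cmod c \<le> 1" .
  then have le: "\<bar>Im (t *\<^sub>R c)\<bar> \<le> 1" using abs_Im_le_cmod[of "t *\<^sub>R c"] t(1) by simp
  obtain n :: int where n: "Re (t *\<^sub>R c) = 0" "Im (t *\<^sub>R c) = of_int (2 * n) * pi"
    using assms(2)[OF t(2)] unfolding exp_eq_1 by blast
  have "n = 0"
  proof (rule ccontr)
    assume "n \<noteq> 0"
    then have "1 \<le> \<bar>of_int n :: real\<bar>" by linarith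
    then have "2 * pi * 1 \<le> 2 * pi * \<bar>of_int n\<bar>" by (intro mult_left_mono) auto
    also have "\<dots> = \<bar>Im (t *\<^sub>R c)\<bar>" unfolding n(2) by (simp add: abs_mult)
    finally show False using le pi_gt3 by linarith
  qed
  then show ?thesis using n t(1) by (simp add: complex_eq_iff)
qed

lemma additive_continuous_imp_linear:
  fixes \<rho> :: "'b::real_normed_vector \<Rightarrow> 'c::real_normed_vector"
  assumes cont: "continuous_on UNIV \<rho>" and add: "\<And>x y. \<rho> (x + y) = \<rho> x + \<rho> y"
  shows "linear \<rho>"
proof (rule linearI[OF add])
  fix r :: real and w
  have zero: "\<rho> 0 = 0" using add[of 0 0] by simp
  have minus: "\<rho> (- x) = - \<rho> x" for x using add[of x "-x"] zero by (simp add: add_eq_0_iff)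
  have nat: "\<rho> (of_nat n *\<^sub>R x) = of_nat n *\<^sub>R \<rho> x" for n x
    by (induction n) (simp_all add: zero add scaleR_left_distrib)
  have int: "\<rho> (of_int m *\<^sub>R x) = of_int m *\<^sub>R \<rho> x" for m x
    by (cases m) (use nat[of _ x] minus in \<open>simp_all del: of_nat_Suc\<close>)
  have ratc: "\<rho> (q *\<^sub>R w) - q *\<^sub>R \<rho> w = 0" if "q \<in> \<rat>" for q :: real
  proof -
    obtain a b :: int where ab: "b > 0" "q = of_int a / of_int b"
      using \<open>q \<in> \<rat>\<close> by (elim Rats_cases')
    have "of_int b *\<^sub>R \<rho> (q *\<^sub>R w) = \<rho> (of_int b *\<^sub>R (q *\<^sub>R w))" by (rule int[symmetric])
    also have "of_int b *\<^sub>R (q *\<^sub>R w) = of_int a *\<^sub>R w" using ab by simp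
    also have "\<rho> (of_int a *\<^sub>R w) = of_int b *\<^sub>R (q *\<^sub>R \<rho> w)" using ab by (simp add: int)
    finally have "of_int b *\<^sub>R (\<rho> (q *\<^sub>R w) - q *\<^sub>R \<rho> w) = 0"
      by (simp add: scaleR_right_diff_distrib)
    then show ?thesis using ab(1) unfolding scaleR_eq_0_iff by simp
  qed
  have "continuous_on (closure \<rat>) (\<lambda>q. \<rho> (q *\<^sub>R w) - q *\<^sub>R \<rho> w)"
    by (intro continuous_intros continuous_on_compose2[OF cont]) auto
  from continuous_constant_on_closure[OF this ratc, of r]
  have "\<rho> (r *\<^sub>R w) - r *\<^sub>R \<rho> w = 0" by (simp add: Rats_closure_real)
  then show "\<rho> (r *\<^sub>R w) = r *\<^sub>R \<rho> w" by simp
qed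

text \<open>Take a continuous logarithm; its failure to be additive is a continuous function with
  values in the integer multiples of \<open>2 * pi * \<i>\<close>, hence constant. The exponent is
  linear over the reals only, which is all that a merely continuous character provides.\<close>

lemma continuous_character_exp:
  fixes h :: "'b::euclidean_space \<Rightarrow> complex"
  assumes cont: "continuous_on UNIV h" and mult: "\<And>x y. h (x + y) = h x * h y" and nz: "\<And>x. h x \<noteq> 0"
  obtains \<rho> where "linear \<rho>" "\<And>x. h x = exp (\<rho> x)"
proof -
  obtain g where g: "continuous_on UNIV g" "\<And>x. h x = exp (g x)"
    using continuous_logarithm_on_contractible[OF cont contractible_UNIV] nz by (metis UNIV_I)
  define \<rho> where "\<rho> = (\<lambda>x. g x - g 0)"
  have "h 0 = 1" using mult[of 0 0] nz[of 0] by simp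
  then have h: "h x = exp (\<rho> x)" for x using g(2) by (simp add: \<rho>_def exp_diff)
  have cont_\<rho>: "continuous_on UNIV \<rho>" unfolding \<rho>_def by (intro continuous_intros g)
  define d where "d = (\<lambda>p. \<rho> (fst p + snd p) - \<rho> (fst p) - \<rho> (snd p))"
  have d_int: "\<exists>n::int. d p = of_int (2 * n) * pi * \<i>" for p
  proof -
    have "exp (\<rho> (fst p + snd p)) = exp (\<rho> (fst p) + \<rho> (snd p))"
      using mult by (simp add: h exp_add)
    then show ?thesis unfolding exp_eq d_def by (auto simp: algebra_simps)
  qed
  have "continuous_on UNIV d"
    unfolding d_def by (intro continuous_intros continuous_on_compose2[OF cont_\<rho>]) auto
  moreover have "\<exists>e>0. \<forall>q. q \<in> UNIV \<and> d q \<noteq> d p \<longrightarrow> e \<le> norm (d q - d p)" for p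
  proof (intro exI[of _ 1] conjI allI impI)
    fix q assume ne: "q \<in> UNIV \<and> d q \<noteq> d p"
    obtain m n :: int where mn: "d q = of_int (2 * m) * pi * \<i>" "d p = of_int (2 * n) * pi * \<i>"
      using d_int by metis
    have "d q - d p = of_int (2 * (m - n)) * pi * \<i>" by (simp add: mn algebra_simps)
    then have "norm (d q - d p) = \<bar>of_int (2 * (m - n))\<bar> * pi"
      by (simp only: norm_mult norm_of_int norm_of_real norm_ii) (simp add: abs_mult)
    moreover have "2 \<le> \<bar>of_int (2 * (m - n)) :: real\<bar>"
    proof -
      have "m \<noteq> n" using ne mn by auto
      then have "2 \<le> \<bar>2 * (m - n)\<bar>" by arith
      then show ?thesis by linarith
    qed
    then have "2 * pi \<le> \<bar>of_int (2 * (m - n)) :: real\<bar> * pi" by (intro mult_right_mono) auto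
    ultimately show "1 \<le> norm (d q - d p)" using pi_gt3 by linarith
  qed simp
  ultimately have "d constant_on UNIV"
    by (intro continuous_discrete_range_constant) auto
  then have "d (x, y) = d (0, 0)" for x y by (auto simp: constant_on_def)
  then have "\<rho> (x + y) = \<rho> x + \<rho> y" for x y by (simp add: d_def \<rho>_def algebra_simps)
  with cont_\<rho> have "linear \<rho>" by (rule additive_continuous_imp_linear)
  with h that show ?thesis by blast
qed

definition kdot :: "int^'n \<Rightarrow> complex^'n \<Rightarrow> complex"
  where "kdot k w = (\<Sum>i\<in>UNIV. of_int (k $ i) * w $ i)"

lemma kdot_add: "kdot k (a + b) = kdot k a + kdot k b"
  by (simp add: kdot_def algebra_simps sum.distrib)

lemma kdot_0 [simp]: "kdot 0 w = 0" "kdot k 0 = 0"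
  by (simp_all add: kdot_def)

lemma kdot_scaleR: "kdot k (r *\<^sub>R w) = r *\<^sub>R kdot k w"
  by (simp add: kdot_def scaleR_sum_right)

lemma kdot_imag_vec: "kdot k (imag_vec \<theta>) = \<i> * of_real (\<Sum>i\<in>UNIV. of_int (k $ i) * \<theta> $ i)"
  by (simp add: kdot_def imag_vec_def sum_distrib_left mult_ac)

lemma imag_vec_scaleR: "imag_vec (r *\<^sub>R \<theta>) = r *\<^sub>R imag_vec \<theta>"
  by (simp add: imag_vec_def vec_eq_iff) (simp add: scaleR_conv_of_real mult_ac)

lemma imag_vec_eq_0_iff [simp]: "imag_vec \<theta> = 0 \<longleftrightarrow> \<theta> = 0"
  by (simp add: imag_vec_def vec_eq_iff)

lemma bounded_linear_imag_vec: "bounded_linear imag_vec"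
  unfolding linear_conv_bounded_linear[symmetric]
  by (rule linearI) (simp_all add: imag_vec_scaleR, simp add: imag_vec_def vec_eq_iff algebra_simps)

text \<open>The weight matrix of a weight chart: entry \<open>i\<close> is the logarithm of the
  factor that the \<open>i\<close>-th coordinate is meant to receive from \<open>w\<close>.\<close>

definition kmap :: "('n \<Rightarrow> int^'n) \<Rightarrow> complex^'n \<Rightarrow> complex^'n"
  where "kmap \<kappa> w = (\<chi> i. kdot (\<kappa> i) w)"

lemma linear_kmap: "linear (kmap \<kappa>)"
  by (rule linearI) (simp_all add: kmap_def vec_eq_iff kdot_add kdot_scaleR)

section \<open>Weight charts, uniqueness sets and characters\<close>

context torus_action
begin

lemma Wt_holomorphic: "f \<in> Wt k \<Longrightarrow> f \<in> \<O>"
  by (simp add: Wt_def)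

lemma Wt_imag: "f \<in> Wt k \<Longrightarrow> x \<in> X \<Longrightarrow> f (H (imag_vec \<theta>) x) = exp (kdot k (imag_vec \<theta>)) * f x"
  by (simp add: Wt_def kdot_imag_vec cis_conv_exp)

lemma zero_if_zero_on_open:
  assumes "f \<in> \<O>" "openin M W" "W \<noteq> {}" "\<And>y. y \<in> W \<Longrightarrow> f y = 0" "x \<in> X"
  shows "f x = 0"
  by (rule holomorphic_functions_identity[OF atlas conn assms])

lemma H_id_if_id_on_open:
  assumes "openin M W" "W \<noteq> {}" "\<And>y. y \<in> W \<Longrightarrow> H w y = y" "x \<in> X"
  shows "H w x = x"
proof (rule separate)
  fix f assume f: "f \<in> \<O>"
  have "f (H w x) - f x = 0"
    by (rule zero_if_zero_on_open[OF _ assms(1,2)])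
       (use assms in \<open>auto intro!: holomorphic_functions_diff H_hol f\<close>)
  then show "f (H w x) = f x" by simp
qed (use assms in auto)

lemma weight_chartD:
  assumes "weight_chart V g \<kappa>"
  shows "compat_chart M \<A> V (\<lambda>y. \<chi> i. g i y)" "openin M V" "V \<subseteq> X" "g i \<in> Wt (\<kappa> i)" "g i \<in> \<O>"
    and "y \<in> V \<Longrightarrow> z \<in> V \<Longrightarrow> (\<And>i. g i y = g i z) \<Longrightarrow> y = z"
proof -
  show c: "compat_chart M \<A> V (\<lambda>y. \<chi> i. g i y)" and w: "g i \<in> Wt (\<kappa> i)"
    using assms by (auto simp: weight_chart_def)
  show "openin M V" "V \<subseteq> X" using compat_chartD[OF c] by auto
  show "g i \<in> \<O>" by (rule Wt_holomorphic[OF w])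
  show "y \<in> V \<Longrightarrow> z \<in> V \<Longrightarrow> (\<And>i. g i y = g i z) \<Longrightarrow> y = z"
    using inj_onD[OF compat_chartD(3)[OF c]] by (simp add: vec_eq_iff)
qed

lemma open_H_preimage:
  assumes "openin M V" "x \<in> V" "continuous_on UNIV w" "w t = 0"
  shows "\<exists>T W. open T \<and> t \<in> T \<and> openin M W \<and> x \<in> W \<and> (\<forall>s\<in>T. \<forall>y\<in>W. H (w s) y \<in> V)"
proof -
  have "continuous_map (prod_topology euclidean M) (prod_topology euclidean M) (\<lambda>(s,y). (w s, y))"
    unfolding continuous_map_prod_top using assms(3) by simp
  from continuous_map_compose[OF this H_cont]
  have "continuous_map (prod_topology euclidean M) M ((\<lambda>(w,x). H w x) \<circ> (\<lambda>(s,y). (w s, y)))" .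
  from openin_continuous_map_preimage[OF this assms(1)]
  have op: "openin (prod_topology euclidean M) {p \<in> topspace (prod_topology euclidean M). H (w (fst p)) (snd p) \<in> V}"
    by (simp add: split_beta)
  have x: "x \<in> X" using assms(1,2) openin_subset by blast
  have "(t, x) \<in> {p \<in> topspace (prod_topology euclidean M). H (w (fst p)) (snd p) \<in> V}"
    using x assms(2,4) by simp
  from op[unfolded openin_prod_topology_alt, rule_format, OF this]
  obtain T W where "openin euclidean T" "openin M W" "t \<in> T" "x \<in> W"
      "T \<times> W \<subseteq> {p \<in> topspace (prod_topology euclidean M). H (w (fst p)) (snd p) \<in> V}"
    by (elim exE conjE)
  then show ?thesis by (intro exI[of _ T] exI[of _ W]) auto
qed

text \<open>For small \<open>t\<close> points near \<open>x\<close> stay in the chart, where the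
  coordinates separate points, so they are fixed; the identity theorem makes
  \<open>t *\<^sub>R w\<close> act trivially on \<open>M\<close>. All small multiples of
  \<open>w\<close> are then periods, and periods are discrete.\<close>

lemma weight_chart_stabilizer:
  assumes V: "weight_chart V g \<kappa>" "x \<in> V"
    and fx: "\<And>i t y. y \<in> X \<Longrightarrow> g i (H (t *\<^sub>R w) y) = g i y"
  shows "w = 0"
proof -
  have "continuous_on UNIV (\<lambda>t::real. t *\<^sub>R w)" by (intro continuous_intros)
  from open_H_preimage[OF weight_chartD(2)[OF V(1)] V(2) this, of 0]
  obtain T W where TW: "open T" "0 \<in> T" "openin M W" "x \<in> W" "\<And>t y. t \<in> T \<Longrightarrow> y \<in> W \<Longrightarrow> H (t *\<^sub>R w) y \<in> V"
    by auto
  obtain e where e: "e > 0" "\<And>t. \<bar>t\<bar> < e \<Longrightarrow> t \<in> T"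
    using TW(1,2) unfolding open_dist by (metis dist_0_norm dist_commute real_norm_def)
  have W': "openin M (W \<inter> V)" "x \<in> W \<inter> V" using TW V weight_chartD(2)[OF V(1)] by auto
  have triv: "H (t *\<^sub>R w) y = y" if "\<bar>t\<bar> < e" "y \<in> X" for t y
  proof (rule H_id_if_id_on_open[OF W'(1) _ _ that(2)])
    fix z assume z: "z \<in> W \<inter> V"
    then have "H (t *\<^sub>R w) z \<in> V" "z \<in> X" using TW(5) e(2)[OF that(1)] weight_chartD(3)[OF V(1)] by auto
    then show "H (t *\<^sub>R w) z = z"
      using weight_chartD(6)[OF V(1), of "H (t *\<^sub>R w) z" z] z fx by blast
  qed (use W' in auto)
  have "w $ i = 0" for i
  proof (rule exp_eq_1_near_0_imp[OF e(1)])
    fix t :: real assume "\<bar>t\<bar> < e"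
    then obtain m :: int where "(t *\<^sub>R w) $ i = \<i> * of_real (2 * pi * of_int m)"
      using triv H_id_iff[of "t *\<^sub>R w"] by blast
    then have "exp (t *\<^sub>R (w $ i)) = cis (2 * pi * of_int m)"
      by (simp add: cis_conv_exp)
    then show "exp (t *\<^sub>R (w $ i)) = 1"
      by (metis Ints_of_int cis_multiple_2pi)
  qed
  then show ?thesis by (simp add: vec_eq_iff)
qed

text \<open>On the imaginary subspace a kernel vector would move no coordinate, so
  \<open>weight_chart_stabilizer\<close> applies; since the matrix is real, real and imaginary parts
  are treated separately. The weights of a chart are thus linearly independent.\<close>

lemma weight_chart_kmap_inj:
  assumes V: "weight_chart V g \<kappa>" "x \<in> V" and "kmap \<kappa> w = 0"
  shows "w = 0"
proof -
  have real: "\<theta> = 0" if "\<And>i. (\<Sum>j\<in>UNIV. of_int (\<kappa> i $ j) * \<theta> $ j) = 0" for \<theta> :: "real^'n"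
  proof -
    have "imag_vec \<theta> = 0"
    proof (rule weight_chart_stabilizer[OF V])
      fix i t y assume "y \<in> X"
      have "kdot (\<kappa> i) (imag_vec (t *\<^sub>R \<theta>)) = 0"
        using that by (simp add: imag_vec_scaleR kdot_scaleR kdot_imag_vec)
      then show "g i (H (t *\<^sub>R imag_vec \<theta>) y) = g i y"
        using Wt_imag[OF weight_chartD(4)[OF V(1)] \<open>y \<in> X\<close>, of i "t *\<^sub>R \<theta>"] by (simp add: imag_vec_scaleR)
    qed
    then show ?thesis by simp
  qed
  have *: "(\<Sum>j\<in>UNIV. of_int (\<kappa> i $ j) * w $ j) = 0" for i
    using assms(3) by (simp add: kmap_def kdot_def vec_eq_iff)
  have "(\<chi> j. Re (w $ j)) = 0" "(\<chi> j. Im (w $ j)) = 0"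
    using arg_cong[OF *, of Re] arg_cong[OF *, of Im] by (auto intro!: real simp: Re_sum Im_sum)
  then show ?thesis by (simp add: vec_eq_iff complex_eq_iff)
qed

definition nonzero :: "('a \<Rightarrow> complex) \<Rightarrow> bool"
  where "nonzero f \<longleftrightarrow> (\<exists>x\<in>X. f x \<noteq> 0)"

lemma open_nonvanishing: "f \<in> \<O> \<Longrightarrow> openin M {x \<in> X. f x \<noteq> 0}"
  using openin_continuous_map_preimage[OF holomorphic_functions_continuous[OF atlas], of f "- {0}"]
    open_Compl[OF closed_singleton, of "0::complex"] by simp

lemma nonzero_on_open:
  assumes "finite I" "\<And>i. i \<in> I \<Longrightarrow> f i \<in> \<O> \<and> nonzero (f i)" "openin M W" "W \<noteq> {}"
  shows "\<exists>y\<in>W. \<forall>i\<in>I. f i y \<noteq> 0"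
  using assms
proof (induction I arbitrary: W rule: finite_induct)
  case (insert i I)
  have "openin M (W \<inter> {x \<in> X. f i x \<noteq> 0})"
    using insert.prems open_nonvanishing by blast
  moreover have "W \<inter> {x \<in> X. f i x \<noteq> 0} \<noteq> {}"
  proof
    assume "W \<inter> {x \<in> X. f i x \<noteq> 0} = {}"
    then have "f i y = 0" if "y \<in> W" for y using that openin_subset[OF insert.prems(2)] by blast
    then show False
      using zero_if_zero_on_open[OF _ insert.prems(2,3)] insert.prems(1) unfolding nonzero_def by blast
  qed
  ultimately have "\<exists>y\<in>W \<inter> {x \<in> X. f i x \<noteq> 0}. \<forall>i\<in>I. f i y \<noteq> 0"
    using insert.IH insert.prems(1) by blast
  then show ?case by blast
qed auto

lemma weight_chart_nonzero:
  assumes "weight_chart V g \<kappa>" "x \<in> V"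
  shows "nonzero (g i)"
proof (rule ccontr)
  assume "\<not> nonzero (g i)"
  then have zero: "g i y = 0" if "y \<in> V" for y
    using that weight_chartD(3)[OF assms(1)] unfolding nonzero_def by blast
  define z where "z = (\<chi> i. g i x)"
  have "open ((\<lambda>y. \<chi> i. g i y) ` V)" "z \<in> (\<lambda>y. \<chi> i. g i y) ` V"
    using compat_chartD(2)[OF weight_chartD(1)[OF assms(1)]] assms(2) by (auto simp: z_def)
  then obtain e where e: "e > 0" "ball z e \<subseteq> (\<lambda>y. \<chi> i. g i y) ` V"
    using open_contains_ball by blast
  have "dist z (z + axis i (of_real (e/2))) < e"
    using e(1) by (simp add: dist_norm norm_axis)
  then obtain y where y: "y \<in> V" "z + axis i (of_real (e/2)) = (\<chi> i. g i y)"
    using e(2) by (auto simp: subset_iff)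
  from arg_cong[OF y(2), of "\<lambda>z. z $ i"] show False
    using zero[OF y(1)] zero[OF assms(2)] e(1) by (simp add: z_def)
qed

lemma generic_point:
  assumes "weight_chart V g \<kappa>" "x \<in> V" "f \<in> \<O>" "nonzero f"
  obtains x0 where "x0 \<in> V" "f x0 \<noteq> 0" "\<And>i. g i x0 \<noteq> 0"
proof -
  define h where "h = (\<lambda>i. case i of None \<Rightarrow> f | Some j \<Rightarrow> g j)"
  have "\<exists>y\<in>V. \<forall>i\<in>UNIV. h i y \<noteq> 0"
    by (rule nonzero_on_open[OF finite _ weight_chartD(2)[OF assms(1)]])
       (use assms weight_chartD(5)[OF assms(1)] weight_chart_nonzero[OF assms(1,2)] in
          \<open>auto simp: h_def split: option.splits\<close>)
  then obtain y where "y \<in> V" "\<And>i. h i y \<noteq> 0" by auto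
  from this(1) this(2)[of None] this(2)[of "Some _"] show ?thesis
    by (intro that[of y]) (simp_all add: h_def)
qed

text \<open>In the coordinates \<open>\<eta>\<close> given by \<open>g i = exp (\<eta> i) * g i x0\<close> the orbit of \<open>x0\<close> is the
  imaginary subspace.\<close>

lemma zero_if_zero_on_orbit:
  assumes V: "weight_chart V g \<kappa>" "x0 \<in> V" "\<And>i. g i x0 \<noteq> 0"
    and F: "F \<in> \<O>" "\<And>\<theta>. F (H (imag_vec \<theta>) x0) = 0" and x: "x \<in> X"
  shows "F x = 0"
proof -
  define \<gamma> where "\<gamma> = (\<lambda>y. \<chi> i. g i y)"
  have c\<gamma>: "compat_chart M \<A> V \<gamma>" using weight_chartD(1)[OF V(1)] by (simp add: \<gamma>_def)
  have x0X: "x0 \<in> X" using V(2) weight_chartD(3)[OF V(1)] by blast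
  define E where "E = (\<lambda>\<eta>. \<chi> i. exp (\<eta> $ i) * g i x0)"
  have E_hol: "hol_vec_at E \<eta>" for \<eta>
    unfolding hol_vec_at_def E_def
    by (auto intro!: hol_at_mult hol_at_exp)
  have E_cont: "continuous_on UNIV E"
    unfolding E_def by (intro continuous_on_vec_lambda continuous_intros)
  have E0: "E 0 = \<gamma> x0" by (simp add: E_def \<gamma>_def)
  \<comment> \<open>The weight matrix over the reals. Its inverse \<open>L\<close> finds the torus
    element that moves \<open>x0\<close> to a prescribed imaginary point of the
    \<open>\<eta>\<close>-coordinates.\<close>
  define K where "K = (\<lambda>\<theta>::real^'n. \<chi> i. \<Sum>j\<in>UNIV. real_of_int (\<kappa> i $ j) * \<theta> $ j)"
  have linK: "linear K"
    by (rule linearI) (simp_all add: K_def vec_eq_iff algebra_simps sum.distrib sum_distrib_left)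
  have kmapK: "kmap \<kappa> (imag_vec \<theta>) = imag_vec (K \<theta>)" for \<theta>
    by (simp add: kmap_def kdot_imag_vec vec_eq_iff) (simp add: imag_vec_def K_def)
  have "inj K"
    unfolding linear_injective_0[OF linK]
    using weight_chart_kmap_inj[OF V(1,2), of "imag_vec _"] kmapK by (metis imag_vec_eq_0_iff)
  then obtain L where L: "linear L" "\<And>\<tau>. K (L \<tau>) = \<tau>"
    using linear_injective_isomorphism[OF linK] by metis
  have "continuous_on UNIV (\<lambda>\<tau>. imag_vec (L \<tau>))"
    using bounded_linear.continuous_on[OF bounded_linear_imag_vec linear_continuous_on] L(1)
    unfolding linear_conv_bounded_linear by blast
  from open_H_preimage[OF weight_chartD(2)[OF V(1)] V(2) this, of 0]
  obtain T where T: "open T" "0 \<in> T" "\<And>\<tau>. \<tau> \<in> T \<Longrightarrow> H (imag_vec (L \<tau>)) x0 \<in> V"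
    using linear_0[OF L(1)] by auto
  have "open (E -` (\<gamma> ` V))"
    using open_vimage[OF compat_chartD(2)[OF c\<gamma>] E_cont] by simp
  moreover have "0 \<in> E -` (\<gamma> ` V)" using E0 V(2) by simp
  ultimately obtain r1 where r1: "r1 > 0" "ball 0 r1 \<subseteq> E -` (\<gamma> ` V)"
    using open_contains_ball by blast
  obtain r2 where r2: "r2 > 0" "ball 0 r2 \<subseteq> T" using T open_contains_ball by blast
  define r where "r = min r1 r2"
  have norm_imag: "norm (imag_vec \<tau>) = norm \<tau>" for \<tau>
    by (simp add: norm_vec_def imag_vec_def norm_mult)
  have zero: "(F \<circ> inv_into V \<gamma>) (E \<eta>) = 0" if "\<eta> \<in> ball 0 r" for \<eta>
  proof (rule hol_identity_imaginary[OF _ _ that])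
    fix \<eta> :: "complex^'n" assume "\<eta> \<in> ball 0 r"
    then have "E \<eta> \<in> \<gamma> ` V" using r1(2) by (auto simp: r_def)
    then show "hol_at (\<lambda>\<eta>. (F \<circ> inv_into V \<gamma>) (E \<eta>)) \<eta>"
      by (intro hol_at_compose[OF E_hol] holomorphic_functions_compat_chart[OF atlas F(1) c\<gamma>])
  next
    fix \<tau> :: "real^'n" assume "(\<chi> j. \<i> * of_real (\<tau> $ j)) \<in> ball 0 r"
    then have "norm \<tau> < r" using norm_imag[of \<tau>] by (simp add: imag_vec_def)
    then have \<tau>: "H (imag_vec (L \<tau>)) x0 \<in> V" using T(3) r2(2) by (auto simp: r_def)
    have "\<gamma> (H (imag_vec (L \<tau>)) x0) = E (imag_vec \<tau>)"
    proof -
      have "kdot (\<kappa> i) (imag_vec (L \<tau>)) = imag_vec \<tau> $ i" for i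
        using arg_cong[OF kmapK[of "L \<tau>"], of "\<lambda>v. v $ i"] by (simp add: kmap_def L(2))
      then show ?thesis
        using Wt_imag[OF weight_chartD(4)[OF V(1)] x0X] by (simp add: \<gamma>_def E_def vec_eq_iff)
    qed
    then have "inv_into V \<gamma> (E (imag_vec \<tau>)) = H (imag_vec (L \<tau>)) x0"
      using compat_chart_inv(3)[OF c\<gamma> \<tau>] by simp
    then show "(F \<circ> inv_into V \<gamma>) (E (\<chi> j. \<i> * of_real (\<tau> $ j))) = 0"
      using F(2) by (simp add: imag_vec_def)
  qed
  have "\<exists>W. openin M W \<and> x0 \<in> W \<and> (\<forall>y\<in>W. F y = 0)"
  proof -
    have "isCont (\<lambda>z. Ln (z $ i / g i x0)) (\<gamma> x0)" for i
      by (rule isCont_Ln') (auto intro!: continuous_intros simp: \<gamma>_def V(3))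
    then have "isCont (\<lambda>z. \<chi> i. Ln (z $ i / g i x0)) (\<gamma> x0)"
      unfolding isCont_def by (rule tendsto_vec_lambda)
    moreover have "r > 0" using r1(1) r2(1) by (simp add: r_def)
    ultimately obtain d where d: "d > 0"
        "\<And>z. dist z (\<gamma> x0) < d \<Longrightarrow> dist (\<chi> i. Ln (z $ i / g i x0)) (\<chi> i. Ln (\<gamma> x0 $ i / g i x0)) < r"
      unfolding continuous_at_eps_delta by blast
    have L0: "(\<chi> i. Ln (\<gamma> x0 $ i / g i x0)) = 0" by (simp add: vec_eq_iff \<gamma>_def V(3))
    \<comment> \<open>A point closer than this to \<open>\<gamma> x0\<close> has no vanishing
      coordinate, so the logarithms inverting \<open>E\<close> can be taken there.\<close>
    obtain e where e: "e > 0" "\<And>i. e \<le> cmod (g i x0)"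
    proof
      show "Min (range (\<lambda>i. cmod (g i x0))) > 0" using V(3) by simp
    qed simp
    define W where "W = {y\<in>V. \<gamma> y \<in> ball (\<gamma> x0) (min d e)}"
    have "openin M W" unfolding W_def by (rule compat_chart_open_preimage[OF c\<gamma> open_ball])
    moreover have "x0 \<in> W" using V(2) d(1) e(1) by (simp add: W_def)
    moreover have "F y = 0" if "y \<in> W" for y
    proof -
      define \<eta> where "\<eta> = (\<chi> i. Ln (\<gamma> y $ i / g i x0))"
      have "dist (\<gamma> y) (\<gamma> x0) < d" "dist (\<gamma> y) (\<gamma> x0) < e" using that by (auto simp: W_def dist_commute)
      then have "\<eta> \<in> ball 0 r" using d(2)[of "\<gamma> y"] by (simp add: \<eta>_def L0)
      moreover have "\<gamma> y $ i \<noteq> 0" for i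
      proof
        assume "\<gamma> y $ i = 0"
        then have "cmod (g i x0) \<le> dist (\<gamma> y) (\<gamma> x0)"
          using dist_vec_nth_le[of "\<gamma> y" i "\<gamma> x0"] by (simp add: \<gamma>_def)
        then show False using e(2)[of i] \<open>dist (\<gamma> y) (\<gamma> x0) < e\<close> by simp
      qed
      then have "E \<eta> = \<gamma> y" using V(3) by (simp add: E_def \<eta>_def vec_eq_iff)
      ultimately show ?thesis using zero compat_chart_inv(3)[OF c\<gamma>] that by (fastforce simp: W_def)
    qed
    ultimately show ?thesis by blast
  qed
  then show ?thesis using zero_if_zero_on_open[OF F(1) _ _ _ x] by blast
qed

text \<open>On an empty space every parameter would act trivially, but the vector with all entries 1
  is not a period.\<close>

lemma point_exists: "X \<noteq> {}"
proof
  assume "X = {}"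
  then have "\<exists>m::int. ((\<chi> i. 1) :: complex^'n) $ undefined = \<i> * of_real (2 * pi * of_int m)"
    using H_id_iff by blast
  then show False by (auto simp: complex_eq_iff)
qed

text \<open>With \<open>c\<close> chosen at a generic point, \<open>f' - c * f\<close> vanishes on
  the torus orbit of that point, which is a uniqueness set.\<close>

lemma Wt_proportional:
  assumes f: "f \<in> Wt k" "nonzero f" and f': "f' \<in> Wt k"
  shows "\<exists>c. \<forall>x\<in>X. f' x = c * f x"
proof -
  obtain x V g \<kappa> where V: "weight_chart V g \<kappa>" "x \<in> V"
    using point_exists weight_chart_exists by blast
  obtain x0 where x0: "x0 \<in> V" "f x0 \<noteq> 0" "\<And>i. g i x0 \<noteq> 0"
    using generic_point[OF V Wt_holomorphic[OF f(1)] f(2)] by blast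
  define c where "c = f' x0 / f x0"
  have x0X: "x0 \<in> X" using x0(1) weight_chartD(3)[OF V(1)] by blast
  have "f' x - c * f x = 0" if "x \<in> X" for x
  proof (rule zero_if_zero_on_orbit[OF V(1) x0(1,3) _ _ that])
    show "(\<lambda>x. f' x - c * f x) \<in> \<O>"
      by (intro holomorphic_functions_diff holomorphic_functions_mult holomorphic_functions_const
          Wt_holomorphic[OF f(1)] Wt_holomorphic[OF f'])
    show "f' (H (imag_vec \<theta>) x0) - c * f (H (imag_vec \<theta>) x0) = 0" for \<theta>
      using x0(2) by (simp add: Wt_imag[OF f(1) x0X] Wt_imag[OF f' x0X] c_def)
  qed
  then show ?thesis by (intro exI[of _ c]) simp
qed

text \<open>\<open>H w\<close> commutes with the torus, so pulling back by it preserves the weight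
  space, which is at most one-dimensional; the resulting factor is a continuous character of
  \<open>w\<close>.\<close>

lemma Wt_character:
  assumes f: "f \<in> Wt k" "nonzero f"
  obtains \<rho> where "linear \<rho>" "\<And>w x. x \<in> X \<Longrightarrow> f (H w x) = exp (\<rho> w) * f x"
proof -
  have fO: "f \<in> \<O>" by (rule Wt_holomorphic[OF f(1)])
  have "(\<lambda>x. f (H w x)) \<in> Wt k" for w
    using f(1) H_hol[OF fO] H_commute[of _ w "imag_vec _"] by (simp add: Wt_def)
  then have "\<exists>c. \<forall>x\<in>X. f (H w x) = c * f x" for w
    by (rule Wt_proportional[OF f])
  then obtain h where h: "\<And>w x. x \<in> X \<Longrightarrow> f (H w x) = h w * f x" by metis
  obtain y where y: "y \<in> X" "f y \<noteq> 0" using f(2) by (auto simp: nonzero_def)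
  have mult: "h (w + w') = h w * h w'" for w w'
  proof -
    have "h (w + w') * f y = f (H w (H w' y))" using h[OF y(1)] H_add[OF y(1)] by metis
    also have "\<dots> = h w * h w' * f y" using h[OF H_in[OF y(1)]] h[OF y(1)] by simp
    finally show ?thesis using y(2) by simp
  qed
  have "h 0 = 1" using h[OF y(1), of 0] y by simp
  then have nz: "h w \<noteq> 0" for w using mult[of w "-w"] by auto
  have "continuous_on UNIV (\<lambda>w. f (H w y) / f y)"
    by (intro continuous_on_divide continuous_on_orbit[OF fO y(1)] continuous_on_id continuous_on_const) (use y in auto)
  then have cont: "continuous_on UNIV h"
    by (rule continuous_on_eq) (use h[OF y(1)] y(2) in simp)
  obtain \<rho> where "linear \<rho>" "\<And>w. h w = exp (\<rho> w)"
    using continuous_character_exp[OF cont mult nz] by blast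
  then show ?thesis using that h by metis
qed

end

text \<open>Here \<open>R\<close> is an action of the complexified torus: \<open>R_Wt\<close> is complex linear in \<open>w\<close>, whereas the
  torus action one starts from determines the character of a weight function only on \<open>\<i>\<real>\<^sup>n\<close>.\<close>

locale toric_action = torus_action M \<A> R for M \<A> and R :: "complex^'n::finite \<Rightarrow> 'a \<Rightarrow> 'a" +
  assumes R_Wt: "f \<in> Wt k \<Longrightarrow> x \<in> topspace M \<Longrightarrow> f (R w x) = exp (kdot k w) * f x"

section \<open>Complexification of the torus action\<close>

context torus_action
begin

text \<open>The coordinates of a weight chart transform by characters whose exponents
  \<open>\<rho>\<close> are only real linear. As \<open>\<rho>\<close> and the weight matrix are
  both injective, the reparametrization \<open>J = N \<circ> kmap \<kappa>\<close> turns these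
  exponents into the complex linear \<open>kdot\<close> and leaves the torus untouched. Any other
  weight function follows, being holomorphic in the chart and known on the torus.\<close>

lemma complexified_action:
  obtains J where "linear J" "inj J" "\<And>\<theta>. J (imag_vec \<theta>) = imag_vec \<theta>"
    "\<And>k f x w. f \<in> Wt k \<Longrightarrow> x \<in> X \<Longrightarrow> f (H (J w) x) = exp (kdot k w) * f x"
proof -
  obtain x1 V g \<kappa> where V: "weight_chart V g \<kappa>" "x1 \<in> V"
    using point_exists weight_chart_exists by blast
  note gW = weight_chartD(4)[OF V(1)] and gnz = weight_chart_nonzero[OF V]
  have "\<exists>\<rho>. linear \<rho> \<and> (\<forall>w. \<forall>x\<in>X. g i (H w x) = exp (\<rho> w) * g i x)" for i
    using Wt_character[OF gW gnz] by metis
  then obtain m where m: "\<And>i. linear (m i)" "\<And>i w x. x \<in> X \<Longrightarrow> g i (H w x) = exp (m i w) * g i x"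
    by metis
  define \<rho> where "\<rho> = (\<lambda>w. \<chi> i. m i w)"
  have lin: "linear \<rho>"
    by (rule linearI) (simp_all add: \<rho>_def vec_eq_iff linear_add[OF m(1)] linear_scale[OF m(1)])
  have inj\<rho>: "inj \<rho>"
    unfolding linear_injective_0[OF lin]
  proof (intro allI impI)
    fix w assume "\<rho> w = 0"
    then have "m i (t *\<^sub>R w) = 0" for i t
      by (simp add: \<rho>_def vec_eq_iff linear_scale[OF m(1)])
    then show "w = 0" by (intro weight_chart_stabilizer[OF V]) (simp add: m(2))
  qed
  then obtain N where N: "linear N" "\<And>z. \<rho> (N z) = z" "\<And>z. N (\<rho> z) = z"
    using linear_injective_isomorphism[OF lin] by metis
  define J where "J = (\<lambda>w. N (kmap \<kappa> w))"
  have linJ: "linear J" unfolding J_def using linear_compose[OF linear_kmap N(1)] by (simp add: o_def)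
  have \<rho>J: "\<rho> (J w) = kmap \<kappa> w" for w by (simp add: J_def N)
  have "inj J"
    unfolding linear_injective_0[OF linJ]
    using \<rho>J weight_chart_kmap_inj[OF V] linear_0[OF lin] by metis
  have \<rho>_imag: "\<rho> (imag_vec \<theta>) = kmap \<kappa> (imag_vec \<theta>)" for \<theta>
  proof -
    have "m i (imag_vec \<theta>) - kdot (\<kappa> i) (imag_vec \<theta>) = 0" for i
    proof (rule exp_eq_1_near_0_imp[of 1])
      fix t :: real
      obtain y where y: "y \<in> X" "g i y \<noteq> 0" using gnz by (auto simp: nonzero_def)
      have "exp (m i (imag_vec (t *\<^sub>R \<theta>))) * g i y = exp (kdot (\<kappa> i) (imag_vec (t *\<^sub>R \<theta>))) * g i y"
        using m(2)[OF y(1)] Wt_imag[OF gW y(1)] by metis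
      then have "exp (t *\<^sub>R m i (imag_vec \<theta>)) = exp (t *\<^sub>R kdot (\<kappa> i) (imag_vec \<theta>))"
        using y(2) by (simp add: imag_vec_scaleR linear_scale[OF m(1)] kdot_scaleR)
      then show "exp (t *\<^sub>R (m i (imag_vec \<theta>) - kdot (\<kappa> i) (imag_vec \<theta>))) = 1"
        by (simp add: scaleR_right_diff_distrib exp_diff)
    qed simp
    then show ?thesis by (simp add: \<rho>_def kmap_def vec_eq_iff)
  qed
  have J_imag: "J (imag_vec \<theta>) = imag_vec \<theta>" for \<theta>
    using \<rho>_imag[of \<theta>] N(3)[of "imag_vec \<theta>"] by (simp add: J_def)
  have "f (H (J w) x) = exp (kdot k w) * f x" if f: "f \<in> Wt k" and x: "x \<in> X" for k f x w
  proof (cases "nonzero f")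
    case False
    then show ?thesis using x by (simp add: nonzero_def)
  next
    case nz: True
    have fO: "f \<in> \<O>" by (rule Wt_holomorphic[OF f])
    obtain p where p: "linear p" "\<And>w x. x \<in> X \<Longrightarrow> f (H w x) = exp (p w) * f x"
      using Wt_character[OF f nz] by blast
    obtain x0 where x0: "x0 \<in> V" "f x0 \<noteq> 0" "\<And>i. g i x0 \<noteq> 0"
      using generic_point[OF V fO nz] by blast
    have x0X: "x0 \<in> X" using x0(1) weight_chartD(3)[OF V(1)] by blast
    have "continuous_on UNIV J" using linJ by (simp add: linear_continuous_on linear_conv_bounded_linear)
    from open_H_preimage[OF weight_chartD(2)[OF V(1)] x0(1) this, of 0]
    obtain T where T: "open T" "0 \<in> T" "\<And>w. w \<in> T \<Longrightarrow> H (J w) x0 \<in> V"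
      using linear_0[OF linJ] by auto
    then obtain r where r: "r > 0" "ball 0 r \<subseteq> T" using open_contains_ball by blast
    define \<gamma> where "\<gamma> = (\<lambda>y. \<chi> i. g i y)"
    have c\<gamma>: "compat_chart M \<A> V \<gamma>" using weight_chartD(1)[OF V(1)] by (simp add: \<gamma>_def)
    define E where "E = (\<lambda>w. \<chi> i. exp (kdot (\<kappa> i) w) * g i x0)"
    have kdot_hol: "hol_at (kdot k) w" for k w
    proof (rule hol_atI)
      have "linear (kdot k)" by (rule linearI) (simp_all add: kdot_add kdot_scaleR)
      then show "(kdot k has_derivative kdot k) (at w)"
        by (intro bounded_linear_imp_has_derivative) (simp add: linear_conv_bounded_linear)
      show "kdot k (c *s v) = c * kdot k v" for c v
        by (simp add: kdot_def sum_distrib_left mult_ac)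
    qed
    have exp_hol: "hol_at (\<lambda>w. exp (kdot k w) * c) w" for k w c
      by (intro hol_at_mult hol_at_const hol_at_exp kdot_hol)
    \<comment> \<open>In the chart the orbit of \<open>x0\<close> is explicit and holomorphic in
      \<open>w\<close>; this is how holomorphy in the group parameter arises.\<close>
    have EH: "E w = \<gamma> (H (J w) x0)" for w
    proof -
      have "m i (J w) = kdot (\<kappa> i) w" for i
        using arg_cong[OF \<rho>J[of w], of "\<lambda>v. v $ i"] by (simp add: \<rho>_def kmap_def)
      then show ?thesis by (simp add: E_def \<gamma>_def m(2)[OF x0X])
    qed
    have local: "f (H (J w) x0) - exp (kdot k w) * f x0 = 0" if "w \<in> ball 0 r" for w
    proof (rule hol_identity_imaginary[OF _ _ that])
      fix w :: "complex^'n" assume w: "w \<in> ball 0 r"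
      have inV: "H (J w) x0 \<in> V" if "w \<in> ball 0 r" for w using T(3) r(2) that by blast
      have "hol_at (\<lambda>w. (f \<circ> inv_into V \<gamma>) (E w)) w"
      proof (rule hol_at_compose)
        show "hol_vec_at E w" by (simp add: hol_vec_at_def E_def exp_hol)
        show "hol_at (f \<circ> inv_into V \<gamma>) (E w)"
          by (rule holomorphic_functions_compat_chart[OF atlas fO c\<gamma>]) (simp add: EH inV[OF w])
      qed
      then have "hol_at (\<lambda>w. f (H (J w) x0)) w"
        by (rule hol_at_transform[OF _ open_ball w]) (simp add: EH compat_chart_inv(3)[OF c\<gamma> inV])
      then show "hol_at (\<lambda>w. f (H (J w) x0) - exp (kdot k w) * f x0) w"
        by (rule hol_at_diff[OF _ exp_hol])
    next
      fix \<theta> :: "real^'n"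
      have "f (H (J (imag_vec \<theta>)) x0) - exp (kdot k (imag_vec \<theta>)) * f x0 = 0"
        by (simp add: J_imag Wt_imag[OF f x0X])
      then show "f (H (J (\<chi> j. \<i> * of_real (\<theta> $ j))) x0) - exp (kdot k (\<chi> j. \<i> * of_real (\<theta> $ j))) * f x0 = 0"
        by (simp add: imag_vec_def)
    qed
    have "p (J w) - kdot k w = 0"
    proof (rule exp_eq_1_near_0_imp)
      show "r / (norm w + 1) > 0" using r(1) by (simp add: add_nonneg_pos)
      fix t :: real assume t: "\<bar>t\<bar> < r / (norm w + 1)"
      have pos: "norm w + 1 > 0" by (simp add: add_nonneg_pos)
      have "\<bar>t\<bar> * norm w \<le> \<bar>t\<bar> * (norm w + 1)" by (intro mult_left_mono) auto
      also have "\<dots> < r" using t by (simp only: pos_less_divide_eq[OF pos])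
      finally have "t *\<^sub>R w \<in> ball 0 r" by simp
      from local[OF this] have "exp (p (J (t *\<^sub>R w))) = exp (kdot k (t *\<^sub>R w))"
        using p(2)[OF x0X] x0(2) by simp
      then show "exp (t *\<^sub>R (p (J w) - kdot k w)) = 1"
        by (simp add: linear_scale[OF linJ] linear_scale[OF p(1)] kdot_scaleR scaleR_right_diff_distrib exp_diff)
    qed
    then show ?thesis using p(2)[OF x] by simp
  qed
  with linJ \<open>inj J\<close> J_imag that show ?thesis by blast
qed

text \<open>\<open>J\<close> is injective and fixes imaginary vectors, among them all periods; so
  composing with it preserves both the kernel of the action and the weight spaces.\<close>

lemma toric_extension:
  obtains R where "toric_action M \<A> R" "\<And>\<theta> x. R (imag_vec \<theta>) x = H (imag_vec \<theta>) x"
proof -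
  obtain J where J: "linear J" "inj J" "\<And>\<theta>. J (imag_vec \<theta>) = imag_vec \<theta>"
    "\<And>k f x w. f \<in> Wt k \<Longrightarrow> x \<in> X \<Longrightarrow> f (H (J w) x) = exp (kdot k w) * f x"
    using complexified_action by blast
  define R where "R = (\<lambda>w. H (J w))"
  have contJ: "continuous_on UNIV J" using J(1) by (simp add: linear_continuous_on linear_conv_bounded_linear)
  have tor: "torus_action M \<A> R"
  proof
    have "continuous_map (prod_topology euclidean M) (prod_topology euclidean M) (\<lambda>(w,x). (J w, x))"
      unfolding continuous_map_prod_top using contJ by simp
    from continuous_map_compose[OF this H_cont]
    show "continuous_map (prod_topology euclidean M) M (\<lambda>(w,x). R w x)"
      by (simp add: o_def case_prod_unfold R_def)
    show "(\<lambda>x. f (R w x)) \<in> \<O>" if "f \<in> \<O>" for f w using H_hol[OF that] by (simp add: R_def)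
    show "R (w + w') x = R w (R w' x)" if "x \<in> X" for w w' x
      using H_add[OF that] by (simp add: R_def linear_add[OF J(1)])
    have lattice: "(\<forall>i. \<exists>m::int. w $ i = \<i> * of_real (2 * pi * of_int m)) \<longleftrightarrow>
        (\<exists>m :: int^'n. w = imag_vec (\<chi> i. 2 * pi * of_int (m $ i)))" for w
    proof
      assume "\<forall>i. \<exists>m::int. w $ i = \<i> * of_real (2 * pi * of_int m)"
      then obtain m where "\<And>i. w $ i = \<i> * of_real (2 * pi * of_int (m i))" by metis
      then show "\<exists>m :: int^'n. w = imag_vec (\<chi> i. 2 * pi * of_int (m $ i))"
        by (intro exI[of _ "\<chi> i. m i"]) (simp add: vec_eq_iff imag_vec_def)
    qed (auto simp: imag_vec_def)
    show "(\<forall>x\<in>X. R w x = x) \<longleftrightarrow> (\<forall>i. \<exists>m::int. w $ i = \<i> * of_real (2 * pi * of_int m))" for w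
    proof -
      have "(\<forall>x\<in>X. R w x = x) \<longleftrightarrow> (\<exists>m :: int^'n. J w = imag_vec (\<chi> i. 2 * pi * of_int (m $ i)))"
        unfolding R_def H_id_iff lattice ..
      also have "\<dots> \<longleftrightarrow> (\<exists>m :: int^'n. w = imag_vec (\<chi> i. 2 * pi * of_int (m $ i)))"
        using J(2,3) by (metis injD)
      finally show ?thesis unfolding lattice .
    qed
  qed (rule stein conn)+
  have RH: "R (imag_vec \<theta>) x = H (imag_vec \<theta>) x" for \<theta> x by (simp add: R_def J(3))
  have Wt_eq: "torus_action.Wt M \<A> R k = Wt k" for k
    unfolding torus_action.Wt_def[OF tor] Wt_def RH ..
  have "toric_action M \<A> R"
    unfolding toric_action_def toric_action_axioms_def
    using tor J(4) by (simp add: Wt_eq) (simp add: R_def)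
  with RH that show ?thesis by blast
qed

end

section \<open>Cones of integer vectors\<close>

definition rvec :: "int^'n \<Rightarrow> real^'n"
  where "rvec k = (\<chi> i. of_int (k $ i))"

lemma of_int_vec_index: "(of_int z :: 'a::ring_1^'n) $ i = of_int z"
  by (cases z rule: int_diff_cases) (simp add: of_nat_index)

definition icone :: "(int^'n) set \<Rightarrow> (real^'n) set"
  where "icone S = {(\<Sum>k\<in>F. c k *\<^sub>R rvec k) | F c. finite F \<and> F \<subseteq> S \<and> (\<forall>k. c k \<ge> 0)}"

lemma icone_add:
  assumes "x \<in> icone S" "y \<in> icone S"
  shows "x + y \<in> icone S"
proof -
  obtain F c where F: "x = (\<Sum>k\<in>F. c k *\<^sub>R rvec k)" "finite F" "F \<subseteq> S" "\<And>k. c k \<ge> 0"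
    using assms(1) unfolding icone_def by blast
  obtain G d where G: "y = (\<Sum>k\<in>G. d k *\<^sub>R rvec k)" "finite G" "G \<subseteq> S" "\<And>k. d k \<ge> 0"
    using assms(2) unfolding icone_def by blast
  define e where "e = (\<lambda>k. (if k \<in> F then c k else 0) + (if k \<in> G then d k else 0))"
  have "x = (\<Sum>k\<in>F \<union> G. (if k \<in> F then c k else 0) *\<^sub>R rvec k)"
    unfolding F(1) using F(2) G(2) by (intro sum.mono_neutral_cong_left) auto
  moreover have "y = (\<Sum>k\<in>F \<union> G. (if k \<in> G then d k else 0) *\<^sub>R rvec k)"
    unfolding G(1) using F(2) G(2) by (intro sum.mono_neutral_cong_left) auto
  ultimately have "x + y = (\<Sum>k\<in>F \<union> G. e k *\<^sub>R rvec k)"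
    by (simp add: e_def scaleR_left_distrib sum.distrib)
  moreover have "finite (F \<union> G)" "F \<union> G \<subseteq> S" "\<forall>k. e k \<ge> 0"
    using F G by (auto simp: e_def)
  ultimately show ?thesis unfolding icone_def by blast
qed

lemma icone_scale:
  assumes "x \<in> icone S" "r \<ge> 0"
  shows "r *\<^sub>R x \<in> icone S"
proof -
  obtain F c where F: "x = (\<Sum>k\<in>F. c k *\<^sub>R rvec k)" "finite F" "F \<subseteq> S" "\<And>k. c k \<ge> 0"
    using assms(1) unfolding icone_def by blast
  have "r *\<^sub>R x = (\<Sum>k\<in>F. (r * c k) *\<^sub>R rvec k)" by (simp add: F(1) scaleR_sum_right)
  moreover have "\<forall>k. r * c k \<ge> 0" using F(4) assms(2) by simp
  ultimately show ?thesis using F(2,3) unfolding icone_def mem_Collect_eq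
    by (intro exI[of _ F] exI[of _ "\<lambda>k. r * c k"]) auto
qed

lemma icone_member: "k \<in> S \<Longrightarrow> rvec k \<in> icone S"
  unfolding icone_def mem_Collect_eq
  by (intro exI[of _ "{k}"] exI[of _ "\<lambda>_. 1"]) auto

lemma icone_0: "0 \<in> icone S"
  unfolding icone_def mem_Collect_eq
  by (intro exI[of _ "{}"] exI[of _ "\<lambda>_. 1"]) auto

lemma icone_convex: "convex (icone S)"
  by (intro convexI icone_add icone_scale)

text \<open>Dirichlet's simultaneous approximation clears the denominators in a nonnegative real
  relation between integer vectors.\<close>

lemma integer_relation:
  fixes k0 :: "int^'n"
  assumes F: "finite F" and c: "\<And>k. c k \<ge> (0::real)" and eq: "- rvec k0 = (\<Sum>k\<in>F. c k *\<^sub>R rvec k)"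
  obtains q :: nat and p :: "int^'n \<Rightarrow> nat" where "q > 0" "of_nat q * k0 + (\<Sum>k\<in>F. of_nat (p k) * k) = 0"
proof -
  obtain h where h: "bij_betw h {0..<card F} F" using ex_bij_betw_nat_finite[OF F] by blast
  obtain b where b: "\<And>k i. k \<in> F \<Longrightarrow> \<bar>of_int (k $ i) :: real\<bar> \<le> b" "b \<ge> 0"
  proof
    show "\<bar>of_int (k $ i) :: real\<bar> \<le> (\<Sum>k\<in>F. \<Sum>i\<in>UNIV. \<bar>of_int (k $ i)\<bar>)" if "k \<in> F" for k i
    proof -
      have "\<bar>of_int (k $ i) :: real\<bar> \<le> (\<Sum>i\<in>UNIV. \<bar>of_int (k $ i)\<bar>)"
        by (rule member_le_sum) auto
      also have "\<dots> \<le> (\<Sum>k\<in>F. \<Sum>i\<in>UNIV. \<bar>of_int (k $ i)\<bar>)"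
        using F that by (intro member_le_sum[of k F "\<lambda>k. \<Sum>i\<in>UNIV. \<bar>of_int (k $ i)\<bar>"]) (auto intro: sum_nonneg)
      finally show ?thesis .
    qed
    show "(\<Sum>k\<in>F. \<Sum>i\<in>UNIV. \<bar>of_int (k $ i)\<bar> :: real) \<ge> 0" by (intro sum_nonneg) auto
  qed
  \<comment> \<open>Rounding errors below \<open>1 / N\<close> in \<open>card F\<close> terms with
    coefficients at most \<open>b\<close> add up to less than 1, so the resulting integer relation
    is exact.\<close>
  obtain N :: nat where N: "N > card F * b" "N > 0"
  proof -
    obtain N where "card F * b < real N" using reals_Archimedean2 by blast
    then show ?thesis using that[of "Suc N"] by simp
  qed
  obtain q p where q: "0 < q" and p: "\<And>i. i < card F \<Longrightarrow> \<bar>of_int q * c (h i) - of_int (p i)\<bar> < 1 / real N"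
    by (rule Dirichlet_approx_simult[OF N(2), of "card F" "\<lambda>i. c (h i)"]) blast
  define p' where "p' = (\<lambda>k. p (inv_into {0..<card F} h k))"
  have p': "\<bar>of_int q * c k - of_int (p' k)\<bar> < 1 / real N" if "k \<in> F" for k
  proof -
    define i where "i = inv_into {0..<card F} h k"
    have "i < card F" "h i = k"
      using h that inv_into_into[of k h "{0..<card F}"] f_inv_into_f[of k h "{0..<card F}"]
      by (auto simp: i_def bij_betw_def)
    then show ?thesis using p[of i] by (simp add: p'_def i_def)
  qed
  \<comment> \<open>The approximated numbers are nonnegative and the errors are below 1, so the
    integers exceed -1.\<close>
  have p'0: "p' k \<ge> 0" if "k \<in> F" for k
  proof -
    have "1 / real N \<le> 1" using N(2) by simp
    moreover have "0 \<le> of_int q * c k" using q c by simp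
    ultimately have "of_int (p' k) > (-1::real)" using p'[OF that] by linarith
    then show ?thesis by linarith
  qed
  have "(q * k0 $ i) + (\<Sum>k\<in>F. p' k * k $ i) = 0" for i
  proof -
    have "- of_int (k0 $ i) = (\<Sum>k\<in>F. c k * of_int (k $ i))"
      using arg_cong[OF eq, of "\<lambda>v. v $ i"] by (simp add: rvec_def)
    then have "of_int (k0 $ i) = - (\<Sum>k\<in>F. c k * of_int (k $ i))" by linarith
    then have "of_int q * of_int (k0 $ i) = - (\<Sum>k\<in>F. of_int q * c k * of_int (k $ i))"
      by (simp add: sum_distrib_left mult.assoc)
    then have "of_int ((q * k0 $ i) + (\<Sum>k\<in>F. p' k * k $ i)) =
        (\<Sum>k\<in>F. (of_int (p' k) - of_int q * c k) * of_int (k $ i))"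
      by (simp add: left_diff_distrib sum_subtractf)
    moreover have "\<bar>\<Sum>k\<in>F. (of_int (p' k) - of_int q * c k) * of_int (k $ i)\<bar> \<le> (\<Sum>k\<in>F. 1 / real N * b)"
    proof (rule order_trans[OF sum_abs], rule sum_mono)
      fix k assume k: "k \<in> F"
      have "\<bar>of_int (p' k) - of_int q * c k\<bar> \<le> 1 / real N"
        using p'[OF k] by (simp add: abs_minus_commute)
      then show "\<bar>(of_int (p' k) - of_int q * c k) * of_int (k $ i)\<bar> \<le> 1 / real N * b"
        unfolding abs_mult by (rule mult_mono) (use b(1)[OF k] in auto)
    qed
    moreover have "(\<Sum>k\<in>F. 1 / real N * b) < 1" using N by (simp add: field_simps)
    ultimately have "\<bar>of_int ((q * k0 $ i) + (\<Sum>k\<in>F. p' k * k $ i)) :: real\<bar> < 1" by linarith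
    then show ?thesis by linarith
  qed
  then have "of_nat (nat q) * k0 + (\<Sum>k\<in>F. of_nat (nat (p' k)) * k) = 0"
    using q p'0 by (simp add: vec_eq_iff of_int_vec_index)
  then show ?thesis using q that[of "nat q" "\<lambda>k. nat (p' k)"] by simp
qed

text \<open>\<open>S\<close> need not be finitely generated, so its cone may fail to be closed. If
  the closure contains every \<open>- rvec k\<close>, it is a subspace and equals its relative
  interior, which the cone shares; so the cone is that subspace, and an integer relation expresses
  \<open>- k\<close> through elements of \<open>S\<close>. Otherwise a hyperplane separates some
  \<open>- rvec k0\<close> from the closed cone.\<close>

lemma monoid_group_or_halfspace:
  fixes S :: "(int^'n) set"
  assumes 0: "0 \<in> S" and add: "\<And>k l. k \<in> S \<Longrightarrow> l \<in> S \<Longrightarrow> k + l \<in> S"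
  shows "(\<forall>k\<in>S. - k \<in> S) \<or> (\<exists>v. \<exists>k0\<in>S. (\<forall>k\<in>S. inner v (rvec k) \<ge> 0) \<and> inner v (rvec k0) > 0)"
proof (cases "\<forall>k\<in>S. - rvec k \<in> closure (icone S)")
  case True
  have clc: "convex (closure (icone S))" by (rule convex_closure[OF icone_convex])
  have cl_scale: "r *\<^sub>R x \<in> closure (icone S)" if "x \<in> closure (icone S)" "r \<ge> 0" for x r
  proof -
    have "(\<lambda>x. r *\<^sub>R x) ` closure (icone S) \<subseteq> closure ((\<lambda>x. r *\<^sub>R x) ` icone S)"
      by (rule image_closure_subset) (auto intro!: continuous_intros closure_subset)
    moreover have "closure ((\<lambda>x. r *\<^sub>R x) ` icone S) \<subseteq> closure (icone S)"
      using icone_scale that(2) by (intro closure_mono) auto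
    ultimately show ?thesis using that(1) by blast
  qed
  have cl_add: "x + y \<in> closure (icone S)" if "x \<in> closure (icone S)" "y \<in> closure (icone S)" for x y
  proof -
    have "(1/2) *\<^sub>R x + (1/2) *\<^sub>R y \<in> closure (icone S)"
      by (rule convexD[OF clc that]) auto
    from cl_scale[OF this, of 2] show ?thesis by (simp add: scaleR_right_distrib)
  qed
  have cl_0: "0 \<in> closure (icone S)" using icone_0 closure_subset by blast
  have "icone S \<subseteq> {x. - x \<in> closure (icone S)}"
  proof
    fix x assume "x \<in> icone S"
    then obtain F c where F: "x = (\<Sum>k\<in>F. c k *\<^sub>R rvec k)" "finite F" "F \<subseteq> S" "\<And>k. c k \<ge> 0"
      unfolding icone_def by blast
    have "- (\<Sum>k\<in>F. c k *\<^sub>R rvec k) \<in> closure (icone S)"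
      using F(2,3)
    proof (induction F rule: finite_induct)
      case (insert k F)
      have "c k *\<^sub>R (- rvec k) \<in> closure (icone S)"
        using True insert.prems F(4) by (intro cl_scale) auto
      moreover have "- (\<Sum>k\<in>F. c k *\<^sub>R rvec k) \<in> closure (icone S)" using insert by auto
      ultimately have "c k *\<^sub>R (- rvec k) + - (\<Sum>k\<in>F. c k *\<^sub>R rvec k) \<in> closure (icone S)"
        by (rule cl_add)
      then show ?case using insert.hyps by (simp add: algebra_simps)
    qed (use cl_0 in simp)
    then show "x \<in> {x. - x \<in> closure (icone S)}" by (simp add: F(1))
  qed
  moreover have "closed {x. - x \<in> closure (icone S)}"
  proof -
    have "continuous_on UNIV (\<lambda>x::real^'n. - x)" by (intro continuous_intros)
    from closed_vimage[OF closed_closure this] show ?thesis by (simp add: vimage_def)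
  qed
  ultimately have cl_minus: "- x \<in> closure (icone S)" if "x \<in> closure (icone S)" for x
    using closure_minimal that by blast
  have "subspace (closure (icone S))"
    unfolding subspace_def
  proof (intro conjI ballI allI cl_0 cl_add)
    fix r :: real and x assume x: "x \<in> closure (icone S)"
    show "r *\<^sub>R x \<in> closure (icone S)"
    proof (cases "r \<ge> 0")
      case False
      then have "- ((- r) *\<^sub>R x) \<in> closure (icone S)" by (intro cl_minus cl_scale x) auto
      then show ?thesis by simp
    qed (use cl_scale x in blast)
  qed auto
  then have "rel_interior (closure (icone S)) = closure (icone S)"
    by (intro rel_interior_affine subspace_imp_affine)
  then have full: "closure (icone S) \<subseteq> icone S"
    using convex_rel_interior_closure[OF icone_convex, of S] rel_interior_subset[of "icone S"] by simp
  have "- k0 \<in> S" if k0: "k0 \<in> S" for k0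
  proof -
    have "- rvec k0 \<in> icone S" using True k0 full by blast
    then obtain F c where F: "- rvec k0 = (\<Sum>k\<in>F. c k *\<^sub>R rvec k)" "finite F" "F \<subseteq> S" "\<And>k. c k \<ge> 0"
      unfolding icone_def by blast
    obtain q p where q: "q > (0::nat)" and p: "of_nat q * k0 + (\<Sum>k\<in>F. of_nat (p k) * k) = 0"
      using integer_relation[OF F(2,4,1)] by blast
    have mult: "of_nat m * k \<in> S" if "k \<in> S" for m k
      by (induction m) (use 0 add that in \<open>auto simp: algebra_simps\<close>)
    have "(\<Sum>k\<in>F. of_nat (p k) * k) \<in> S"
      using F(2,3) by (induction F rule: finite_induct) (auto intro!: 0 add mult)
    \<comment> \<open>Since \<open>q > 0\<close>, moving one copy of \<open>k0\<close> to the other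
      side of the relation writes \<open>- k0\<close> as a sum of elements of
      \<open>S\<close>.\<close>
    moreover have "of_nat (q - 1) * k0 \<in> S" by (rule mult[OF k0])
    ultimately have "(\<Sum>k\<in>F. of_nat (p k) * k) + of_nat (q - 1) * k0 \<in> S" by (rule add)
    moreover have "(\<Sum>k\<in>F. of_nat (p k) * k) + of_nat (q - 1) * k0 = - k0"
    proof -
      obtain m where m: "q = Suc m" using q gr0_implies_Suc by blast
      show ?thesis
        unfolding eq_neg_iff_add_eq_0 p[symmetric] by (simp add: m distrib_right add_ac)
    qed
    ultimately show ?thesis by simp
  qed
  then show ?thesis by blast
next
  case False
  then obtain k0 where k0: "k0 \<in> S" "- rvec k0 \<notin> closure (icone S)" by blast
  obtain a b where ab: "inner a (- rvec k0) < b" "\<And>x. x \<in> closure (icone S) \<Longrightarrow> inner a x > b"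
    using separating_hyperplane_closed_point[OF convex_closure[OF icone_convex] closed_closure k0(2)] by blast
  have b0: "b < 0" using ab(2)[of 0] icone_0[of S] closure_subset by force
  have "inner a (rvec k) \<ge> 0" if k: "k \<in> S" for k
  proof (rule ccontr)
    assume neg: "\<not> ?thesis"
    \<comment> \<open>A linear form bounded below on a cone is nonnegative: at this multiple of
      \<open>rvec k\<close> it would take exactly the excluded value \<open>b\<close>.\<close>
    define r where "r = b / inner a (rvec k)"
    have "r \<ge> 0" using neg b0 by (simp add: r_def divide_nonpos_neg less_imp_le)
    then have "r *\<^sub>R rvec k \<in> closure (icone S)"
      using icone_scale[OF icone_member[OF k]] closure_subset by blast
    from ab(2)[OF this] show False using neg by (simp add: r_def)
  qed
  moreover have "inner a (rvec k0) > 0" using ab(1) b0 by simp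
  ultimately show ?thesis using k0(1) by blast
qed

section \<open>Closed orbits\<close>

text \<open>Two geometric series. The bound becomes the constant \<open>C\<close> of the hull
  estimate, one factor for each coordinate.\<close>

lemma sum_exp_minus_abs_le:
  fixes F :: "int set"
  assumes "finite F"
  shows "(\<Sum>m\<in>F. exp (- \<bar>of_int m\<bar>)) \<le> 2 / (1 - exp (-1 :: real))"
proof -
  define q :: real where "q = exp (-1)"
  have q: "0 < q" "q < 1" by (auto simp: q_def)
  have geo: "(\<Sum>n\<in>A. q ^ n) \<le> 1 / (1 - q)" if "finite A" for A
    using sum_le_suminf[OF summable_geometric that, of q] suminf_geometric[of q] q by simp
  have e: "exp (- \<bar>of_int m\<bar>) = q ^ nat \<bar>m\<bar>" for m :: int
  proof -
    have "q ^ nat \<bar>m\<bar> = exp (of_nat (nat \<bar>m\<bar>) * (-1))" unfolding q_def by (rule exp_of_nat_mult[symmetric])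
    then show ?thesis by simp
  qed
  have part: "(\<Sum>m\<in>G. exp (- \<bar>of_int m\<bar>)) \<le> 1 / (1 - q)" if "finite G" "inj_on (\<lambda>m. nat \<bar>m\<bar>) G" for G :: "int set"
  proof -
    have "(\<Sum>m\<in>G. exp (- \<bar>of_int m\<bar>)) = (\<Sum>n\<in>(\<lambda>m. nat \<bar>m\<bar>) ` G. q ^ n)"
      by (subst sum.reindex[OF that(2)]) (simp add: e)
    then show ?thesis using geo that(1) by simp
  qed
  have "(\<Sum>m\<in>F. exp (- \<bar>of_int m\<bar> :: real)) =
      (\<Sum>m\<in>{m\<in>F. m \<ge> 0}. exp (- \<bar>of_int m\<bar>)) + (\<Sum>m\<in>{m\<in>F. m < 0}. exp (- \<bar>of_int m\<bar>))"
    using assms by (subst sum.union_disjoint[symmetric]) (auto intro!: sum.cong)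
  also have "\<dots> \<le> 1 / (1 - q) + 1 / (1 - q)"
    using assms by (intro add_mono part) (auto simp: inj_on_def)
  finally show ?thesis by (simp add: q_def)
qed

definition real_vec :: "real^'n \<Rightarrow> complex^'n"
  where "real_vec s = (\<chi> j. of_real (s $ j))"

lemma real_vec_add: "real_vec (s + t) = real_vec s + real_vec t"
  by (simp add: real_vec_def vec_eq_iff)

lemma real_vec_scaleR: "real_vec (r *\<^sub>R s) = r *\<^sub>R real_vec s"
  by (simp add: real_vec_def vec_eq_iff) (simp add: scaleR_conv_of_real)

lemma kdot_real_vec: "kdot k (real_vec s) = of_real (inner s (rvec k))"
  by (simp add: kdot_def real_vec_def rvec_def inner_vec_def mult.commute)

lemma bounded_linear_real_vec: "bounded_linear real_vec"
  unfolding linear_conv_bounded_linear[symmetric]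
  by (rule linearI) (simp_all add: real_vec_scaleR real_vec_add)

lemma imag_vec_add: "imag_vec (s + t) = imag_vec s + imag_vec t"
  by (simp add: imag_vec_def vec_eq_iff algebra_simps)

lemma imag_vec_0 [simp]: "imag_vec 0 = 0"
  by (simp add: imag_vec_def vec_eq_iff)

lemma real_vec_0 [simp]: "real_vec 0 = 0"
  by (simp add: real_vec_def vec_eq_iff)

section \<open>Weights occurring at a point and Fourier estimates\<close>

context torus_action
begin

lemma Wt_mult: "f \<in> Wt k \<Longrightarrow> g \<in> Wt l \<Longrightarrow> (\<lambda>x. f x * g x) \<in> Wt (k + l)"
  by (simp add: Wt_def holomorphic_functions_mult ring_distribs sum.distrib flip: cis_mult)

lemma Wt_one: "(\<lambda>_. 1) \<in> Wt 0"
  by (simp add: Wt_def)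

definition supp :: "'a \<Rightarrow> (int^'n) set"
  where "supp x = {k. \<exists>g\<in>Wt k. g x \<noteq> 0}"

lemma supp_0: "0 \<in> supp x"
  unfolding supp_def mem_Collect_eq by (rule bexI[OF _ Wt_one]) simp

lemma supp_add:
  assumes "k \<in> supp x" "l \<in> supp x"
  shows "k + l \<in> supp x"
proof -
  obtain f g where "f \<in> Wt k" "f x \<noteq> 0" "g \<in> Wt l" "g x \<noteq> 0"
    using assms unfolding supp_def by blast
  then show ?thesis
    unfolding supp_def mem_Collect_eq by (intro bexI[OF _ Wt_mult[of f k g l]]) auto
qed

lemma H_period:
  assumes "x \<in> X"
  shows "H (imag_vec (\<chi> i. 2 * pi * of_int (m $ i))) x = x"
  using H_id_iff[of "imag_vec (\<chi> i. 2 * pi * of_int (m $ i))"] assms by (auto simp: imag_vec_def)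

lemma component_bound:
  assumes "f \<in> \<O>" "x \<in> X" "\<And>\<theta>. cmod (f (H (imag_vec \<theta>) x)) \<le> B"
  shows "cmod (component k js f x) \<le> B"
proof -
  have "cmod (component k js f (H (imag_vec \<theta>) x)) \<le> B" for \<theta>
    using assms(1,3)
  proof (induction js arbitrary: f)
    case (Cons j js)
    have "cmod (avg j (k $ j) f (H (imag_vec \<theta>) x)) \<le> B" for \<theta>
    proof -
      have eq: "H (rot j \<phi>) (H (imag_vec \<theta>) x) = H (imag_vec (\<theta> + axis j \<phi>)) x" for \<phi>
      proof -
        have "imag_vec (\<theta> + axis j \<phi>) = rot j \<phi> + imag_vec \<theta>"
          by (simp add: imag_vec_def rot_def axis_def vec_eq_iff algebra_simps)
        then show ?thesis by (simp add: H_add[OF assms(2)])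
      qed
      have c: "continuous_on {-pi..pi} (\<lambda>\<phi>. f (H (rot j \<phi>) (H (imag_vec \<theta>) x)))"
        by (intro continuous_on_orbit[OF Cons.prems(1)] H_in assms(2) continuous_on_rot continuous_on_id)
      have "cmod (integral {-pi..pi} (\<lambda>\<phi>. f (H (rot j \<phi>) (H (imag_vec \<theta>) x)) * cis (- (of_int (k $ j) * \<phi>))))
          \<le> B * (pi - (-pi))"
      proof (rule integral_bound)
        show "continuous_on {-pi..pi} (\<lambda>\<phi>. f (H (rot j \<phi>) (H (imag_vec \<theta>) x)) * cis (- (of_int (k $ j) * \<phi>)))"
          by (intro continuous_on_mult c continuous_on_cis continuous_intros)
        show "cmod (f (H (rot j \<phi>) (H (imag_vec \<theta>) x)) * cis (- (of_int (k $ j) * \<phi>))) \<le> B" for \<phi>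
          unfolding eq norm_mult using Cons.prems(2) by simp
      qed simp
      then show ?thesis by (simp add: avg_def fcoef_def norm_divide field_simps)
    qed
    then show ?case using Cons.IH[OF avg_holomorphic[OF Cons.prems(1)]] by simp
  qed simp
  from this[of 0] show ?thesis
    using assms(2) by simp
qed

text \<open>A weak form of absolute convergence of the Fourier series on the torus, one coordinate at
  a time.\<close>

lemma component_sum_bound:
  assumes y: "y \<in> X" and dom: "\<And>k g. g \<in> Wt k \<Longrightarrow> cmod (g y) \<le> cmod (g x)"
  defines "C \<equiv> 2 / (1 - exp (-1 :: real))"
  shows "f \<in> \<O> \<Longrightarrow> wt_on (- set js) l f \<Longrightarrow> distinct js \<Longrightarrow> B \<ge> 0 \<Longrightarrow>
    (\<And>k. (\<And>j. j \<notin> set js \<Longrightarrow> k $ j = l $ j) \<Longrightarrow>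
      cmod (component k js f x) \<le> B * (\<Prod>j\<in>set js. exp (- \<bar>of_int (k $ j)\<bar>))) \<Longrightarrow>
    cmod (f y) \<le> B * C ^ length js"
proof (induction js arbitrary: f l B)
  case Nil
  then have "f \<in> Wt l" by (intro WtI) simp_all
  then show ?case using dom[of f l] Nil.prems(5)[of l] by simp
next
  case (Cons j js)
  have C0: "C \<ge> 0" by (simp add: C_def)
  have avg: "cmod (avg j m f y) \<le> B * exp (- \<bar>of_int m\<bar>) * C ^ length js" for m
  proof (rule Cons.IH[OF avg_holomorphic[OF Cons.prems(1)]])
    define k1 where "k1 = (\<chi> i. if i = j then m else l $ i)"
    have "wt_on (- set (j # js)) k1 f"
      using Cons.prems(2) by (auto simp: wt_on_def k1_def)
    from avg_wt_on[OF Cons.prems(1) this, of j]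
    show "wt_on (- set js) k1 (avg j m f)"
      by (auto simp: wt_on_def k1_def)
    show "distinct js" "B * exp (- \<bar>of_int m\<bar>) \<ge> 0" using Cons.prems by auto
    fix k assume k: "\<And>i. i \<notin> set js \<Longrightarrow> k $ i = k1 $ i"
    have kj: "k $ j = m" using k[of j] Cons.prems(3) by (simp add: k1_def)
    have "cmod (component k (j # js) f x) \<le> B * (\<Prod>j\<in>set (j # js). exp (- \<bar>of_int (k $ j)\<bar>))"
      by (rule Cons.prems(5)) (use k in \<open>auto simp: k1_def\<close>)
    then show "cmod (component k js (avg j m f) x) \<le> B * exp (- \<bar>of_int m\<bar>) * (\<Prod>j\<in>set js. exp (- \<bar>of_int (k $ j)\<bar>))"
      using Cons.prems(3) by (simp add: kj mult.assoc)
  qed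
  have "cmod ((\<lambda>\<theta>. f (H (rot j \<theta>) y)) 0) \<le> B * C ^ length (j # js)"
  proof (rule norm_le_sum_fcoef)
    show "continuous_on UNIV (\<lambda>\<theta>. f (H (rot j \<theta>) y))"
      by (intro continuous_on_orbit[OF Cons.prems(1) y] continuous_on_rot continuous_on_id)
    fix F :: "int set" assume F: "finite F"
    have "(\<Sum>m\<in>F. cmod (fcoef (\<lambda>\<theta>. f (H (rot j \<theta>) y)) m)) \<le> (\<Sum>m\<in>F. B * C ^ length js * exp (- \<bar>of_int m\<bar>))"
      using avg by (intro sum_mono) (simp add: avg_def mult_ac)
    also have "\<dots> \<le> B * C ^ length js * C"
      unfolding sum_distrib_left[symmetric] C_def
      using Cons.prems(4) C0 by (intro mult_left_mono sum_exp_minus_abs_le F) (simp add: C_def)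
    finally show "(\<Sum>m\<in>F. cmod (fcoef (\<lambda>\<theta>. f (H (rot j \<theta>) y)) m)) \<le> B * C ^ length (j # js)"
      by (simp add: mult_ac)
  qed
  then show ?case using y by simp
qed

end

section \<open>Holomorphic hulls of orbits and limits of flows\<close>

context toric_action
begin

text \<open>A compact piece of the complexified orbit: all angles, and real directions of size at
  most 1. The room in the real directions is what makes weight components at \<open>x\<close>
  decay.\<close>

definition orbit_box :: "'a \<Rightarrow> 'a set"
  where "orbit_box x = (\<lambda>(s,\<theta>). R (real_vec s + imag_vec \<theta>) x) ` (cbox (- 1) 1 \<times> cbox 0 (\<chi> i. 2 * pi))"

lemma orbit_box_compact:
  assumes "x \<in> X"
  shows "compactin M (orbit_box x)"
proof -
  have "continuous_on UNIV (\<lambda>p. real_vec (fst p) + imag_vec (snd p))"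
    by (intro continuous_on_add bounded_linear.continuous_on[OF bounded_linear_real_vec]
        bounded_linear.continuous_on[OF bounded_linear_imag_vec] continuous_intros)
  from H_cont_orbit[OF this assms]
  have "continuous_map euclidean M (\<lambda>p. R (real_vec (fst p) + imag_vec (snd p)) x)" by simp
  moreover have "compactin euclidean (cbox (- 1) 1 \<times> cbox 0 (\<chi> i. 2 * pi) :: ((real^'n) \<times> (real^'n)) set)"
    by (simp add: compact_Times)
  ultimately show ?thesis
    unfolding orbit_box_def split_beta by (intro image_compactin)
qed

lemma orbit_box_contains:
  assumes "x \<in> X" "\<And>i. \<bar>s $ i\<bar> \<le> 1"
  shows "R (imag_vec \<theta>) (R (real_vec s) x) \<in> orbit_box x"
proof -
  define m where "m = (\<chi> i. \<lfloor>\<theta> $ i / (2 * pi)\<rfloor>)"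
  define \<theta>' where "\<theta>' = \<theta> - (\<chi> i. 2 * pi * of_int (m $ i))"
  have "0 \<le> \<theta>' $ i \<and> \<theta>' $ i \<le> 2 * pi" for i
  proof -
    have "of_int (m $ i) \<le> \<theta> $ i / (2 * pi)" "\<theta> $ i / (2 * pi) \<le> of_int (m $ i) + 1"
      unfolding m_def by (simp_all add: of_int_floor_le less_imp_le[OF floor_less_cancel])
    then show ?thesis by (simp add: \<theta>'_def field_simps)
  qed
  then have "(s, \<theta>') \<in> cbox (- 1) 1 \<times> cbox 0 (\<chi> i. 2 * pi)"
    using assms(2) by (auto simp: mem_box_cart abs_le_iff minus_le_iff)
  then have "R (real_vec s + imag_vec \<theta>') x \<in> orbit_box x"
    unfolding orbit_box_def by force
  moreover have "R (real_vec s + imag_vec \<theta>') x = R (imag_vec \<theta>) (R (real_vec s) x)"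
  proof -
    have "\<theta> = \<theta>' + (\<chi> i. 2 * pi * of_int (m $ i))" by (simp add: \<theta>'_def)
    then have "R (imag_vec \<theta>) (R (real_vec s) x) =
        R (imag_vec \<theta>') (R (imag_vec (\<chi> i. 2 * pi * of_int (m $ i))) (R (real_vec s) x))"
      by (simp only: H_add[OF H_in[OF assms(1)], symmetric] imag_vec_add[symmetric])
    also have "\<dots> = R (imag_vec \<theta>') (R (real_vec s) x)"
      by (simp only: H_period[OF H_in[OF assms(1)]])
    also have "\<dots> = R (real_vec s + imag_vec \<theta>') x"
      by (simp only: H_add[OF assms(1), symmetric] add.commute)
    finally show ?thesis by simp
  qed
  ultimately show ?thesis by simp
qed

text \<open>Moving \<open>x\<close> by the real vector of signs of \<open>k\<close> multiplies the
  component of weight \<open>k\<close> by \<open>exp\<close> of the sum of the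
  \<open>\<bar>k $ i\<bar>\<close>, without leaving the box. So components at \<open>x\<close> decay
  exponentially in \<open>k\<close>, those at \<open>y\<close> are no larger, and summation bounds
  \<open>f y\<close> by the supremum over the box times a constant.\<close>

lemma hull_contains:
  assumes x: "x \<in> X" and y: "y \<in> X" and dom: "\<And>k g. g \<in> Wt k \<Longrightarrow> cmod (g y) \<le> cmod (g x)"
  shows "y \<in> holomorphic_hull M \<A> (orbit_box x)"
proof -
  define C where "C = 2 / (1 - exp (-1 :: real))"
  obtain js :: "'n list" where js: "set js = UNIV" "distinct js"
    using finite_distinct_list[of "UNIV :: 'n set"] by auto
  have bdd: "bdd_above ((\<lambda>y. cmod (f y)) ` orbit_box x)" if f: "f \<in> \<O>" for f
  proof -
    have "compactin euclidean (f ` orbit_box x)"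
      by (rule image_compactin[OF orbit_box_compact[OF x] holomorphic_functions_continuous[OF atlas f]])
    then have "bounded (f ` orbit_box x)" using compact_imp_bounded by simp
    then show ?thesis unfolding bounded_iff bdd_above_def by auto
  qed
  have le_sup: "cmod (f z) \<le> (SUP y\<in>orbit_box x. cmod (f y))" if "f \<in> \<O>" "z \<in> orbit_box x" for f z
    by (rule cSUP_upper[OF that(2) bdd[OF that(1)]])
  have x_box: "x \<in> orbit_box x"
    using orbit_box_contains[OF x, of 0 0] x by simp
  have est: "cmod (f y) \<le> (SUP y\<in>orbit_box x. cmod (f y)) * C ^ length js" if f: "f \<in> \<O>" for f
    unfolding C_def
  proof (rule component_sum_bound[where y=y and x=x and l=0, OF y _ f _ js(2)])
    show "\<And>k g. g \<in> Wt k \<Longrightarrow> cmod (g y) \<le> cmod (g x)" by (rule dom)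
    define B where "B = (SUP y\<in>orbit_box x. cmod (f y))"
    show "wt_on (- set js) 0 f" using js(1) by (simp add: wt_on_def)
    show B0: "0 \<le> (SUP y\<in>orbit_box x. cmod (f y))" using le_sup[OF f x_box] norm_ge_zero[of "f x"] unfolding B_def by linarith
    fix k
    define s :: "real^'n" where "s = (\<chi> i. of_int (sgn (k $ i)))"
    have W: "component k js f \<in> Wt k"
      using component_wt_on[OF f, of "{}" k js] js(1) by (auto intro: WtI simp: wt_on_def)
    have "\<bar>s $ i\<bar> \<le> 1" for i by (simp add: s_def sgn_if)
    then have "cmod (component k js f (R (real_vec s) x)) \<le> B"
      unfolding B_def by (intro component_bound f H_in x le_sup orbit_box_contains)
    moreover have "component k js f (R (real_vec s) x) = of_real (exp (\<Sum>i\<in>UNIV. \<bar>of_int (k $ i)\<bar>)) * component k js f x"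
    proof -
      have "inner s (rvec k) = (\<Sum>i\<in>UNIV. \<bar>of_int (k $ i)\<bar>)"
        by (simp add: inner_vec_def s_def rvec_def) (intro sum.cong refl, simp add: sgn_if)
      then show ?thesis by (simp only: R_Wt[OF W x] kdot_real_vec exp_of_real)
    qed
    ultimately have "exp (\<Sum>i\<in>UNIV. \<bar>of_int (k $ i)\<bar>) * cmod (component k js f x) \<le> B"
      by (simp add: norm_mult)
    then have "cmod (component k js f x) \<le> B * inverse (exp (\<Sum>i\<in>UNIV. \<bar>of_int (k $ i)\<bar>))"
      by (simp add: field_simps)
    also have "inverse (exp (\<Sum>i\<in>UNIV. \<bar>of_int (k $ i) :: real\<bar>)) = (\<Prod>i\<in>UNIV. exp (- \<bar>of_int (k $ i)\<bar>))"
      unfolding exp_minus[symmetric] sum_negf[symmetric] by (rule exp_sum) simp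
    finally show "cmod (component k js f x) \<le> (SUP y\<in>orbit_box x. cmod (f y)) * (\<Prod>j\<in>set js. exp (- \<bar>of_int (k $ j)\<bar>))"
      by (simp only: js(1) B_def)
  qed
  have "cmod (f y) \<le> (SUP y\<in>orbit_box x. cmod (f y))" if f: "f \<in> \<O>" for f
  proof (rule ccontr)
    define S where "S = (SUP y\<in>orbit_box x. cmod (f y))"
    assume "\<not> ?thesis"
    then have less: "S < cmod (f y)" by (simp add: S_def)
    have S0: "0 \<le> S" using le_sup[OF f x_box] norm_ge_zero[of "f x"] unfolding S_def by linarith
    \<comment> \<open>The estimate for \<open>f ^ N\<close> has the same constant, so the constant
      is lost as \<open>N\<close> grows.\<close>
    have pow: "cmod (f y) ^ N \<le> S ^ N * C ^ length js" for N
    proof -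
      have "(SUP y\<in>orbit_box x. cmod (f y ^ N)) \<le> S ^ N"
      proof (rule cSUP_least)
        fix z assume "z \<in> orbit_box x"
        then show "cmod (f z ^ N) \<le> S ^ N"
          unfolding norm_power S_def by (intro power_mono le_sup[OF f] norm_ge_zero)
      qed (use x_box in auto)
      moreover have "C \<ge> 0" by (simp add: C_def)
      ultimately have "(SUP y\<in>orbit_box x. cmod (f y ^ N)) * C ^ length js \<le> S ^ N * C ^ length js"
        by (intro mult_right_mono) auto
      with est[OF holomorphic_functions_power[OF f, of N]] show ?thesis
        unfolding norm_power[of "f y"] by (rule order_trans)
    qed
    show False
    proof (cases "S = 0")
      case True
      then show False using pow[of 1] less by simp
    next
      case False
      then have S: "S > 0" using S0 by simp
      then have "cmod (f y) / S > 1" using less by simp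
      then obtain N where "C ^ length js < (cmod (f y) / S) ^ N" using real_arch_pow by blast
      moreover have "(cmod (f y) / S) ^ N \<le> C ^ length js"
        unfolding power_divide pos_divide_le_eq[OF zero_less_power[OF S]] using pow[of N]
        by (simp only: mult.commute)
      ultimately show False by linarith
    qed
  qed
  then show ?thesis using y unfolding holomorphic_hull_def by blast
qed

text \<open>Flowing along a direction \<open>v\<close> that is nonnegative on the support stays in the hull of a
  compact set, so it has a limit point, at which the support loses the weights positive on \<open>v\<close>.\<close>

lemma limit_point:
  assumes x: "x \<in> X" and v: "\<And>k. k \<in> supp x \<Longrightarrow> inner v (rvec k) \<ge> 0"
  obtains y where "y \<in> X" "supp y \<subseteq> {k \<in> supp x. inner v (rvec k) = 0}"
proof -
  define p where "p = (\<lambda>s::real. R (real_vec ((- s) *\<^sub>R v)) x)"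
  have pX: "p s \<in> X" for s using x by (simp add: p_def)
  have gp: "g (p s) = of_real (exp (- s * inner v (rvec k))) * g x" if "g \<in> Wt k" for g k s
    unfolding p_def using R_Wt[OF that x, of "real_vec ((- s) *\<^sub>R v)"]
    by (simp only: kdot_real_vec inner_scaleR_left exp_of_real)
  define K where "K = holomorphic_hull M \<A> (orbit_box x)"
  have "orbit_box x \<noteq> {}" using orbit_box_contains[OF x, of 0 0] by auto
  then have K: "compactin M K"
    using stein[unfolded stein_manifold_def, THEN conjunct2, THEN conjunct1] orbit_box_compact[OF x]
    unfolding K_def by blast
  have pK: "p s \<in> K" if "s \<ge> 0" for s
    unfolding K_def
  proof (rule hull_contains[OF x pX])
    fix k g assume g: "g \<in> Wt k"
    show "cmod (g (p s)) \<le> cmod (g x)"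
    proof (cases "g x = 0")
      case False
      then have "k \<in> supp x" using g by (auto simp: supp_def)
      then have "exp (- s * inner v (rvec k)) \<le> 1" using v that by simp
      then show ?thesis by (simp add: gp[OF g] norm_mult mult_left_le_one_le)
    qed (simp add: gp[OF g])
  qed
  \<comment> \<open>Closures of tails of the flow; compactness of the hull gives them a common
    point, a cluster point of the flow.\<close>
  define F where "F = (\<lambda>n::nat. M closure_of (p ` {s. s \<ge> real n}))"
  have "K \<inter> \<Inter>(range F) \<noteq> {}"
  proof -
    have "K \<inter> \<Inter>\<F> \<noteq> {}" if fin: "finite \<F>" and sub: "\<F> \<subseteq> range F" for \<F>
    proof -
      obtain I where I: "finite I" "\<F> = F ` I" using finite_subset_image[OF fin sub] by blast
      define N where "N = Max (insert 0 I)"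
      have "p (real N) \<in> F n" if "n \<in> I" for n
      proof -
        have "n \<le> N" using that I(1) by (simp add: N_def)
        then have "p (real N) \<in> p ` {s. s \<ge> real n}" by simp
        moreover have "p ` {s. s \<ge> real n} \<subseteq> X" using pX by blast
        ultimately show ?thesis unfolding F_def using closure_of_subset by blast
      qed
      then show ?thesis using pK[of "real N"] I(2) by auto
    qed
    moreover have "\<forall>C\<in>range F. closedin M C" by (auto simp: F_def)
    ultimately show ?thesis using K unfolding compactin_fip by blast
  qed
  then obtain y where y: "y \<in> K" "\<And>n. y \<in> F n" by blast
  have yX: "y \<in> X" using y(1) K compactin_subset_topspace by blast
  \<comment> \<open>Only a cluster point is known, but a weight function that converges along the
    flow must take its limit there.\<close>
  have lim_val: "g y = L" if g: "g \<in> Wt k" and lim: "((\<lambda>s. g (p s)) \<longlongrightarrow> L) at_top" for g k L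
  proof (rule ccontr)
    assume "g y \<noteq> L"
    define e where "e = dist (g y) L / 2"
    have e: "e > 0" using \<open>g y \<noteq> L\<close> by (simp add: e_def)
    obtain s0 where s0: "\<And>s. s \<ge> s0 \<Longrightarrow> dist (g (p s)) L < e"
      using tendstoD[OF lim e] unfolding eventually_at_top_linorder by blast
    obtain n :: nat where n: "real n \<ge> s0" using real_arch_simple by blast
    have op: "openin M {z \<in> X. g z \<in> ball (g y) e}"
      using openin_continuous_map_preimage[OF holomorphic_functions_continuous[OF atlas Wt_holomorphic[OF g]], of "ball (g y) e"]
      by simp
    have "y \<in> {z \<in> X. g z \<in> ball (g y) e}" using yX e by simp
    from y(2)[of n, unfolded F_def in_closure_of, THEN conjunct2, rule_format, OF conjI, OF this op]
    have "\<exists>z. z \<in> p ` {s. s \<ge> real n} \<and> z \<in> {z \<in> X. g z \<in> ball (g y) e}" .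
    then obtain s where s: "s \<ge> real n" "g (p s) \<in> ball (g y) e" by blast
    have "dist (g (p s)) L < e" using s0 s(1) n by simp
    then have "dist (g y) L < 2 * e"
      using s(2) dist_triangle[of "g y" L "g (p s)"] by simp
    then show False by (simp add: e_def)
  qed
  have "k \<in> supp x \<and> inner v (rvec k) = 0" if "k \<in> supp y" for k
  proof -
    obtain g where g: "g \<in> Wt k" "g y \<noteq> 0" using \<open>k \<in> supp y\<close> by (auto simp: supp_def)
    have "g x \<noteq> 0"
    proof
      assume "g x = 0"
      then have "((\<lambda>s. g (p s)) \<longlongrightarrow> 0) at_top" by (simp add: gp[OF g(1)])
      then show False using lim_val[OF g(1)] g(2) by blast
    qed
    then have k: "k \<in> supp x" using g(1) by (auto simp: supp_def)
    have "inner v (rvec k) = 0"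
    proof (rule ccontr)
      assume "inner v (rvec k) \<noteq> 0"
      then have pos: "inner v (rvec k) > 0" using v[OF k] by simp
      have "((\<lambda>s. exp (- s * inner v (rvec k))) \<longlongrightarrow> 0) at_top"
        using pos by real_asymp
      then have "((\<lambda>s. of_real (exp (- s * inner v (rvec k))) * g x) \<longlongrightarrow> of_real 0 * g x) at_top"
        by (intro tendsto_mult tendsto_of_real tendsto_const)
      then have "((\<lambda>s. g (p s)) \<longlongrightarrow> 0) at_top" by (simp only: gp[OF g(1)] of_real_0 mult_zero_left)
      then show False using lim_val[OF g(1)] g(2) by blast
    qed
    with k show ?thesis by blast
  qed
  with yX that show ?thesis by blast
qed

lemma closed_orbit: "\<exists>x\<in>X. \<forall>k\<in>supp x. - k \<in> supp x"
proof -
  define d where "d = (\<lambda>x. dim (rvec ` supp x))"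
  obtain x where x: "x \<in> X" "\<And>y. y \<in> X \<Longrightarrow> d x \<le> d y"
    using point_exists ex_has_least_nat[of "\<lambda>x. x \<in> X" _ d] by blast
  have "\<not> (\<exists>v. \<exists>k0\<in>supp x. (\<forall>k\<in>supp x. inner v (rvec k) \<ge> 0) \<and> inner v (rvec k0) > 0)"
  proof
    assume "\<exists>v. \<exists>k0\<in>supp x. (\<forall>k\<in>supp x. inner v (rvec k) \<ge> 0) \<and> inner v (rvec k0) > 0"
    then obtain v k0 where v: "k0 \<in> supp x" "\<And>k. k \<in> supp x \<Longrightarrow> inner v (rvec k) \<ge> 0" "inner v (rvec k0) > 0"
      by blast
    obtain y where y: "y \<in> X" "supp y \<subseteq> {k \<in> supp x. inner v (rvec k) = 0}"
      using limit_point[OF x(1) v(2)] by blast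
    have sub: "span (rvec ` supp y) \<subseteq> span (rvec ` supp x)"
      using y(2) by (intro span_mono) auto
    have "span (rvec ` supp y) \<subseteq> {z. inner v z = 0}"
      using y(2) by (intro span_minimal subspace_hyperplane) auto
    then have "rvec k0 \<notin> span (rvec ` supp y)" using v(3) by auto
    moreover have "rvec k0 \<in> span (rvec ` supp x)" using v(1) by (intro span_base) auto
    ultimately have "span (rvec ` supp y) \<subset> span (rvec ` supp x)" using sub by blast
    then have "d y < d x" unfolding d_def by (rule dim_psubset)
    then show False using x(2)[OF y(1)] by simp
  qed
  then show ?thesis
    using monoid_group_or_halfspace[of "supp x", OF supp_0 supp_add] x(1) by blast
qed

end

section \<open>A fixed point of the torus\<close>

lemma compat_chart_std: "holomorphic_atlas (euclidean :: (complex^'n::finite) topology) std_atlas"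
    "compat_chart (euclidean :: (complex^'n::finite) topology) std_atlas UNIV id"
proof -
  have "homeomorphic_map euclidean euclidean (id :: complex^'n \<Rightarrow> _)"
    by simp
  moreover have "hol_vec_at (id \<circ> inv_into UNIV id) (z :: complex^'n)" for z
    by (simp add: hol_vec_at_def inv_id[unfolded id_def] id_def)
  ultimately show at: "holomorphic_atlas (euclidean :: (complex^'n::finite) topology) std_atlas"
    by (simp add: holomorphic_atlas_def std_atlas_def holomorphic_vec_on_iff)
  show "compat_chart (euclidean :: (complex^'n::finite) topology) std_atlas UNIV id"
    by (rule compat_chart_member[OF at]) (simp add: std_atlas_def)
qed

lemma holomorphic_functions_std:
  "f \<in> holomorphic_functions (euclidean :: (complex^'n::finite) topology) std_atlas \<longleftrightarrow> (\<forall>z. hol_at f z)"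
  by (simp add: holomorphic_functions_def std_atlas_def holomorphic_fun_on_iff inv_id[unfolded id_def] id_def o_def)

lemma holomorphic_functions_cong:
  assumes "holomorphic_atlas M \<A>" "f \<in> holomorphic_functions M \<A>" "\<And>x. x \<in> topspace M \<Longrightarrow> f x = g x"
  shows "g \<in> holomorphic_functions M \<A>"
proof (rule holomorphic_functionsI)
  fix U \<phi> z assume U: "(U,\<phi>) \<in> \<A>" "z \<in> \<phi> ` U"
  have cU: "compat_chart M \<A> U \<phi>" by (rule compat_chart_member[OF assms(1) U(1)])
  show "hol_at (g \<circ> inv_into U \<phi>) z"
    by (rule hol_at_transform[OF holomorphic_functionsD[OF assms(2) U] compat_chartD(2)[OF cU] U(2)])
       (use assms(3) compat_chart_inv(1)[OF cU] compat_chartD(4)[OF cU] in auto)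
qed

lemma hol_at_prod:
  "finite I \<Longrightarrow> (\<And>i. i \<in> I \<Longrightarrow> hol_at (f i) z) \<Longrightarrow> hol_at (\<lambda>z. \<Prod>i\<in>I. f i z) z"
  by (induction I rule: finite_induct) (auto intro: hol_at_mult)

lemma hol_at_power: "hol_at f z \<Longrightarrow> hol_at (\<lambda>z. f z ^ N) z"
  by (induction N) (auto intro: hol_at_mult)

lemma kdot_smult: "kdot k (c *s w) = c * kdot k w"
  by (simp add: kdot_def sum_distrib_left mult_ac)

lemma open_Collect_all_finite:
  fixes Q :: "'n::finite \<Rightarrow> 'b::topological_space \<Rightarrow> bool"
  assumes "\<And>j. open {z. Q j z}"
  shows "open {z. \<forall>j. Q j z}"
  using assms unfolding Collect_all_eq by (intro open_INT) auto

section \<open>From a fixed point to global coordinates\<close>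

context toric_action
begin

text \<open>The weight matrix is invertible over the reals, but its inverse need not be integral, so
  \<open>L\<close> may send periods to vectors that are none. That weight functions have integral
  exponents in these coordinates is a separate fact, proved at a fixed point.\<close>

lemma R_scaled_coordinates:
  assumes V: "weight_chart V g \<kappa>" "p \<in> V"
  obtains L where "linear L" "\<And>c \<eta>. L (c *s \<eta>) = c *s L \<eta>"
    "\<And>i \<eta> x. x \<in> X \<Longrightarrow> g i (R (L \<eta>) x) = exp (\<eta> $ i) * g i x"
proof -
  have inj: "inj (kmap \<kappa>)"
    unfolding linear_injective_0[OF linear_kmap] using weight_chart_kmap_inj[OF V] by blast
  then obtain L where L: "linear L" "\<And>x. L (kmap \<kappa> x) = x" "\<And>x. kmap \<kappa> (L x) = x"
    using linear_injective_isomorphism[OF linear_kmap] by metis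
  have kd: "kdot (\<kappa> i) (L \<eta>) = \<eta> $ i" for i \<eta>
    using arg_cong[OF L(3)[of \<eta>], of "\<lambda>v. v $ i"] by (simp add: kmap_def)
  have "kmap \<kappa> (c *s L \<eta>) = c *s \<eta>" for c \<eta>
    by (simp add: kmap_def vec_eq_iff kdot_smult kd)
  then have "L (c *s \<eta>) = c *s L \<eta>" for c \<eta> by (metis L(2))
  moreover have "g i (R (L \<eta>) x) = exp (\<eta> $ i) * g i x" if "x \<in> X" for i \<eta> x
    using R_Wt[OF weight_chartD(4)[OF V(1)] that] by (simp add: kd)
  ultimately show ?thesis using L(1) that by blast
qed

lemma fixed_point_biholomorphic:
  assumes p: "p \<in> X" and fixed: "\<And>w. R w p = p"
  shows "biholomorphically_equivalent M \<A> (euclidean :: (complex^'n) topology) std_atlas"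
proof -
  obtain V g \<kappa> where V: "weight_chart V g \<kappa>" "p \<in> V" using weight_chart_exists[OF p] by blast
  define \<gamma> where "\<gamma> = (\<lambda>y. \<chi> i. g i y)"
  have c\<gamma>: "compat_chart M \<A> V \<gamma>" using weight_chartD(1)[OF V(1)] by (simp add: \<gamma>_def)
  have VX: "V \<subseteq> X" by (rule weight_chartD(3)[OF V(1)])
  obtain L where L: "linear L" "\<And>c \<eta>. L (c *s \<eta>) = c *s L \<eta>"
    "\<And>i \<eta> x. x \<in> X \<Longrightarrow> g i (R (L \<eta>) x) = exp (\<eta> $ i) * g i x"
    using R_scaled_coordinates[OF V] by blast
  define S where "S = (\<lambda>\<eta>. R (L \<eta>))"
  have SX: "x \<in> X \<Longrightarrow> S \<eta> x \<in> X" for x \<eta> by (simp add: S_def)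
  have gS: "x \<in> X \<Longrightarrow> g i (S \<eta> x) = exp (\<eta> $ i) * g i x" for i \<eta> x by (simp add: S_def L(3))
  have S_add: "x \<in> X \<Longrightarrow> S (\<eta> + \<eta>') x = S \<eta> (S \<eta>' x)" for x \<eta> \<eta>'
    by (simp add: S_def linear_add[OF L(1)] H_add)
  have S_0: "x \<in> X \<Longrightarrow> S 0 x = x" for x by (simp add: S_def linear_0[OF L(1)])
  \<comment> \<open>At the fixed point a coordinate is multiplied by \<open>exp 1\<close> without
    changing: the chart is centred at 0.\<close>
  have gp: "g i p = 0" for i
  proof -
    have "g i p = exp 1 * g i p" using gS[OF p, of i "\<chi> j. 1"] fixed by (simp add: S_def)
    moreover have "exp 1 \<noteq> (1::complex)"
      by (metis exp_eq_one_iff exp_of_real of_real_1 of_real_eq_iff zero_neq_one)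
    ultimately show ?thesis by simp
  qed
  have \<gamma>p: "\<gamma> p = 0" by (simp add: \<gamma>_def vec_eq_iff gp)
  obtain e where e: "e > 0" "ball 0 e \<subseteq> \<gamma> ` V"
  proof -
    have "0 \<in> \<gamma> ` V" using V(2) \<gamma>p by force
    then show ?thesis using that compat_chartD(2)[OF c\<gamma>] open_contains_ball by blast
  qed
  \<comment> \<open>The norm is at most the sum of the moduli of the coordinates; the summand 1
    makes the estimate strict.\<close>
  define r where "r = e / (real CARD('n) + 1)"
  have r: "r > 0" using e(1) by (simp add: r_def add_nonneg_pos)
  have D: "z \<in> \<gamma> ` V" if "\<And>j. cmod (z $ j) < r" for z
  proof -
    have "norm z \<le> (\<Sum>j\<in>UNIV. cmod (z $ j))" unfolding norm_vec_def by (rule L2_set_le_sum) simp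
    also have "\<dots> \<le> (\<Sum>j\<in>(UNIV::'n set). r)" by (intro sum_mono less_imp_le that)
    also have "\<dots> = real CARD('n) * r" by simp
    also have "\<dots> < (real CARD('n) + 1) * r" using r by simp
    also have "\<dots> = e" by (simp add: r_def add_nonneg_pos)
    finally show ?thesis using e(2) by auto
  qed
  define P where "P = inv_into V \<gamma>"
  have P: "P z \<in> V" "\<gamma> (P z) = z" if "z \<in> \<gamma> ` V" for z
    unfolding P_def using compat_chart_inv(1,2)[OF c\<gamma> that] by auto
  have P\<gamma>: "P (\<gamma> x) = x" if "x \<in> V" for x
    unfolding P_def using compat_chart_inv(3)[OF c\<gamma> that] .
  have gP: "g i (P z) = z $ i" if "z \<in> \<gamma> ` V" for i z
    using arg_cong[OF P(2)[OF that], of "\<lambda>v. v $ i"] by (simp add: \<gamma>_def)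
  \<comment> \<open>contractions preserve the polydisc: both sides are lifts of the same path\<close>
  have lift: "S \<eta> x \<in> V" if x: "x \<in> V" "\<And>j. cmod (g j x) < r" and \<eta>: "\<And>j. Re (\<eta> $ j) \<le> 0" for x \<eta>
  proof -
    have xX: "x \<in> X" using x(1) VX by blast
    define q where "q = (\<lambda>t::real. S (t *\<^sub>R \<eta>) x)"
    define z where "z = (\<lambda>t::real. \<chi> j. exp ((t *\<^sub>R \<eta>) $ j) * g j x)"
    have "continuous_on {0..1} (\<lambda>t. L (t *\<^sub>R \<eta>))"
      using L(1) bounded_linear.continuous_on[of L] continuous_on_scaleR[OF continuous_on_id continuous_on_const]
      unfolding linear_conv_bounded_linear by blast
    from H_cont_orbit[OF this xX] have qc: "continuous_map (top_of_set {0..1}) M q"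
      by (simp add: q_def S_def)
    have zV: "z t \<in> \<gamma> ` V" if "t \<in> {0..1}" for t
    proof (rule D)
      fix j
      have "cmod (exp ((t *\<^sub>R \<eta>) $ j)) \<le> 1"
        using \<eta>[of j] that by (simp add: mult_nonneg_nonpos)
      then have "cmod (z t $ j) \<le> cmod (g j x)"
        by (simp add: z_def norm_mult mult_left_le_one_le)
      then show "cmod (z t $ j) < r" using x(2)[of j] by linarith
    qed
    have "continuous_on {0..1} z"
      unfolding z_def vector_scaleR_component
      by (intro continuous_on_vec_lambda continuous_on_mult continuous_on_exp continuous_on_scaleR
          continuous_on_id continuous_on_const)
    then have "continuous_map (top_of_set {0..1}) (top_of_set (\<gamma> ` V)) z"
      using zV by (auto simp: image_subset_iff)
    from continuous_map_compose[OF this compat_chart_continuous_inv[OF c\<gamma>]]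
    have Pc: "continuous_map (top_of_set {0..1}) M (P \<circ> z)" by (simp add: P_def)
    have iff: "q t = (P \<circ> z) t \<longleftrightarrow> q t \<in> V" if "t \<in> {0..1}" for t
    proof
      assume "q t = (P \<circ> z) t"
      then show "q t \<in> V" using P(1)[OF zV[OF that]] by simp
    next
      assume "q t \<in> V"
      moreover have "\<gamma> (q t) = z t" using gS[OF xX] by (simp add: \<gamma>_def q_def z_def vec_eq_iff)
      ultimately show "q t = (P \<circ> z) t" using P\<gamma>[of "q t"] by simp
    qed
    define T where "T = {t \<in> topspace (top_of_set {0..1}). q t = (P \<circ> z) t}"
    have "closedin (top_of_set {0..1}) T"
      unfolding T_def by (rule closedin_continuous_maps_eq[OF haus qc Pc])
    moreover have "T = {t \<in> topspace (top_of_set {0..1}). q t \<in> V}"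
      unfolding T_def using iff by auto
    then have "openin (top_of_set {0..1}) T"
      using openin_continuous_map_preimage[OF qc weight_chartD(2)[OF V(1)]] by simp
    moreover have "0 \<in> T" using iff[of 0] x(1) S_0[OF xX] by (simp add: T_def q_def)
    moreover have "connected {0..1::real}" by simp
    ultimately have "T = {0..1}" unfolding connected_clopen by blast
    then have "1 \<in> T" by simp
    then show ?thesis using iff[of 1] by (simp add: T_def q_def)
  qed
  have lift_eq: "S \<eta> (P z) = P (\<chi> j. exp (\<eta> $ j) * z $ j)"
    if z: "\<And>j. cmod (z $ j) < r" and \<eta>: "\<And>j. Re (\<eta> $ j) \<le> 0" for z \<eta>
  proof -
    have zV: "z \<in> \<gamma> ` V" using D z by blast
    have "S \<eta> (P z) \<in> V" by (rule lift) (use P(1)[OF zV] gP[OF zV] z \<eta> in auto)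
    moreover have "\<gamma> (S \<eta> (P z)) = (\<chi> j. exp (\<eta> $ j) * z $ j)"
      using gS[of "P z"] P(1)[OF zV] VX gP[OF zV] by (auto simp: \<gamma>_def vec_eq_iff)
    ultimately show ?thesis using P\<gamma> by metis
  qed
  \<comment> \<open>The exponents \<open>a j\<close> of \<open>f\<close> under the scalings are
    complex at first. Turning one coordinate fully round makes them integers, boundedness near the
    fixed point makes them nonnegative.\<close>
  have monomial: "\<exists>c m. \<forall>x\<in>X. f x = c * (\<Prod>j\<in>UNIV. g j x ^ m j)" if f: "f \<in> Wt k" "nonzero f" for f k
  proof -
    have fO: "f \<in> \<O>" by (rule Wt_holomorphic[OF f(1)])
    define a where "a = (\<lambda>j. kdot k (L (axis j 1)))"
    have kL: "kdot k (L \<eta>) = (\<Sum>j\<in>UNIV. \<eta> $ j * a j)" for \<eta>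
    proof -
      have "\<eta> = (\<Sum>j\<in>UNIV. (\<eta> $ j) *s axis j 1)"
        by (simp add: vec_eq_iff axis_def if_distrib sum.delta' cong: if_cong)
      then have "L \<eta> = (\<Sum>j\<in>UNIV. (\<eta> $ j) *s L (axis j 1))"
        by (metis (no_types, lifting) L(2) linear_sum[OF L(1)] sum.cong)
      moreover have "kdot k (\<Sum>j\<in>J. w j) = (\<Sum>j\<in>J. kdot k (w j))" if "finite J" for J and w :: "'n \<Rightarrow> complex^'n"
        using that by (induction J rule: finite_induct) (simp_all add: kdot_add)
      ultimately show ?thesis by (simp add: kdot_smult a_def)
    qed
    have fS: "f (S \<eta> x) = exp (\<Sum>j\<in>UNIV. \<eta> $ j * a j) * f x" if "x \<in> X" for \<eta> x
      using R_Wt[OF f(1) that, of "L \<eta>"] by (simp add: S_def kL)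
    define z0 where "z0 = (\<chi> j::'n. complex_of_real (r/2))"
    have z0: "cmod (z0 $ j) < r" for j using r by (simp add: z0_def)
    have z0V: "z0 \<in> \<gamma> ` V" using D z0 by blast
    define x0 where "x0 = P z0"
    have x0: "x0 \<in> X" using P(1)[OF z0V] VX by (auto simp: x0_def)
    \<comment> \<open>Points whose coordinates are nonzero and smaller than those of
      \<open>x0\<close>: each is reached from \<open>x0\<close> by a contraction, so
      \<open>f\<close> is explicit there.\<close>
    define W where "W = {y \<in> V. \<gamma> y \<in> {z. \<forall>j. 0 < cmod (z $ j) \<and> cmod (z $ j) < r/2}}"
    have "open {z::complex^'n. \<forall>j. 0 < cmod (z $ j) \<and> cmod (z $ j) < r/2}"
      by (intro open_Collect_all_finite open_Collect_conj open_Collect_less continuous_intros)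
    then have W: "openin M W" unfolding W_def by (rule compat_chart_open_preimage[OF c\<gamma>])
    have Wne: "W \<noteq> {}"
    proof -
      define z1 where "z1 = (\<chi> j::'n. complex_of_real (r/4))"
      have "z1 \<in> \<gamma> ` V" by (rule D) (use r in \<open>simp add: z1_def\<close>)
      then have "P z1 \<in> W" using P r by (simp add: W_def z1_def)
      then show ?thesis by blast
    qed
    have fW: "f y = exp (\<Sum>j\<in>UNIV. Ln (g j y / of_real (r/2)) * a j) * f x0" if "y \<in> W" for y
    proof -
      have y: "y \<in> V" "\<And>j. 0 < cmod (g j y)" "\<And>j. cmod (g j y) < r/2"
        using that by (auto simp: W_def \<gamma>_def)
      define \<eta> where "\<eta> = (\<chi> j. Ln (g j y / of_real (r/2)))"
      have nz: "g j y / of_real (r/2) \<noteq> 0" for j using y(2)[of j] r by auto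
      have "Re (\<eta> $ j) \<le> 0" for j
      proof -
        have "cmod (g j y / of_real (r/2)) \<le> 1"
          using y(3)[of j] r by (simp add: norm_divide field_simps)
        then show ?thesis using Re_Ln[OF nz[of j]] nz[of j] by (simp add: \<eta>_def)
      qed
      then have "S \<eta> x0 = P (\<chi> j. exp (\<eta> $ j) * z0 $ j)"
        unfolding x0_def by (intro lift_eq z0)
      also have "(\<chi> j. exp (\<eta> $ j) * z0 $ j) = \<gamma> y"
        using nz r by (simp add: \<eta>_def z0_def \<gamma>_def vec_eq_iff)
      finally have "S \<eta> x0 = y" using P\<gamma>[OF y(1)] by simp
      then show ?thesis using fS[OF x0, of \<eta>] by (simp add: \<eta>_def)
    qed
    have fx0: "f x0 \<noteq> 0"
    proof
      assume "f x0 = 0"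
      then have "f x = 0" if "x \<in> X" for x
        using zero_if_zero_on_open[OF fO W Wne _ that] fW by simp
      then show False using f(2) by (auto simp: nonzero_def)
    qed
    have "\<exists>m::nat. a j = of_nat m" for j
    proof -
      define c where "c = 2 * pi * \<i>"
      \<comment> \<open>The lift of a closed loop in the polydisc is closed, although
        \<open>L (axis j c)\<close> need not be a period.\<close>
      have "S (axis j c) x0 = P (\<chi> i. exp (axis j c $ i) * z0 $ i)"
        unfolding x0_def by (intro lift_eq z0) (simp add: c_def axis_def)
      also have "(\<chi> i. exp (axis j c $ i) * z0 $ i) = z0"
        by (simp add: vec_eq_iff axis_def c_def exp_two_pi_i)
      finally have "exp (\<Sum>i\<in>UNIV. axis j c $ i * a i) = 1"
        using fS[OF x0, of "axis j c"] fx0 by (simp add: x0_def)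
      moreover have sum_axis: "(\<Sum>i\<in>UNIV. axis j d $ i * a i) = d * a j" for d
        by (simp add: axis_def if_distrib[of "\<lambda>x. x * _"] sum.delta' cong: if_cong)
      ultimately have "exp (c * a j) = 1" by simp
      then obtain n :: int where n: "Re (c * a j) = 0" "Im (c * a j) = of_int (2 * n) * pi"
        unfolding exp_eq_1 by blast
      then have an: "a j = of_int n" by (simp add: c_def complex_eq_iff)
      have "n \<ge> 0"
      proof (rule ccontr)
        assume "\<not> n \<ge> 0"
        then have n1: "1 \<le> - n" by simp
        \<comment> \<open>A compact polydisc, on which \<open>f\<close> is bounded. Contracting the
          \<open>j\<close>-th coordinate of \<open>x0\<close> stays in it, but with a negative
          exponent \<open>f\<close> would grow exponentially.\<close>
        define Q where "Q = {z::complex^'n. \<forall>i. cmod (z $ i) \<le> r/2}"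
        have QV: "Q \<subseteq> \<gamma> ` V"
        proof
          fix z assume z: "z \<in> Q"
          have "cmod (z $ j) < r" for j
          proof -
            have "cmod (z $ j) \<le> r/2" using z unfolding Q_def by blast
            then show ?thesis using r by linarith
          qed
          then show "z \<in> \<gamma> ` V" by (rule D)
        qed
        have "compact Q"
        proof -
          have "closed Q" unfolding Q_def
            by (intro closed_Collect_all closed_Collect_le continuous_intros)
          moreover have "bounded Q"
            unfolding bounded_iff
          proof (intro exI ballI)
            fix z assume "z \<in> Q"
            have "norm z \<le> (\<Sum>i\<in>UNIV. cmod (z $ i))" unfolding norm_vec_def by (rule L2_set_le_sum) simp
            also have "\<dots> \<le> (\<Sum>i\<in>(UNIV::'n set). r/2)" using \<open>z \<in> Q\<close> by (intro sum_mono) (simp add: Q_def)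
            finally show "norm z \<le> (\<Sum>i\<in>(UNIV::'n set). r/2)" .
          qed
          ultimately show ?thesis by (simp add: compact_eq_bounded_closed)
        qed
        moreover have "continuous_on Q (f \<circ> P)"
          unfolding P_def
          by (intro continuous_at_imp_continuous_on ballI hol_at_continuous
              holomorphic_functions_compat_chart[OF atlas fO c\<gamma>]) (use QV in blast)
        ultimately have "compact ((f \<circ> P) ` Q)" by (intro compact_continuous_image)
        then obtain B where B: "\<And>z. z \<in> Q \<Longrightarrow> cmod (f (P z)) \<le> B"
          using compact_imp_bounded bounded_iff by (metis comp_apply imageI)
        have est: "exp s * cmod (f x0) \<le> B" if "s \<ge> 0" for s :: real
        proof -
          define d where "d = complex_of_real (- s)"
          have "S (axis j d) x0 = P (\<chi> i. exp (axis j d $ i) * z0 $ i)"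
            unfolding x0_def by (intro lift_eq z0) (use that in \<open>simp add: d_def axis_def\<close>)
          moreover have "(\<chi> i. exp (axis j d $ i) * z0 $ i) \<in> Q"
          proof -
            have "cmod (exp (axis j d $ i) * z0 $ i) \<le> r/2" for i
            proof -
              have "cmod (exp (axis j d $ i)) \<le> 1" using that by (simp add: axis_def d_def)
              then show ?thesis using r by (simp add: norm_mult z0_def mult_left_le_one_le)
            qed
            then show ?thesis by (simp add: Q_def)
          qed
          ultimately have "cmod (f (S (axis j d) x0)) \<le> B" using B by simp
          moreover have "f (S (axis j d) x0) = exp (d * a j) * f x0"
            using fS[OF x0, of "axis j d"] by (simp only: sum_axis)
          moreover have "cmod (exp (d * a j)) = exp (- s * of_int n)"
            by (simp add: an d_def)
          moreover have "s \<le> - s * of_int n"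
          proof -
            have "s * 1 \<le> s * of_int (- n)" using n1 that by (intro mult_left_mono) linarith+
            then show ?thesis by simp
          qed
          then have "exp s \<le> exp (- s * of_int n)" by simp
          ultimately show ?thesis
            by (smt (verit) mult_right_mono norm_ge_zero norm_mult)
        qed
        have pos: "cmod (f x0) > 0" using fx0 by simp
        have "cmod (f x0) \<le> B" using est[of 0] by simp
        then have B0: "B \<ge> 0" by (rule order_trans[OF norm_ge_zero])
        \<comment> \<open>The time \<open>B / cmod (f x0)\<close> and
          \<open>exp s \<ge> 1 + s\<close> give \<open>B + cmod (f x0) \<le> B\<close>.\<close>
        have "(1 + B / cmod (f x0)) * cmod (f x0) \<le> exp (B / cmod (f x0)) * cmod (f x0)"
          using exp_ge_add_one_self[of "B / cmod (f x0)"] pos by (intro mult_right_mono) auto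
        also have "\<dots> \<le> B" using est[of "B / cmod (f x0)"] B0 pos by simp
        finally show False using pos by (simp add: distrib_right)
      qed
      then show ?thesis using an by (intro exI[of _ "nat n"]) simp
    qed
    then obtain m where m: "\<And>j. a j = of_nat (m j)" by metis
    \<comment> \<open>All coordinates of \<open>x0\<close> equal \<open>r/2\<close>, so this is the
      quotient of \<open>f\<close> by the monomial at \<open>x0\<close>.\<close>
    define c where "c = f x0 / (\<Prod>j\<in>(UNIV::'n set). of_real (r/2) ^ m j)"
    have "f x - c * (\<Prod>j\<in>UNIV. g j x ^ m j) = 0" if x: "x \<in> X" for x
    proof (rule zero_if_zero_on_open[OF _ W Wne _ x])
      show "(\<lambda>x. f x - c * (\<Prod>j\<in>UNIV. g j x ^ m j)) \<in> \<O>"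
        by (intro holomorphic_functions_diff holomorphic_functions_mult holomorphic_functions_const
            holomorphic_functions_prod holomorphic_functions_power fO weight_chartD(5)[OF V(1)] finite)
      fix y assume y: "y \<in> W"
      then have nz: "g j y / of_real (r/2) \<noteq> 0" for j using r by (auto simp: W_def \<gamma>_def)
      have "exp (\<Sum>j\<in>UNIV. Ln (g j y / of_real (r/2)) * a j) = (\<Prod>j\<in>UNIV. exp (Ln (g j y / of_real (r/2))) ^ m j)"
        by (simp add: exp_sum m exp_of_nat2_mult)
      also have "\<dots> = (\<Prod>j\<in>UNIV. (g j y / of_real (r/2)) ^ m j)"
        by (simp only: exp_Ln[OF nz])
      also have "\<dots> = (\<Prod>j\<in>UNIV. g j y ^ m j) / (\<Prod>j\<in>(UNIV::'n set). of_real (r/2) ^ m j)"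
        by (simp only: power_divide prod_dividef)
      finally have "f y = (\<Prod>j\<in>UNIV. g j y ^ m j) / (\<Prod>j\<in>(UNIV::'n set). of_real (r/2) ^ m j) * f x0"
        using fW[OF y] by simp
      then show "f y - c * (\<Prod>j\<in>UNIV. g j y ^ m j) = 0" by (simp add: c_def)
    qed
    then show ?thesis by (intro exI[of _ c] exI[of _ m]) simp
  qed
  have inj: "inj_on \<gamma> X"
  proof (rule inj_onI, rule weight_separate)
    fix x y k f assume x: "x \<in> X" and y: "y \<in> X" and eq: "\<gamma> x = \<gamma> y" and f: "f \<in> Wt k"
    have geq: "g j x = g j y" for j using arg_cong[OF eq, of "\<lambda>v. v $ j"] by (simp add: \<gamma>_def)
    show "f x = f y"
    proof (cases "nonzero f")
      case True
      then obtain c m where "\<And>x. x \<in> X \<Longrightarrow> f x = c * (\<Prod>j\<in>UNIV. g j x ^ m j)"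
        using monomial[OF f] by blast
      with x y show ?thesis by (simp add: geq)
    next
      case False
      with x y show ?thesis by (simp add: nonzero_def)
    qed
  qed
  define G where "G = inv_into X \<gamma>"
  define E where "E = (\<lambda>t::real. \<chi> j::'n. complex_of_real t)"
  \<comment> \<open>Points that the contraction by \<open>exp (- t)\<close> brings into the
    polydisc. There the inverse of \<open>\<gamma>\<close> is found by contracting, lifting to
    \<open>V\<close> and flowing back with \<open>S (E t)\<close>; these sets exhaust the whole
    space.\<close>
  define Z where "Z = (\<lambda>t. {\<zeta>::complex^'n. \<forall>j. cmod (exp (of_real (- t)) * \<zeta> $ j) < r})"
  define sc where "sc = (\<lambda>t::real. \<lambda>\<zeta>::complex^'n. (\<chi> j. exp (of_real (- t)) * \<zeta> $ j))"
  have scV: "sc t \<zeta> \<in> \<gamma> ` V" if "\<zeta> \<in> Z t" for t \<zeta>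
    using that by (intro D) (simp add: Z_def sc_def)
  have loc: "S (E t) (P (sc t \<zeta>)) \<in> X \<and> \<gamma> (S (E t) (P (sc t \<zeta>))) = \<zeta>" if "\<zeta> \<in> Z t" for t \<zeta>
  proof
    have PX: "P (sc t \<zeta>) \<in> X" using P(1)[OF scV[OF that]] VX by blast
    then show "S (E t) (P (sc t \<zeta>)) \<in> X" by (rule SX)
    have "g j (S (E t) (P (sc t \<zeta>))) = \<zeta> $ j" for j
      unfolding gS[OF PX] gP[OF scV[OF that]] by (simp add: E_def sc_def exp_minus field_simps)
    then show "\<gamma> (S (E t) (P (sc t \<zeta>))) = \<zeta>" by (simp add: \<gamma>_def vec_eq_iff)
  qed
  have Z_ex: "\<exists>t. \<zeta> \<in> Z t" for \<zeta>
  proof -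
    define t where "t = norm \<zeta> / r"
    have "cmod (exp (of_real (- t)) * \<zeta> $ j) < r" for j
    proof -
      have "1 + t \<le> exp t" by (rule exp_ge_add_one_self)
      then have "norm \<zeta> + r \<le> exp t * r" using r by (simp add: t_def field_simps)
      moreover have "cmod (\<zeta> $ j) \<le> norm \<zeta>" by (rule Finite_Cartesian_Product.norm_nth_le)
      ultimately have "cmod (\<zeta> $ j) < exp t * r" using r by linarith
      then have "exp (- t) * cmod (\<zeta> $ j) < r" by (simp add: exp_minus field_simps)
      then show ?thesis by (simp add: norm_mult)
    qed
    then show ?thesis by (auto simp: Z_def)
  qed
  have G_loc: "G \<zeta> = S (E t) (P (sc t \<zeta>))" if "\<zeta> \<in> Z t" for t \<zeta>
    using loc[OF that] inj unfolding G_def by (metis inv_into_f_f)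
  have surj: "\<gamma> ` X = UNIV"
  proof -
    have "\<zeta> \<in> \<gamma> ` X" for \<zeta>
    proof -
      obtain t where "\<zeta> \<in> Z t" using Z_ex by blast
      from loc[OF this] show ?thesis by (metis imageI)
    qed
    then show ?thesis by blast
  qed
  have GX: "G \<zeta> \<in> X" "\<gamma> (G \<zeta>) = \<zeta>" for \<zeta>
    unfolding G_def using surj by (auto simp: inv_into_into f_inv_into_f)
  have gG: "g j (G \<zeta>) = \<zeta> $ j" for j \<zeta>
    using arg_cong[OF GX(2)[of \<zeta>], of "\<lambda>v. v $ j"] by (simp add: \<gamma>_def)
  have Gcont: "continuous_map euclidean M G"
    unfolding continuous_map_def
  proof (intro conjI allI impI)
    show "G \<in> topspace euclidean \<rightarrow> X" using GX by auto
    fix U assume U: "openin M U"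
    have "open {\<zeta>. G \<zeta> \<in> U}"
      unfolding open_subopen[of "{\<zeta>. G \<zeta> \<in> U}"]
    proof (intro ballI)
      fix \<zeta> assume \<zeta>: "\<zeta> \<in> {\<zeta>. G \<zeta> \<in> U}"
      obtain t where t: "\<zeta> \<in> Z t" using Z_ex by blast
      have "openin M {x \<in> X. S (E t) x \<in> U}"
        using openin_continuous_map_preimage[OF H_cont_slice U] by (simp add: S_def)
      from compat_chart_inv_preimage[OF c\<gamma> this]
      have o1: "open {z \<in> \<gamma> ` V. P z \<in> {x \<in> X. S (E t) x \<in> U}}" by (simp add: P_def)
      have sc_cont: "continuous_on UNIV (sc t)"
        unfolding sc_def by (intro continuous_on_vec_lambda continuous_intros)
      have "open (Z t)"
        unfolding Z_def by (intro open_Collect_all_finite open_Collect_less continuous_intros)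
      then have "open (sc t -` {z \<in> \<gamma> ` V. P z \<in> {x \<in> X. S (E t) x \<in> U}} \<inter> Z t)"
        using open_vimage[OF o1 sc_cont] by (rule open_Int[rotated])
      moreover have "\<zeta> \<in> sc t -` {z \<in> \<gamma> ` V. P z \<in> {x \<in> X. S (E t) x \<in> U}} \<inter> Z t"
        using t \<zeta> G_loc[OF t] scV[OF t] P(1)[OF scV[OF t]] VX by auto
      moreover have "sc t -` {z \<in> \<gamma> ` V. P z \<in> {x \<in> X. S (E t) x \<in> U}} \<inter> Z t \<subseteq> {\<zeta>. G \<zeta> \<in> U}"
        using G_loc by auto
      ultimately show "\<exists>T. open T \<and> \<zeta> \<in> T \<and> T \<subseteq> {\<zeta>. G \<zeta> \<in> U}" by blast
    qed
    then show "openin euclidean {x \<in> topspace euclidean. G x \<in> U}" by simp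
  qed
  have \<gamma>cont: "continuous_map M euclidean \<gamma>"
    unfolding \<gamma>_def
    by (intro continuous_map_vec_lambda holomorphic_functions_continuous[OF atlas] weight_chartD(5)[OF V(1)])
  have \<gamma>hol: "holomorphic_map M \<A> euclidean std_atlas \<gamma>"
  proof (rule holomorphic_mapI[OF atlas compat_chart_std(1) \<gamma>cont], intro exI conjI allI)
    fix y i assume "y \<in> X"
    show "\<gamma> y \<in> UNIV" by simp
    show "compat_chart euclidean std_atlas UNIV id" by (rule compat_chart_std)
    show "(\<lambda>y. id (\<gamma> y) $ i) \<in> \<O>" using weight_chartD(5)[OF V(1)] by (simp add: \<gamma>_def)
  qed
  have Ghol: "holomorphic_map euclidean std_atlas M \<A> G"
  proof (rule holomorphic_mapI[OF compat_chart_std(1) atlas Gcont])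
    fix \<zeta> :: "complex^'n"
    obtain V' g' \<kappa>' where V': "weight_chart V' g' \<kappa>'" "G \<zeta> \<in> V'"
      using weight_chart_exists[OF GX(1)] by blast
    have "(\<lambda>\<zeta>. (\<chi> i. g' i (G \<zeta>)) $ i) \<in> holomorphic_functions euclidean std_atlas" for i
    proof -
      \<comment> \<open>Coordinates of every weight chart are monomials in \<open>\<zeta>\<close>,
        which makes the inverse holomorphic.\<close>
      obtain c m where cm: "\<And>x. x \<in> X \<Longrightarrow> g' i x = c * (\<Prod>j\<in>UNIV. g j x ^ m j)"
        using monomial[OF weight_chartD(4)[OF V'(1)] weight_chart_nonzero[OF V']] by blast
      have "hol_at (\<lambda>\<zeta>. c * (\<Prod>j\<in>UNIV. \<zeta> $ j ^ m j)) \<zeta>" for \<zeta>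
        by (intro hol_at_mult hol_at_const hol_at_prod hol_at_power hol_at_coord finite)
      then show ?thesis by (simp add: holomorphic_functions_std cm[OF GX(1)] gG)
    qed
    with V' show "\<exists>W h. G \<zeta> \<in> W \<and> compat_chart M \<A> W h \<and>
        (\<forall>i. (\<lambda>\<zeta>. h (G \<zeta>) $ i) \<in> holomorphic_functions euclidean std_atlas)"
      using weight_chartD(1)[OF V'(1)] by blast
  qed
  have "biholomorphic_map M \<A> euclidean std_atlas \<gamma>"
    unfolding biholomorphic_map_def
    using inj surj \<gamma>hol Ghol by (simp add: bij_betw_def G_def)
  then show ?thesis unfolding biholomorphically_equivalent_def by blast
qed

text \<open>At a point whose weights come in opposite pairs the hypothesis leaves only the weight 0.
  Weight functions are then either zero at \<open>p\<close> or invariant, and cannot tell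
  \<open>R w p\<close> from \<open>p\<close>.\<close>

lemma fixed_point_exists:
  assumes "\<And>k f f'. f \<in> Wt k \<Longrightarrow> f' \<in> Wt (- k) \<Longrightarrow> nonzero f \<Longrightarrow> nonzero f' \<Longrightarrow> k = 0"
  shows "\<exists>p\<in>X. \<forall>w. R w p = p"
proof -
  obtain p where p: "p \<in> X" "\<And>k. k \<in> supp p \<Longrightarrow> - k \<in> supp p" using closed_orbit by blast
  have supp0: "k = 0" if k: "k \<in> supp p" for k
  proof -
    obtain f f' where "f \<in> Wt k" "f p \<noteq> 0" "f' \<in> Wt (- k)" "f' p \<noteq> 0"
      using k p(2)[OF k] unfolding supp_def by blast
    then show ?thesis using assms p(1) unfolding nonzero_def by blast
  qed
  have "R w p = p" for w
  proof (rule weight_separate)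
    fix k f assume f: "f \<in> Wt k"
    show "f (R w p) = f p"
    proof (cases "f p = 0")
      case False
      then have "k = 0" using f by (intro supp0) (auto simp: supp_def)
      then show ?thesis using R_Wt[OF f p(1)] by simp
    qed (simp add: R_Wt[OF f p(1)])
  qed (use p(1) in auto)
  then show ?thesis using p(1) by blast
qed

end

section \<open>Reflections\<close>

text \<open>The part of the Stein property that suffices to recognise automorphisms. It is evident
  for \<open>\<complex>\<^sup>n\<close>, so both sides of the isomorphism are treated alike.\<close>

definition global_coordinates :: "'a topology \<Rightarrow> ('a, 'n::finite) atlas \<Rightarrow> bool"
  where "global_coordinates M \<A> \<longleftrightarrow> holomorphic_atlas M \<A> \<and>
    (\<forall>x\<in>topspace M. \<exists>W g. x \<in> W \<and> compat_chart M \<A> W g \<and> (\<forall>i. (\<lambda>y. g y $ i) \<in> holomorphic_functions M \<A>))"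

lemma stein_global_coordinates:
  assumes "stein_manifold M \<A>"
  shows "global_coordinates M \<A>"
  unfolding global_coordinates_def
proof (intro conjI ballI)
  show "holomorphic_atlas M \<A>" using assms by (simp add: stein_manifold_def complex_manifold_def)
  fix x assume "x \<in> topspace M"
  then obtain f V where "\<And>i. f i \<in> holomorphic_functions M \<A>" "x \<in> V"
      "holomorphic_atlas M (insert (V, \<lambda>y. \<chi> i. f i y) \<A>)"
    using assms unfolding stein_manifold_def by blast
  then show "\<exists>W g. x \<in> W \<and> compat_chart M \<A> W g \<and> (\<forall>i. (\<lambda>y. g y $ i) \<in> holomorphic_functions M \<A>)"
    by (intro exI[of _ V] exI[of _ "\<lambda>y. \<chi> i. f i y"]) (simp add: compat_chart_def)
qed

lemma std_global_coordinates:
  "global_coordinates (euclidean :: (complex^'n::finite) topology) std_atlas"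
  unfolding global_coordinates_def
  using compat_chart_std by (auto simp: holomorphic_functions_std intro!: exI[of _ UNIV] exI[of _ id])

lemma holomorphic_map_from_functions:
  assumes "global_coordinates M \<A>" "continuous_map M M F"
    and "\<And>u. u \<in> holomorphic_functions M \<A> \<Longrightarrow> (\<lambda>x. u (F x)) \<in> holomorphic_functions M \<A>"
  shows "holomorphic_map M \<A> M \<A> F"
proof (rule holomorphic_mapI[OF _ _ assms(2)])
  fix y assume "y \<in> topspace M"
  then have "F y \<in> topspace M" using continuous_map_image_subset_topspace[OF assms(2)] by blast
  then obtain W g where "F y \<in> W" "compat_chart M \<A> W g" "\<And>i. (\<lambda>y. g y $ i) \<in> holomorphic_functions M \<A>"
    using assms(1) unfolding global_coordinates_def by blast
  then show "\<exists>W g. F y \<in> W \<and> compat_chart M \<A> W g \<and>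
      (\<forall>i. (\<lambda>y. g (F y) $ i) \<in> holomorphic_functions M \<A>)"
    using assms(3)[of "\<lambda>y. g y $ _"] by blast
qed (use assms(1) in \<open>simp_all add: global_coordinates_def\<close>)

lemma AutI:
  assumes gc: "global_coordinates M \<A>" and ext: "f \<in> extensional (topspace M)"
    and cf: "continuous_map M M f" and cg: "continuous_map M M g"
    and gf: "\<And>x. x \<in> topspace M \<Longrightarrow> g (f x) = x" and fg: "\<And>x. x \<in> topspace M \<Longrightarrow> f (g x) = x"
    and uf: "\<And>u. u \<in> holomorphic_functions M \<A> \<Longrightarrow> (\<lambda>x. u (f x)) \<in> holomorphic_functions M \<A>"
    and ug: "\<And>u. u \<in> holomorphic_functions M \<A> \<Longrightarrow> (\<lambda>x. u (g x)) \<in> holomorphic_functions M \<A>"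
  shows "f \<in> Aut M \<A>"
proof -
  have fX: "f ` topspace M \<subseteq> topspace M" and gX: "g ` topspace M \<subseteq> topspace M"
    using cf cg continuous_map_image_subset_topspace by blast+
  have bij: "bij_betw f (topspace M) (topspace M)"
    by (rule bij_betw_byWitness[of _ g]) (use gf fg fX gX in auto)
  have inv: "g x = inv_into (topspace M) f x" if "x \<in> topspace M" for x
    using that fg gX bij by (intro inv_into_f_eq[symmetric]) (auto simp: bij_betw_def)
  have at: "holomorphic_atlas M \<A>" using gc by (simp add: global_coordinates_def)
  have "holomorphic_map M \<A> M \<A> (inv_into (topspace M) f)"
  proof (rule holomorphic_map_from_functions[OF gc])
    show "continuous_map M M (inv_into (topspace M) f)"
      by (rule continuous_map_eq[OF cg inv])
    show "(\<lambda>x. u (inv_into (topspace M) f x)) \<in> holomorphic_functions M \<A>"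
      if "u \<in> holomorphic_functions M \<A>" for u
      by (rule holomorphic_functions_cong[OF at ug[OF that]]) (simp add: inv)
  qed
  moreover have "holomorphic_map M \<A> M \<A> f"
    by (rule holomorphic_map_from_functions[OF gc cf uf])
  ultimately show ?thesis using bij ext by (simp add: Aut_def biholomorphic_map_def)
qed

lemma AutD:
  assumes "holomorphic_atlas M \<A>" "f \<in> Aut M \<A>"
  defines "g \<equiv> inv_into (topspace M) f"
  shows "f \<in> extensional (topspace M)" "continuous_map M M f" "continuous_map M M g"
    and "x \<in> topspace M \<Longrightarrow> f x \<in> topspace M" "x \<in> topspace M \<Longrightarrow> g x \<in> topspace M"
    and "x \<in> topspace M \<Longrightarrow> g (f x) = x" "x \<in> topspace M \<Longrightarrow> f (g x) = x"
    and "u \<in> holomorphic_functions M \<A> \<Longrightarrow> (\<lambda>x. u (f x)) \<in> holomorphic_functions M \<A>"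
    and "u \<in> holomorphic_functions M \<A> \<Longrightarrow> (\<lambda>x. u (g x)) \<in> holomorphic_functions M \<A>"
proof -
  have bij: "bij_betw f (topspace M) (topspace M)" and hol: "holomorphic_map M \<A> M \<A> f" "holomorphic_map M \<A> M \<A> g"
    and ext: "f \<in> extensional (topspace M)"
    using assms(2) by (auto simp: Aut_def biholomorphic_map_def g_def)
  show "f \<in> extensional (topspace M)" by (rule ext)
  show "continuous_map M M f" "continuous_map M M g" using hol by (auto simp: holomorphic_map_def)
  show "x \<in> topspace M \<Longrightarrow> f x \<in> topspace M" using bij bij_betwE by blast
  show "x \<in> topspace M \<Longrightarrow> g x \<in> topspace M"
    using bij unfolding g_def bij_betw_def by (metis inv_into_into)
  show "x \<in> topspace M \<Longrightarrow> g (f x) = x"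
    using bij unfolding g_def by (rule bij_betw_inv_into_left)
  show "x \<in> topspace M \<Longrightarrow> f (g x) = x"
    using bij unfolding g_def by (rule bij_betw_inv_into_right)
  show "u \<in> holomorphic_functions M \<A> \<Longrightarrow> (\<lambda>x. u (f x)) \<in> holomorphic_functions M \<A>"
    by (rule holomorphic_map_pullback[OF assms(1,1) hol(1)])
  show "u \<in> holomorphic_functions M \<A> \<Longrightarrow> (\<lambda>x. u (g x)) \<in> holomorphic_functions M \<A>"
    by (rule holomorphic_map_pullback[OF assms(1,1) hol(2)])
qed

section \<open>Twisting the action by a nowhere vanishing weight function\<close>

definition idot :: "int^'n \<Rightarrow> int^'n \<Rightarrow> int"
  where "idot k v = (\<Sum>i\<in>UNIV. k $ i * v $ i)"

text \<open>\<open>ray v (Ln z)\<close> represents the torus element \<open>z\<^sup>v\<close>, the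
  value at \<open>z\<close> of the one-parameter subgroup with direction \<open>v\<close>;
  integrality of \<open>v\<close> makes it independent of the branch of the logarithm.\<close>

definition ray :: "int^'n \<Rightarrow> complex \<Rightarrow> complex^'n"
  where "ray v c = (\<chi> i. of_int (v $ i) * c)"

lemma kdot_ray: "kdot k (ray v c) = of_int (idot k v) * c"
  by (simp add: kdot_def ray_def idot_def sum_distrib_left mult_ac)

lemma exp_int_mult_Ln: "z \<noteq> 0 \<Longrightarrow> exp (of_int n * Ln z) = z powi n"
  by (metis exp_Ln exp_power_int mult.commute)

lemma holomorphic_functions_powi:
  assumes "holomorphic_atlas M \<A>" "f \<in> holomorphic_functions M \<A>" "\<And>x. x \<in> topspace M \<Longrightarrow> f x \<noteq> 0"
  shows "(\<lambda>x. f x powi n) \<in> holomorphic_functions M \<A>"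
  unfolding power_int_def using assms
  by (cases "n \<ge> 0") (simp_all add: holomorphic_functions_power holomorphic_functions_inverse
      holomorphic_functions_power[OF holomorphic_functions_inverse])

context toric_action
begin

text \<open>The product of the two functions has weight 0, hence is constant, and the constant is
  not 0 because two nonzero holomorphic functions are both nonzero at some point.\<close>

lemma unit_nonvanishing:
  assumes "f \<in> Wt l" "f' \<in> Wt (- l)" "nonzero f" "nonzero f'" "x \<in> X"
  shows "f x \<noteq> 0"
proof
  assume fx: "f x = 0"
  have "(\<lambda>x. f x * f' x) \<in> Wt 0" using Wt_mult[OF assms(1,2)] by simp
  moreover have "nonzero (\<lambda>_. 1)" using assms(5) by (auto simp: nonzero_def)
  ultimately obtain c where c: "\<And>x. x \<in> X \<Longrightarrow> f x * f' x = c"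
    using Wt_proportional[OF Wt_one] by force
  obtain y where y: "y \<in> X" "f y \<noteq> 0 \<and> f' y \<noteq> 0"
  proof -
    have "\<exists>y\<in>X. \<forall>i\<in>UNIV. (\<lambda>i::bool. if i then f else f') i y \<noteq> 0"
      by (rule nonzero_on_open) (use assms Wt_holomorphic in auto)
    then show ?thesis using that by (metis UNIV_I)
  qed
  then show False using c[OF y(1)] c[OF assms(5)] fx by auto
qed

lemma R_ray_cong:
  assumes "exp c = exp d" "x \<in> X"
  shows "R (ray v c) x = R (ray v d) x"
proof -
  obtain n :: int where n: "c = d + of_int (2 * n) * pi * \<i>"
    using assms(1) unfolding exp_eq by blast
  have "ray v c = ray v d + imag_vec (\<chi> i. 2 * pi * of_int ((\<chi> i. n * v $ i) $ i))"
    by (simp add: n ray_def imag_vec_def vec_eq_iff algebra_simps)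
  then show ?thesis using H_add[OF assms(2)] H_period[OF assms(2)] by metis
qed

text \<open>Lets the torus element \<open>(f x)\<^sup>v\<close> act on \<open>x\<close>. In monomial
  coordinates this is the map with exponent matrix \<open>1 + v l\<^sup>T\<close>, where
  \<open>l\<close> is the weight of \<open>f\<close>.\<close>

definition twist :: "('a \<Rightarrow> complex) \<Rightarrow> int^'n \<Rightarrow> 'a \<Rightarrow> 'a"
  where "twist f v x = R (ray v (Ln (f x))) x"

lemma twist_in [simp]: "x \<in> X \<Longrightarrow> twist f v x \<in> X"
  by (simp add: twist_def)

lemma Wt_twist:
  assumes "g \<in> Wt k" "x \<in> X" "f x \<noteq> 0"
  shows "g (twist f v x) = f x powi (idot k v) * g x"
  unfolding twist_def using R_Wt[OF assms(1,2)] by (simp add: kdot_ray exp_int_mult_Ln[OF assms(3)])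

text \<open>\<open>Ln\<close> jumps at its cut, but another branch of the logarithm of
  \<open>f x\<close> moves \<open>x\<close> to the same point, so a branch continuous near a given
  value may be used.\<close>

lemma twist_continuous:
  assumes f: "f \<in> \<O>" "\<And>x. x \<in> X \<Longrightarrow> f x \<noteq> 0"
  shows "continuous_map M M (twist f v)"
  unfolding continuous_map_def
proof (intro conjI allI impI)
  show "twist f v \<in> X \<rightarrow> X" by auto
  fix U assume U: "openin M U"
  show "openin M {x \<in> X. twist f v x \<in> U}"
  proof (subst openin_subopen, intro ballI)
    fix y assume y: "y \<in> {x \<in> X. twist f v x \<in> U}"
    then have yX: "y \<in> X" and fy: "f y \<noteq> 0" using f(2) by auto
    define W where "W = {x \<in> X. f x \<in> {z. z / f y \<in> - \<real>\<^sub>\<le>\<^sub>0}}"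
    \<comment> \<open>a branch of the logarithm that is continuous near \<open>f y\<close>\<close>
    define b where "b = (\<lambda>x. Ln (f x / f y) + Ln (f y))"
    have "open ((\<lambda>z. z / f y) -` (- \<real>\<^sub>\<le>\<^sub>0))"
      by (intro open_vimage open_Compl closed_nonpos_Reals_complex continuous_intros) (use fy in auto)
    then have W: "openin M W"
      unfolding W_def
      using openin_continuous_map_preimage[OF holomorphic_functions_continuous[OF atlas f(1)],
          of "{z. z / f y \<in> - \<real>\<^sub>\<le>\<^sub>0}"]
      by (simp add: vimage_def)
    have yW: "y \<in> W" using yX fy by (simp add: W_def)
    have WX: "W \<subseteq> X" by (auto simp: W_def)
    have eq: "twist f v x = R (ray v (b x)) x" if "x \<in> W" for x
      unfolding twist_def
    proof (rule R_ray_cong)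
      show "x \<in> X" using that WX by blast
      have "f x \<noteq> 0" using f(2) that WX by blast
      then show "exp (Ln (f x)) = exp (b x)" using fy by (simp add: b_def exp_add)
    qed
    have "continuous_map (subtopology M W) euclidean f"
      by (rule continuous_map_from_subtopology[OF holomorphic_functions_continuous[OF atlas f(1)]])
    then have "continuous_map (subtopology M W) (top_of_set {z. z / f y \<in> - \<real>\<^sub>\<le>\<^sub>0}) f"
      by (auto simp: continuous_map_in_subtopology W_def)
    moreover have "continuous_map (top_of_set {z. z / f y \<in> - \<real>\<^sub>\<le>\<^sub>0}) euclidean (\<lambda>z. ray v (Ln (z / f y) + Ln (f y)))"
      unfolding ray_def
      by (simp, intro continuous_on_vec_lambda continuous_intros continuous_on_Ln') (use fy in auto)
    ultimately have "continuous_map (subtopology M W) euclidean ((\<lambda>z. ray v (Ln (z / f y) + Ln (f y))) \<circ> f)"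
      by (rule continuous_map_compose)
    then have "continuous_map (subtopology M W) euclidean (\<lambda>x. ray v (b x))"
      by (simp add: b_def o_def)
    moreover have "continuous_map (subtopology M W) M (\<lambda>x. x)"
      by (intro continuous_map_from_subtopology) simp
    ultimately have "continuous_map (subtopology M W) (prod_topology euclidean M) (\<lambda>x. (ray v (b x), x))"
      by (intro continuous_map_pairedI)
    from continuous_map_compose[OF this H_cont]
    have "continuous_map (subtopology M W) M (\<lambda>x. R (ray v (b x)) x)" by (simp add: o_def)
    from openin_continuous_map_preimage[OF this U]
    have "openin M {x \<in> topspace (subtopology M W). R (ray v (b x)) x \<in> U}"
      using W openin_trans_full by blast
    moreover have "{x \<in> topspace (subtopology M W). R (ray v (b x)) x \<in> U} = {x \<in> W. twist f v x \<in> U}"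
      using WX eq by auto
    ultimately show "\<exists>T. openin M T \<and> y \<in> T \<and> T \<subseteq> {x \<in> X. twist f v x \<in> U}"
      using yW y WX by (intro exI[of _ "{x \<in> W. twist f v x \<in> U}"]) auto
  qed
qed

text \<open>In a weight chart the twist multiplies each coordinate by an integer power of
  \<open>f\<close>.\<close>

lemma twist_pullback:
  assumes f: "f \<in> Wt l" "\<And>x. x \<in> X \<Longrightarrow> f x \<noteq> 0" and u: "u \<in> \<O>"
  shows "(\<lambda>x. u (twist f v x)) \<in> \<O>"
proof (rule holomorphic_map_pullback[OF atlas atlas _ u])
  have fO: "f \<in> \<O>" by (rule Wt_holomorphic[OF f(1)])
  show "holomorphic_map M \<A> M \<A> (twist f v)"
  proof (rule holomorphic_mapI[OF atlas atlas twist_continuous[OF fO f(2)]])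
    fix y assume y: "y \<in> X"
    obtain V g \<kappa> where V: "weight_chart V g \<kappa>" "twist f v y \<in> V"
      using weight_chart_exists[OF twist_in[OF y]] by blast
    have "(\<lambda>x. (\<chi> i. g i (twist f v x)) $ i) \<in> \<O>" for i
    proof (rule holomorphic_functions_cong[OF atlas])
      show "(\<lambda>x. f x powi (idot (\<kappa> i) v) * g i x) \<in> \<O>"
        by (intro holomorphic_functions_mult holomorphic_functions_powi atlas fO f(2) weight_chartD(5)[OF V(1)])
    qed (simp add: Wt_twist[OF weight_chartD(4)[OF V(1)]] f(2))
    then show "\<exists>W h. twist f v y \<in> W \<and> compat_chart M \<A> W h \<and> (\<forall>i. (\<lambda>y. h (twist f v y) $ i) \<in> \<O>)"
      using V(2) weight_chartD(1)[OF V(1)] by blast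
  qed simp
qed

text \<open>\<open>e\<close> is the determinant of the exponent matrix
  \<open>1 + v l\<^sup>T\<close>. When it is 1 or -1, the inverse matrix is
  \<open>1 - e v l\<^sup>T\<close>, again that of a twist by \<open>f\<close>, now in direction
  \<open>- e *s v\<close>.\<close>

lemma twist_twist:
  assumes f: "f \<in> Wt l" "\<And>x. x \<in> X \<Longrightarrow> f x \<noteq> 0" and e: "e = 1 \<or> e = - 1" "idot l v = e - 1" and x: "x \<in> X"
  shows "twist f (- e *s v) (twist f v x) = x"
proof -
  have fx: "f x \<noteq> 0" using f(2) x by blast
  have "f (twist f v x) = f x powi (e - 1) * f x powi 1"
    using Wt_twist[where g=f and f=f and v=v, OF f(1) x fx] e(2) by simp
  also have "\<dots> = f x powi e" using power_int_add[of "f x" "e - 1" 1] fx by simp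
  finally have "exp (Ln (f (twist f v x))) = exp (of_int e * Ln (f x))"
    using fx f(2)[OF twist_in[OF x]] by (simp add: exp_int_mult_Ln)
  then have "twist f (- e *s v) (twist f v x) = R (ray (- e *s v) (of_int e * Ln (f x))) (R (ray v (Ln (f x))) x)"
    unfolding twist_def[of f "- e *s v"] using R_ray_cong[OF _ twist_in[OF x]] by (metis twist_def)
  also have "\<dots> = R (ray (- e *s v) (of_int e * Ln (f x)) + ray v (Ln (f x))) x"
    by (rule H_add[OF x, symmetric])
  also have "ray (- e *s v) (of_int e * Ln (f x)) + ray v (Ln (f x)) = 0"
    using e(1) by (auto simp: ray_def vec_eq_iff)
  finally show ?thesis using x by simp
qed

text \<open>Along the torus \<open>f\<close> gains the phase \<open>l \<cdot> \<theta>\<close>, so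
  the twist flows further along \<open>v\<close> by that angle.\<close>

lemma twist_R_imag:
  assumes f: "f \<in> Wt l" "\<And>x. x \<in> X \<Longrightarrow> f x \<noteq> 0" and x: "x \<in> X"
  shows "twist f v (R (imag_vec \<theta>) x) =
    R (imag_vec (\<theta> + (\<Sum>i\<in>UNIV. of_int (l $ i) * \<theta> $ i) *\<^sub>R rvec v)) (twist f v x)"
proof -
  define s where "s = (\<Sum>i\<in>UNIV. of_int (l $ i) * \<theta> $ i)"
  have fx: "f x \<noteq> 0" using f(2) x by blast
  have "f (R (imag_vec \<theta>) x) = exp (\<i> * of_real s + Ln (f x))"
    using Wt_imag[OF f(1) x] fx by (simp add: kdot_imag_vec s_def exp_add)
  then have "exp (Ln (f (R (imag_vec \<theta>) x))) = exp (\<i> * of_real s + Ln (f x))"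
    by simp
  then have "twist f v (R (imag_vec \<theta>) x) = R (ray v (\<i> * of_real s + Ln (f x))) (R (imag_vec \<theta>) x)"
    unfolding twist_def by (rule R_ray_cong) (use x in simp)
  also have "\<dots> = R (ray v (\<i> * of_real s + Ln (f x)) + imag_vec \<theta>) x"
    by (rule H_add[OF x, symmetric])
  also have "ray v (\<i> * of_real s + Ln (f x)) + imag_vec \<theta> = imag_vec (\<theta> + s *\<^sub>R rvec v) + ray v (Ln (f x))"
    by (simp add: ray_def imag_vec_def rvec_def vec_eq_iff algebra_simps)
  also have "R \<dots> x = R (imag_vec (\<theta> + s *\<^sub>R rvec v)) (twist f v x)"
    unfolding twist_def by (rule H_add[OF x])
  finally show ?thesis by (simp add: s_def)
qed

lemma twist_Aut:
  assumes f: "f \<in> Wt l" "\<And>x. x \<in> X \<Longrightarrow> f x \<noteq> 0" and e: "e = 1 \<or> e = - 1" "idot l v = e - 1"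
  shows "restrict (twist f v) X \<in> Aut M \<A>"
proof (rule AutI[OF stein_global_coordinates[OF stein], where g = "twist f (- e *s v)"])
  have fO: "f \<in> \<O>" by (rule Wt_holomorphic[OF f(1)])
  show "restrict (twist f v) X \<in> extensional X" by simp
  show "continuous_map M M (restrict (twist f v) X)"
    by (rule continuous_map_eq[OF twist_continuous[OF fO f(2)]]) auto
  show "continuous_map M M (twist f (- e *s v))" by (rule twist_continuous[OF fO f(2)])
  show "twist f (- e *s v) (restrict (twist f v) X x) = x" if "x \<in> X" for x
    using twist_twist[OF f e that] that by simp
  show "restrict (twist f v) X (twist f (- e *s v) x) = x" if x: "x \<in> X" for x
  proof -
    have "idot l (- e *s v) = - e * idot l v"
      by (simp add: idot_def sum_distrib_left mult_ac)
    also have "\<dots> = e - 1" using e by auto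
    finally have "idot l (- e *s v) = e - 1" .
    from twist_twist[OF f e(1) this x]
    have "twist f (- e *s (- e *s v)) (twist f (- e *s v) x) = x" .
    moreover have "- e *s (- e *s v) = v" using e(1) by (auto simp: vec_eq_iff)
    ultimately show ?thesis using x by simp
  qed
  show "(\<lambda>x. u (restrict (twist f v) X x)) \<in> \<O>" if "u \<in> \<O>" for u
  proof (rule holomorphic_functions_cong[OF atlas twist_pullback[OF f that, of v]])
    fix x assume "x \<in> X"
    then show "u (twist f v x) = u (restrict (twist f v) X x)" unfolding restrict_def by presburger
  qed
  show "(\<lambda>x. u (twist f (- e *s v) x)) \<in> \<O>" if "u \<in> \<O>" for u
    by (rule twist_pullback[OF f that])
qed

lemma Wt_powi:
  assumes "f \<in> Wt l" "\<And>x. x \<in> X \<Longrightarrow> f x \<noteq> 0"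
  shows "(\<lambda>x. f x powi m) \<in> Wt (m *s l)"
proof -
  have "(cis (\<Sum>i\<in>UNIV. of_int (l $ i) * \<theta> $ i)) powi m = cis (\<Sum>i\<in>UNIV. of_int ((m *s l) $ i) * \<theta> $ i)"
    for \<theta> :: "real^'n"
    by (simp add: cis_power_int sum_distrib_left mult_ac)
  then show ?thesis
    using assms holomorphic_functions_powi[OF atlas Wt_holomorphic[OF assms(1)] assms(2)]
    by (simp add: Wt_def power_int_mult_distrib)
qed

text \<open>A torus-normalizing automorphism \<open>twist f v\<close> acts on the torus by \<open>\<theta> \<mapsto> \<theta> + (l \<cdot> \<theta>) v\<close>.
  On \<open>\<complex>\<^sup>n\<close> this forces the exponents \<open>\<delta> i j + v j * l i\<close> to be nonnegative. In dimension at least two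
  a vector \<open>v\<close> orthogonal to \<open>l\<close> violates this; in dimension one the inversion of the punctured
  plane does.\<close>

lemma no_units:
  assumes rigid: "\<And>\<psi> l v i j. \<psi> \<in> Aut M \<A> \<Longrightarrow>
      (\<And>x \<theta>. x \<in> X \<Longrightarrow> \<psi> (R (imag_vec \<theta>) x) =
        R (imag_vec (\<theta> + (\<Sum>i\<in>UNIV. of_int (l $ i) * \<theta> $ i) *\<^sub>R rvec v)) (\<psi> x)) \<Longrightarrow>
      (if i = j then 1 else 0) + v $ j * l $ i \<ge> 0"
    and f: "f \<in> Wt l" "f' \<in> Wt (- l)" "nonzero f" "nonzero f'"
  shows "l = 0"
proof (rule ccontr)
  have rigid': "(if i = j then 1 else 0) + v $ j * k $ i \<ge> 0"
    if u: "u \<in> Wt k" "\<And>x. x \<in> X \<Longrightarrow> u x \<noteq> 0" and e: "e = 1 \<or> e = - 1" "idot k v = e - 1" for u k v e i j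
  proof (rule rigid[OF twist_Aut[OF u e]])
    fix x \<theta> assume "x \<in> X"
    then show "restrict (twist u v) X (R (imag_vec \<theta>) x) =
        R (imag_vec (\<theta> + (\<Sum>i\<in>UNIV. of_int (k $ i) * \<theta> $ i) *\<^sub>R rvec v)) (restrict (twist u v) X x)"
      using twist_R_imag[OF u] by simp
  qed
  have fnv: "f x \<noteq> 0" if "x \<in> X" for x by (rule unit_nonvanishing[OF f that])
  assume "l \<noteq> 0"
  then obtain a where a: "l $ a \<noteq> 0" by (auto simp: vec_eq_iff)
  show False
  proof (cases "\<exists>b. b \<noteq> a")
    case True
    then obtain b where b: "b \<noteq> a" by blast
    \<comment> \<open>Orthogonal to \<open>l\<close>, so the twist has determinant 1; the entry at
      \<open>a\<close>, \<open>b\<close> is \<open>- (l $ a)\<^sup>2\<close>.\<close>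
    define v where "v = (\<chi> i. if i = a then l $ b else if i = b then - l $ a else 0)"
    have "idot l v = (\<Sum>i\<in>{a,b}. l $ i * v $ i)"
      unfolding idot_def by (rule sum.mono_neutral_right) (auto simp: v_def)
    then have "idot l v = 1 - 1" using b by (simp add: v_def)
    from rigid'[OF f(1) fnv _ this, of a b] have "(if a = b then 1 else 0) + v $ b * l $ a \<ge> 0" by blast
    then show False using b a by (simp add: v_def) (metis not_square_less_zero order_antisym_conv linorder_not_less mult_eq_0_iff)
  next
    case False
    then have UNIV_a: "UNIV = {a}" by blast
    have eqI: "k = k'" if "k $ a = k' $ a" for k k' :: "int^'n"
      using that False by (metis vec_eq_iff)
    have unit: "u x \<noteq> 0" if u: "u \<in> Wt k" "nonzero u" and x: "x \<in> X" for u k x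
    proof -
      \<comment> \<open>In dimension one all weights are commensurable: \<open>m\<close> and
        \<open>N\<close> make the weight of \<open>f\<close> to the power \<open>m\<close> opposite
        to that of \<open>u ^ N\<close>.\<close>
      define m where "m = - (sgn (l $ a) * k $ a)"
      define N where "N = nat \<bar>l $ a\<bar>"
      have unz: "nonzero (\<lambda>x. u x ^ N)" using u(2) by (auto simp: nonzero_def)
      have "(\<lambda>x. u x ^ n) \<in> Wt (int n *s k)" for n
      proof (induction n)
        case 0 then show ?case using Wt_one by simp
      next
        case (Suc n)
        have "int (Suc n) *s k = k + int n *s k" by (simp add: vec_eq_iff algebra_simps)
        then show ?case using Wt_mult[OF u(1) Suc] by simp
      qed
      then have uN: "(\<lambda>x. u x ^ N) \<in> Wt (int N *s k)" .
      have "m *s l = - (int N *s k)"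
        by (rule eqI) (auto simp: m_def N_def sgn_if abs_if)
      then have fm: "(\<lambda>x. f x powi m) \<in> Wt (- (int N *s k))"
        using Wt_powi[OF f(1) fnv, of m] by simp
      have fmnz: "nonzero (\<lambda>x. f x powi m)" using fnv x by (auto simp: nonzero_def)
      have "u x ^ N \<noteq> 0" by (rule unit_nonvanishing[OF uN fm unz fmnz x])
      moreover have "N > 0" using a by (simp add: N_def)
      ultimately show ?thesis by auto
    qed
    \<comment> \<open>The least positive weight \<open>d\<close> divides all weights, so the
      rotation by \<open>2 * pi / d\<close> acts trivially; as only periods do so, \<open>d\<close>
      is 1.\<close>
    define T where "T = {n. n > 0 \<and> (\<exists>k u. k $ a = int n \<and> u \<in> Wt k \<and> nonzero u)}"
    have pnz: "nonzero u" if "\<And>x. x \<in> X \<Longrightarrow> u x \<noteq> 0" for u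
      using that point_exists unfolding nonzero_def by blast
    have "nat \<bar>l $ a\<bar> \<in> T"
    proof -
      have "nonzero (\<lambda>x. f x powi sgn (l $ a))" using fnv by (intro pnz) simp
      moreover have "(sgn (l $ a) *s l) $ a = int (nat \<bar>l $ a\<bar>)" by (auto simp: sgn_if abs_if)
      ultimately have "\<exists>k u. k $ a = int (nat \<bar>l $ a\<bar>) \<and> u \<in> Wt k \<and> nonzero u"
        using Wt_powi[OF f(1) fnv, of "sgn (l $ a)"] by blast
      then show ?thesis using a unfolding T_def mem_Collect_eq by (intro conjI) simp_all
    qed
    define d where "d = (LEAST n. n \<in> T)"
    have "d \<in> T" unfolding d_def using \<open>nat \<bar>l $ a\<bar> \<in> T\<close> by (rule LeastI)
    then obtain k u where d: "d > 0" and k: "k $ a = int d" "u \<in> Wt k" "nonzero u" by (auto simp: T_def)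
    have least: "d \<le> n" if "n \<in> T" for n unfolding d_def using that by (rule Least_le)
    have unv: "u x \<noteq> 0" if "x \<in> X" for x by (rule unit[OF k(2,3) that])
    have dvd: "int d dvd k' $ a" if u': "u' \<in> Wt k'" "nonzero u'" for k' u'
    proof (rule ccontr)
      assume "\<not> int d dvd k' $ a"
      then have md: "k' $ a mod int d > 0" "k' $ a mod int d < int d"
      proof -
        have "k' $ a mod int d \<noteq> 0" using \<open>\<not> int d dvd k' $ a\<close> by (simp add: dvd_eq_mod_eq_0)
        moreover have "0 \<le> k' $ a mod int d" "k' $ a mod int d < int d" using d by simp_all
        ultimately show "k' $ a mod int d > 0" "k' $ a mod int d < int d" by linarith+
      qed
      define q where "q = - (k' $ a div int d)"
      have "(\<lambda>x. u' x * u x powi q) \<in> Wt (k' + q *s k)"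
        by (rule Wt_mult[OF u'(1) Wt_powi[OF k(2) unv]])
      moreover have "nonzero (\<lambda>x. u' x * u x powi q)"
        using unit[OF u'] unv by (intro pnz) simp
      moreover have "(k' + q *s k) $ a = int (nat (k' $ a mod int d))"
        using md(1) by (simp add: q_def k(1) minus_div_mult_eq_mod[symmetric])
      ultimately have "\<exists>k u. k $ a = int (nat (k' $ a mod int d)) \<and> u \<in> Wt k \<and> nonzero u" by blast
      then have "nat (k' $ a mod int d) \<in> T"
        using md(1) unfolding T_def mem_Collect_eq by (intro conjI) simp_all
      then show False using least[of "nat (k' $ a mod int d)"] md by linarith
    qed
    define w where "w = imag_vec (\<chi> i::'n. 2 * pi / real d)"
    have "R w x = x" if x: "x \<in> X" for x
    proof (rule weight_separate)
      fix k' u' assume u': "u' \<in> Wt k'"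
      show "u' (R w x) = u' x"
      proof (cases "nonzero u'")
        case True
        then obtain m where m: "k' $ a = int d * m" using dvd[OF u'] by blast
        have "kdot k' w = of_int (2 * m) * pi * \<i>"
          using d by (simp add: w_def kdot_imag_vec UNIV_a m)
        then have "exp (kdot k' w) = 1" unfolding exp_eq_1 by auto
        then show ?thesis using R_Wt[OF u' x] by simp
      next
        case False
        then show ?thesis using x by (simp add: nonzero_def)
      qed
    qed (use x in auto)
    then obtain m :: int where "w $ a = \<i> * of_real (2 * pi * of_int m)"
      using H_id_iff[of w] by blast
    then have "(2 * pi) * (1 / real d) = (2 * pi) * of_int m" by (simp add: w_def imag_vec_def complex_eq_iff)
    then have "1 / real d = of_int m" unfolding mult_cancel_left by simp
    then have "of_int (m * int d) = (1::real)" using d by (simp add: field_simps)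
    then have "m * int d = 1" by linarith
    then have "int d dvd 1" by (metis dvd_triv_right)
    then have "d = 1" by simp
    then have ka: "k $ a = 1" using k(1) by simp
    \<comment> \<open>With weight 1 the twist in direction -2 acts on exponents like the inversion
      \<open>z \<mapsto> 1/z\<close>: its only exponent, and so its determinant, is
      \<open>1 - 2\<close>.\<close>
    define v :: "int^'n" where "v = (\<chi> i. - 2)"
    have "idot k v = - 1 - 1" by (simp add: idot_def UNIV_a ka v_def)
    from rigid'[OF k(2) unv _ this, of a a] have "1 + v $ a * k $ a \<ge> 0" by simp
    then show False by (simp add: v_def ka)
  qed
qed

end

section \<open>The automorphism group of complex Euclidean space\<close>

lemma Aut_group_carrier [simp]: "carrier (Aut_group M \<A>) = Aut M \<A>"
  by (simp add: Aut_group_def)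

lemma Aut_group_mult:
  assumes "f \<in> Aut M \<A>" "g \<in> Aut M \<A>"
  shows "f \<otimes>\<^bsub>Aut_group M \<A>\<^esub> g = compose (topspace M) f g"
proof -
  have "f \<in> Bij (topspace M)" "g \<in> Bij (topspace M)"
    using assms by (auto simp: Aut_def biholomorphic_map_def Bij_def)
  then show ?thesis by (simp add: Aut_group_def BijGroup_def)
qed

lemma Aut_compose:
  assumes gc: "global_coordinates M \<A>" and f: "f \<in> Aut M \<A>" and g: "g \<in> Aut M \<A>"
  shows "compose (topspace M) f g \<in> Aut M \<A>"
proof -
  have at: "holomorphic_atlas M \<A>" using gc by (simp add: global_coordinates_def)
  note F = AutD[OF at f] and G = AutD[OF at g]
  show ?thesis
  proof (rule AutI[OF gc, where g = "\<lambda>x. inv_into (topspace M) g (inv_into (topspace M) f x)"])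
    show "continuous_map M M (compose (topspace M) f g)"
      by (rule continuous_map_eq[OF continuous_map_compose[OF G(2) F(2)]]) (simp add: compose_def)
    show "continuous_map M M (\<lambda>x. inv_into (topspace M) g (inv_into (topspace M) f x))"
      using continuous_map_compose[OF F(3) G(3)] by (simp add: o_def)
    show "(\<lambda>x. u (compose (topspace M) f g x)) \<in> holomorphic_functions M \<A>"
      if "u \<in> holomorphic_functions M \<A>" for u
      by (rule holomorphic_functions_cong[OF at G(8)[OF F(8)[OF that]]]) (simp add: compose_def)
    show "(\<lambda>x. u (inv_into (topspace M) g (inv_into (topspace M) f x))) \<in> holomorphic_functions M \<A>"
      if "u \<in> holomorphic_functions M \<A>" for u
      by (rule F(9)[OF G(9)[OF that]])
  qed (simp_all add: compose_def F G)
qed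

lemma Aut_id:
  assumes gc: "global_coordinates M \<A>"
  shows "(\<lambda>x\<in>topspace M. x) \<in> Aut M \<A>"
proof (rule AutI[OF gc, where g = "\<lambda>x. x"])
  have at: "holomorphic_atlas M \<A>" using gc by (simp add: global_coordinates_def)
  show "continuous_map M M (\<lambda>x\<in>topspace M. x)"
    by (rule continuous_map_eq[of _ _ "\<lambda>x. x"]) auto
  show "(\<lambda>x. u ((\<lambda>x\<in>topspace M. x) x)) \<in> holomorphic_functions M \<A>"
    if "u \<in> holomorphic_functions M \<A>" for u
    by (rule holomorphic_functions_cong[OF at that]) simp
qed auto

section \<open>Diagonal maps and torus weights on complex Euclidean space\<close>

definition dil :: "complex^'n \<Rightarrow> complex^'n \<Rightarrow> complex^'n"
  where "dil w z = (\<chi> i. exp (w $ i) * z $ i)"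

lemma dil_add: "dil (w + w') z = dil w (dil w' z)"
  by (simp add: dil_def vec_eq_iff exp_add)

lemma dil_0 [simp]: "dil 0 z = z"
  by (simp add: dil_def vec_eq_iff)

lemma dil_continuous: "continuous_on UNIV (\<lambda>(w,z). dil w z)"
  unfolding dil_def split_beta
  by (intro continuous_on_vec_lambda continuous_on_mult continuous_on_exp continuous_on_component
      continuous_on_fst continuous_on_snd continuous_on_id)

lemma dil_hol: "hol_vec_at (dil w) z"
  by (simp add: hol_vec_at_def dil_def hol_at_mult)

lemma dil_Aut: "dil w \<in> Aut euclidean std_atlas"
proof (rule AutI[OF std_global_coordinates, where g = "dil (- w)"])
  have "continuous_on UNIV (\<lambda>z. (\<lambda>(w,z). dil w z) (w, z))" for w
    by (rule continuous_on_compose2[OF dil_continuous]) (auto intro!: continuous_intros)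
  then show "continuous_map euclidean euclidean (dil w)" "continuous_map euclidean euclidean (dil (- w))"
    by simp_all
  show "dil (- w) (dil w z) = z" "dil w (dil (- w) z) = z" for z
    by (simp_all flip: dil_add)
qed (auto simp: holomorphic_functions_std extensional_def intro: hol_at_compose[OF dil_hol])

lemma dil_eq_id_iff: "dil w = (\<lambda>z. z) \<longleftrightarrow> (\<forall>i. \<exists>m::int. w $ i = \<i> * of_real (2 * pi * of_int m))"
proof -
  have "exp c = 1 \<longleftrightarrow> (\<exists>m::int. c = \<i> * of_real (2 * pi * of_int m))" for c
  proof -
    have "exp c = 1 \<longleftrightarrow> Re c = 0 \<and> (\<exists>m::int. Im c = 2 * pi * of_int m)"
      unfolding exp_eq_1 by (simp add: mult_ac)
    then show ?thesis by (auto simp: complex_eq_iff)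
  qed
  moreover have "dil w = (\<lambda>z. z) \<longleftrightarrow> (\<forall>i. exp (w $ i) = 1)"
  proof
    assume "dil w = (\<lambda>z. z)"
    from fun_cong[OF this, of "\<chi> i. 1"] show "\<forall>i. exp (w $ i) = 1"
      by (simp add: dil_def vec_eq_iff)
  qed (auto simp: dil_def vec_eq_iff)
  ultimately show ?thesis by simp
qed

lemma openin_compact_open_subbasis:
  "compactin X K \<Longrightarrow> openin Y U \<Longrightarrow>
    openin (compact_open_topology X Y) {f \<in> extensional (topspace X). continuous_map X Y f \<and> f ` K \<subseteq> U}"
  unfolding compact_open_topology_def by (rule topology_generated_by_Basis) blast

text \<open>A diagonal map sending a compact \<open>K\<close> into an open \<open>U\<close> keeps
  doing so for nearby parameters, by the tube lemma.\<close>

lemma dil_continuous_Aut: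
  "continuous_map euclidean (Aut_topology (euclidean :: (complex^'n::finite) topology) std_atlas) dil"
  unfolding Aut_topology_def continuous_map_in_subtopology
proof
  let ?E = "euclidean :: (complex^'n) topology"
  have cd: "continuous_map ?E ?E (dil w)" for w :: "complex^'n"
    using AutD(2)[OF compat_chart_std(1) dil_Aut] by simp
  let ?B = "\<lambda>K U. {f \<in> extensional (topspace ?E). continuous_map ?E ?E f \<and> f ` K \<subseteq> U}"
  have dilB: "dil w \<in> ?B K U \<longleftrightarrow> dil w ` K \<subseteq> U" for w K U
    using cd[of w] by (simp add: extensional_def)
  show "continuous_map euclidean (compact_open_topology ?E ?E) dil"
    unfolding compact_open_topology_def
  proof (rule continuous_on_generated_topo)
    fix B assume "B \<in> {?B K U | K U. compactin ?E K \<and> openin ?E U}"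
    then obtain K U where K: "compact K" "open U" and B: "B = ?B K U"
      by auto
    have pre: "dil -` B \<inter> topspace euclidean = {w. dil w ` K \<subseteq> U}"
      unfolding B using dilB by auto
    have "open {w. dil w ` K \<subseteq> U}"
    proof (subst open_subopen, intro ballI)
      fix w assume w: "w \<in> {w. dil w ` K \<subseteq> U}"
      have op: "open ((\<lambda>(w,z). dil w z) -` U)" using open_vimage[OF K(2) dil_continuous] .
      have "{w} \<times> K \<subseteq> (\<lambda>(w,z). dil w z) -` U" using w by auto
      from Elementary_Topology.tube_lemma[OF K(1) op this]
      obtain T where "w \<in> T" "open T" "T \<times> K \<subseteq> (\<lambda>(w,z). dil w z) -` U" by blast
      then show "\<exists>T. open T \<and> w \<in> T \<and> T \<subseteq> {w. dil w ` K \<subseteq> U}"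
        by (intro exI[of _ T]) auto
    qed
    then show "openin euclidean (dil -` B \<inter> topspace euclidean)" unfolding pre by simp
  next
    have "dil w \<in> ?B {} UNIV" for w unfolding dilB by simp
    moreover have "?B {} UNIV \<in> {?B K U | K U. compactin ?E K \<and> openin ?E U}"
      by (rule CollectI, rule exI[of _ "{}"], rule exI[of _ UNIV]) simp
    ultimately show "dil ` topspace euclidean \<subseteq> \<Union>{?B K U | K U. compactin ?E K \<and> openin ?E U}"
      by blast
  qed
  show "dil \<in> topspace euclidean \<rightarrow> Aut ?E std_atlas"
    using dil_Aut by auto
qed

text \<open>The weights of an entire function are nonnegative: multiplying by \<open>\<zeta>\<^sup>m\<close> gives an entire function
  of \<open>\<zeta>\<close> that is constant on the unit circle and vanishes at \<open>0\<close>.\<close>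

lemma entire_negative_weight:
  fixes F :: "complex^'n \<Rightarrow> complex"
  assumes hol: "\<And>z. hol_at F z" and m: "m < 0"
    and wt: "\<And>a z. F (dil (rot i a) z) = cis (of_int m * a) * F z"
  shows "F z = 0"
proof -
  \<comment> \<open>\<open>F\<close> along the \<open>i\<close>-th coordinate line through
    \<open>z\<close>, with \<open>z\<close> itself at parameter 1.\<close>
  define u where "u = (\<lambda>\<zeta>. F ((z - axis i (z $ i)) + \<zeta> *s axis i (z $ i)))"
  define N where "N = nat (- m)"
  define q where "q = (\<lambda>\<zeta>. \<zeta> ^ N * u \<zeta> - F z)"
  have "u holomorphic_on UNIV"
    unfolding u_def by (rule hol_line_holomorphic) (rule hol)
  then have q: "q holomorphic_on UNIV"
    unfolding q_def by (intro holomorphic_intros)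
  have zero: "q (cis a) = 0" for a
  proof -
    have "(z - axis i (z $ i)) + cis a *s axis i (z $ i) = dil (rot i a) z"
      by (simp add: vec_eq_iff dil_def rot_def axis_def cis_conv_exp)
    then have "u (cis a) = cis (of_int m * a) * F z" by (simp add: u_def wt)
    moreover have "cis a ^ N * cis (of_int m * a) = 1"
      unfolding Complex.DeMoivre cis_mult using m by (simp add: N_def algebra_simps)
    ultimately show ?thesis by (simp add: q_def mult.assoc[symmetric])
  qed
  have "1 islimpt sphere (0::complex) 1"
  proof (rule connected_imp_perfect)
    fix x
    show "sphere (0::complex) 1 \<noteq> {x}"
    proof
      assume "sphere (0::complex) 1 = {x}"
      moreover have "1 \<in> sphere (0::complex) 1" "-1 \<in> sphere (0::complex) 1" by simp_all
      ultimately have "1 = x" "-1 = x" by blast+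
      then show False by simp
    qed
  qed (auto simp: connected_sphere)
  moreover have "q \<zeta> = 0" if "\<zeta> \<in> sphere 0 1" for \<zeta>
  proof -
    have "\<zeta> \<noteq> 0" using that by auto
    then have "\<zeta> = cis (Arg \<zeta>)" using that cis_Arg[of \<zeta>] by (simp add: sgn_div_norm)
    then show ?thesis using zero by metis
  qed
  ultimately have "q 0 = 0"
    using analytic_continuation[OF q open_UNIV connected_UNIV, of "sphere 0 1" 1 0] by blast
  moreover have "N > 0" using m by (simp add: N_def)
  ultimately show ?thesis by (simp add: q_def zero_power)
qed

text \<open>Under the \<open>i\<close>-th circle the \<open>j\<close>-th component of
  \<open>g\<close> has the weight in question; were it negative, the component would vanish
  identically and \<open>g\<close> could not be surjective.\<close>

lemma Aut_std_weights:
  fixes g :: "complex^'n::finite \<Rightarrow> complex^'n"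
  assumes g: "g \<in> Aut euclidean std_atlas"
    and wt: "\<And>\<theta> z. g (dil (imag_vec \<theta>) z) = dil (imag_vec (\<theta> + (\<Sum>i\<in>UNIV. of_int (l $ i) * \<theta> $ i) *\<^sub>R rvec v)) (g z)"
  shows "(if i = j then 1 else 0) + v $ j * l $ i \<ge> 0"
proof (rule ccontr)
  define m where "m = (if i = j then 1 else 0) + v $ j * l $ i"
  assume "\<not> ?thesis"
  then have m: "m < 0" by (simp add: m_def)
  have "g z $ j = 0" for z
  proof (rule entire_negative_weight[of "\<lambda>z. g z $ j", OF _ m])
    show "hol_at (\<lambda>z. g z $ j) z" for z
      using AutD(8)[OF compat_chart_std(1) g, of "\<lambda>z. z $ j"] by (simp add: holomorphic_functions_std)
    fix a z
    have "rot i a = imag_vec (axis i a)"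
      by (simp add: rot_def imag_vec_def axis_def vec_eq_iff)
    moreover have "(\<Sum>k\<in>UNIV. of_int (l $ k) * axis i a $ k) = of_int (l $ i) * a"
      by (simp add: axis_def if_distrib sum.delta cong: if_cong)
    ultimately have "g (dil (rot i a) z) $ j = exp (imag_vec (axis i a + (of_int (l $ i) * a) *\<^sub>R rvec v) $ j) * g z $ j"
      by (simp add: wt) (simp add: dil_def)
    also have "exp (imag_vec (axis i a + (of_int (l $ i) * a) *\<^sub>R rvec v) $ j) = cis (of_int m * a)"
      by (simp add: imag_vec_def rvec_def axis_def m_def cis_conv_exp algebra_simps)
    finally show "g (dil (rot i a) z) $ j = cis (of_int m * a) * g z $ j" .
  qed
  moreover have "g (inv_into UNIV g (axis j 1)) = axis j 1"
    using AutD(7)[OF compat_chart_std(1) g, of "axis j 1"] by simp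
  ultimately have "(axis j 1 :: complex^'n) $ j = 0" by metis
  then show False by simp
qed

text \<open>Evaluation is continuous because \<open>M\<close> is locally compact: a closed chart
  ball around \<open>x\<close> is a compact neighbourhood to which the compact-open topology
  applies.\<close>

lemma Aut_topology_eval:
  assumes at: "holomorphic_atlas M \<A>" and H: "continuous_map euclidean (Aut_topology M \<A>) H"
  shows "continuous_map (prod_topology euclidean M) M (\<lambda>(w,x). H w x)"
proof -
  have HA: "H w \<in> Aut M \<A>" for w
    using continuous_map_image_subset_topspace[OF H] by (auto simp: Aut_topology_def)
  have Hc: "continuous_map M M (H w)" for w by (rule AutD(2)[OF at HA])
  have HX: "H w x \<in> topspace M" if "x \<in> topspace M" for w x by (rule AutD(4)[OF at HA that])
  have H': "continuous_map euclidean (compact_open_topology M M) H"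
    using H unfolding Aut_topology_def by (rule continuous_map_into_fulltopology)
  have "openin (prod_topology euclidean M) {p \<in> topspace (prod_topology euclidean M). (\<lambda>(w,x). H w x) p \<in> U}"
    if U: "openin M U" for U
    unfolding openin_prod_topology_alt
  proof (intro allI impI)
    fix w x assume "(w, x) \<in> {p \<in> topspace (prod_topology euclidean M). (\<lambda>(w,x). H w x) p \<in> U}"
    then have x: "x \<in> topspace M" "H w x \<in> U" by auto
    obtain V \<phi> where V: "(V,\<phi>) \<in> \<A>" "x \<in> V" using atlas_chart_at[OF at x(1)] by blast
    have cV: "compat_chart M \<A> V \<phi>" by (rule compat_chart_member[OF at V(1)])
    have "openin M {y \<in> topspace M. H w y \<in> U}" by (rule openin_continuous_map_preimage[OF Hc U])
    from compat_chart_inv_preimage[OF cV this]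
    have "open {z \<in> \<phi> ` V. inv_into V \<phi> z \<in> {y \<in> topspace M. H w y \<in> U}}" .
    moreover have "\<phi> x \<in> {z \<in> \<phi> ` V. inv_into V \<phi> z \<in> {y \<in> topspace M. H w y \<in> U}}"
      using x V(2) compat_chart_inv(3)[OF cV V(2)] by simp
    ultimately obtain r where r: "r > 0" "cball (\<phi> x) r \<subseteq> {z \<in> \<phi> ` V. inv_into V \<phi> z \<in> {y \<in> topspace M. H w y \<in> U}}"
      unfolding open_contains_cball by blast
    define K where "K = inv_into V \<phi> ` cball (\<phi> x) r"
    have "compactin (top_of_set (\<phi> ` V)) (cball (\<phi> x) r)"
      using r(2) by (auto simp: compactin_subtopology)
    then have K: "compactin M K"
      unfolding K_def by (rule image_compactin[OF _ compat_chart_continuous_inv[OF cV]])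
    define B where "B = {f \<in> extensional (topspace M). continuous_map M M f \<and> f ` K \<subseteq> U}"
    have "openin (compact_open_topology M M) B"
      unfolding B_def by (rule openin_compact_open_subbasis[OF K U])
    from openin_continuous_map_preimage[OF H' this]
    have T: "openin euclidean {w. H w \<in> B}" by simp
    define W where "W = {y \<in> V. \<phi> y \<in> ball (\<phi> x) r}"
    have W: "openin M W" unfolding W_def by (rule compat_chart_open_preimage[OF cV open_ball])
    have "w \<in> {w. H w \<in> B}"
      using r(2) Hc AutD(1)[OF at HA] by (auto simp: B_def K_def)
    moreover have "x \<in> W" using V(2) r(1) by (simp add: W_def)
    moreover have "{w. H w \<in> B} \<times> W \<subseteq> {p \<in> topspace (prod_topology euclidean M). (\<lambda>(w,x). H w x) p \<in> U}"
    proof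
      fix q assume "q \<in> {w. H w \<in> B} \<times> W"
      then obtain w' y where q: "q = (w', y)" and w': "H w' \<in> B" and y: "y \<in> W" by blast
      have "y \<in> K"
      proof -
        have "y = inv_into V \<phi> (\<phi> y)" "\<phi> y \<in> cball (\<phi> x) r"
          using y compat_chart_inv(3)[OF cV] by (auto simp: W_def)
        then show ?thesis unfolding K_def by blast
      qed
      then have "H w' y \<in> U" using w' by (auto simp: B_def)
      moreover have "y \<in> topspace M" using y openin_subset[OF W] by blast
      ultimately show "q \<in> {p \<in> topspace (prod_topology euclidean M). (\<lambda>(w,x). H w x) p \<in> U}"
        by (simp add: q)
    qed
    ultimately show "\<exists>T W. openin euclidean T \<and> openin M W \<and> w \<in> T \<and> x \<in> W \<and>
        T \<times> W \<subseteq> {p \<in> topspace (prod_topology euclidean M). (\<lambda>(w,x). H w x) p \<in> U}"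
      using T W by blast
  qed
  then show ?thesis using HX by (auto simp: continuous_map_def)
qed

theorem theorem1p1:
  fixes M :: "'a topology" and \<A> :: "('a, 'n::finite) atlas"
  assumes "stein_manifold M \<A>"
    and "connected_space M"
    and "isomorphic_topological_groups
           (Aut_group M \<A>) (Aut_topology M \<A>)
           (Aut_group (euclidean :: (complex^'n) topology) std_atlas)
           (Aut_topology (euclidean :: (complex^'n) topology) std_atlas)"
  shows "biholomorphically_equivalent M \<A> (euclidean :: (complex^'n) topology) std_atlas"
proof -
  let ?E = "euclidean :: (complex^'n) topology"
  have gc: "global_coordinates M \<A>" by (rule stein_global_coordinates[OF assms(1)])
  have at: "holomorphic_atlas M \<A>" using gc by (simp add: global_coordinates_def)
  obtain h where iso: "h \<in> iso (Aut_group M \<A>) (Aut_group ?E std_atlas)"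
    and homeo: "homeomorphic_map (Aut_topology M \<A>) (Aut_topology ?E std_atlas) h"
    using assms(3) unfolding isomorphic_topological_groups_def by blast
  have hE: "h f \<in> Aut ?E std_atlas" if "f \<in> Aut M \<A>" for f
    using iso that by (auto simp: iso_def hom_def)
  have h_inj: "f = g" if "f \<in> Aut M \<A>" "g \<in> Aut M \<A>" "h f = h g" for f g
    using iso that by (auto simp: iso_def bij_betw_def dest: inj_onD)
  have h_compose: "h (compose (topspace M) f g) = (\<lambda>z. h f (h g z))" if fg: "f \<in> Aut M \<A>" "g \<in> Aut M \<A>" for f g
  proof -
    have "h (f \<otimes>\<^bsub>Aut_group M \<A>\<^esub> g) = h f \<otimes>\<^bsub>Aut_group ?E std_atlas\<^esub> h g"
      using iso fg by (auto simp: iso_def hom_def)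
    then show ?thesis
      by (simp add: Aut_group_mult[OF fg] Aut_group_mult[OF hE[OF fg(1)] hE[OF fg(2)]] compose_def restrict_UNIV)
  qed
  obtain k where k: "homeomorphic_maps (Aut_topology M \<A>) (Aut_topology ?E std_atlas) h k"
    using homeo unfolding homeomorphic_map_maps by blast
  \<comment> \<open>Continuity of the inverse homeomorphism \<open>k\<close> makes the transported
    family continuous in \<open>w\<close>.\<close>
  define H where "H = (\<lambda>w. k (dil w))"
  have "continuous_map (Aut_topology ?E std_atlas) (Aut_topology M \<A>) k"
    using k by (simp add: homeomorphic_maps_def)
  from continuous_map_compose[OF dil_continuous_Aut this]
  have Hcont: "continuous_map euclidean (Aut_topology M \<A>) H" by (simp add: H_def o_def)
  have HA: "H w \<in> Aut M \<A>" for w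
    using continuous_map_image_subset_topspace[OF Hcont] by (auto simp: Aut_topology_def)
  have hH: "h (H w) = dil w" for w
  proof -
    have "dil w \<in> topspace (Aut_topology ?E std_atlas)"
      using continuous_map_image_subset_topspace[OF dil_continuous_Aut] by auto
    then show ?thesis using k by (simp add: homeomorphic_maps_def H_def)
  qed
  have H_comp: "compose (topspace M) (H w) (H w') = H (w + w')" for w w'
    by (rule h_inj[OF Aut_compose[OF gc HA HA] HA])
       (simp add: h_compose[OF HA HA] hH fun_eq_iff dil_add)
  \<comment> \<open>The image is idempotent and injective, hence the identity.\<close>
  have h_id: "h (\<lambda>x\<in>topspace M. x) = (\<lambda>z. z)"
  proof -
    define e where "e = h (\<lambda>x\<in>topspace M. x)"
    have idA: "(\<lambda>x\<in>topspace M. x) \<in> Aut M \<A>" by (rule Aut_id[OF gc])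
    have "compose (topspace M) (\<lambda>x\<in>topspace M. x) (\<lambda>x\<in>topspace M. x) = (\<lambda>x\<in>topspace M. x)"
      by (auto simp: compose_def restrict_def)
    then have ee: "e (e z) = e z" for z
      using h_compose[OF idA idA] by (simp add: e_def fun_eq_iff)
    have "e z = z" for z
      using AutD(6)[OF compat_chart_std(1) hE[OF idA]] ee[of z] by (metis UNIV_I e_def topspace_euclidean)
    then show ?thesis by (simp add: e_def[symmetric] fun_eq_iff)
  qed
  interpret torus_action M \<A> H
  proof
    show "stein_manifold M \<A>" "connected_space M" by (rule assms)+
    show "continuous_map (prod_topology euclidean M) M (\<lambda>(w,x). H w x)"
      by (rule Aut_topology_eval[OF at Hcont])
    show "(\<lambda>x. f (H w x)) \<in> holomorphic_functions M \<A>" if "f \<in> holomorphic_functions M \<A>" for f w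
      by (rule AutD(8)[OF at HA that])
    show "H (w + w') x = H w (H w' x)" if "x \<in> topspace M" for w w' x
      using that by (simp add: H_comp[symmetric] compose_def)
    show "(\<forall>x\<in>topspace M. H w x = x) \<longleftrightarrow> (\<forall>i. \<exists>m::int. w $ i = \<i> * of_real (2 * pi * of_int m))" for w
    proof -
      have "(\<forall>x\<in>topspace M. H w x = x) \<longleftrightarrow> H w = (\<lambda>x\<in>topspace M. x)"
      proof
        assume "\<forall>x\<in>topspace M. H w x = x"
        then show "H w = (\<lambda>x\<in>topspace M. x)"
          using AutD(1)[OF at HA[of w]] by (intro extensionalityI[of _ "topspace M"]) auto
      qed simp
      also have "\<dots> \<longleftrightarrow> dil w = (\<lambda>z. z)"
        using h_inj[OF HA[of w] Aut_id[OF gc]] hH[of w] h_id by metis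
      finally show ?thesis using dil_eq_id_iff[of w] by simp
    qed
  qed
  obtain R where R: "toric_action M \<A> R" "\<And>\<theta> x. R (imag_vec \<theta>) x = H (imag_vec \<theta>) x"
    using toric_extension by blast
  interpret R: toric_action M \<A> R by (rule R(1))
  have rigid: "(if i = j then 1 else 0) + v $ j * l $ i \<ge> 0"
    if \<psi>: "\<psi> \<in> Aut M \<A>" and conj: "\<And>x \<theta>. x \<in> topspace M \<Longrightarrow> \<psi> (R (imag_vec \<theta>) x) =
        R (imag_vec (\<theta> + (\<Sum>i\<in>UNIV. of_int (l $ i) * \<theta> $ i) *\<^sub>R rvec v)) (\<psi> x)" for \<psi> l v i j
  proof (rule Aut_std_weights[OF hE[OF \<psi>]])
    fix \<theta> z
    define \<theta>' where "\<theta>' = \<theta> + (\<Sum>i\<in>UNIV. of_int (l $ i) * \<theta> $ i) *\<^sub>R rvec v"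
    \<comment> \<open>Normalizing the torus is an equation between products in
      \<open>Aut M \<A>\<close>, so the isomorphism carries it over to
      \<open>\<complex>\<^sup>n\<close>.\<close>
    have "compose (topspace M) \<psi> (H (imag_vec \<theta>)) = compose (topspace M) (H (imag_vec \<theta>')) \<psi>"
      using conj by (auto simp: compose_def R(2) \<theta>'_def fun_eq_iff restrict_def)
    then have "(\<lambda>z. h \<psi> (dil (imag_vec \<theta>) z)) = (\<lambda>z. dil (imag_vec \<theta>') (h \<psi> z))"
      using h_compose[OF \<psi> HA] h_compose[OF HA \<psi>] hH by metis
    then show "h \<psi> (dil (imag_vec \<theta>) z) = dil (imag_vec (\<theta> + (\<Sum>i\<in>UNIV. of_int (l $ i) * \<theta> $ i) *\<^sub>R rvec v)) (h \<psi> z)"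
      unfolding \<theta>'_def by (rule fun_cong)
  qed
  have "\<exists>p\<in>topspace M. \<forall>w. R w p = p"
    by (rule R.fixed_point_exists, rule R.no_units[OF rigid]) 
  then show ?thesis using R.fixed_point_biholomorphic by blast
qed

end
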